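(* Let $\Omega\subsetneq \mathbb{C}$ be a simply connected domain. The following are equivalent: (1) $\Omega$ has the Denjoy-Wolff Property; (2) every $g\in \mathrm{Aut}_d(\Omega)$ has a Denjoy-Wolff point; (3) the closure in $\mathbb{C}_\infty$ of every (Busemann) horosphere of $\Omega$ intersects $\partial \Omega$ at exactly one point; (4) every Riemann map $h:\mathbb{D}\to \Omega$ has $H$-limit at every $\sigma\in\partial\mathbb{D}$. In particular, if one (and hence all) of the previous conditions holds, then the principal part of every prime end of $\Omega$ is a single point.
   Context: $\mathbb{D}$ is the open unit disc, $\mathbb{C}_\infty$ the Riemann sphere. For a domain $\Omega\subset\mathbb{C}$, $\partial\Omega$ and $\overline{\Omega}$ denote its boundary and closure in $\mathbb{C}_\infty$. A Riemann map of $\Omega$ is a biholomorphism $h:\mathbb{D}\to\Omega$. $\mathrm{Hol}_d(\Omega,\Omega)$ is the set of holomorphic maps $f:\Omega\to\Omega$ without fixed points in $\Omega$; $\mathrm{Aut}_d(\Omega)$ is the set of those $f\in \mathrm{Hol}_d(\Omega,\Omega)$ that are automorphisms (biholomorphic self-maps) of $\Omega$. A map $f\in \mathrm{Hol}_d(\Omega,\Omega)$ has a Denjoy-Wolff point if there is $\tau\in\partial\Omega$ such that the iterates $f^{\circ n}$ converge to $\tau$ uniformly on compacta of $\Omega$ (as maps into $\mathbb{C}_\infty$). $\Omega$ has the Denjoy-Wolff Property if every $f\in \mathrm{Hol}_d(\Omega,\Omega)$ has a Denjoy-Wolff point. For $\sigma\in\partial\mathbb{D}$ and $R>0$ the horosphere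 of $\mathbb{D}$ of center $\sigma$ and radius $R$ is $E(\sigma,R)=\{z\in\mathbb{D}: \frac{|\sigma-z|^2}{1-|z|^2}<R\}$. A (Busemann) horosphere of $\Omega$ is the image $h(E(\sigma,R))$ of a horosphere of $\mathbb{D}$ under a Riemann map $h:\mathbb{D}\to\Omega$. A function $h:\mathbb{D}\to\mathbb{C}$ has $H$-limit $L\in\mathbb{C}_\infty$ at $\sigma\in\partial\mathbb{D}$ if for every sequence $\{z_n\}\subset\mathbb{D}$ converging to $\sigma$ that is eventually contained in $E(\sigma,R)$ for some $R>0$, the sequence $\{h(z_n)\}$ converges to $L$; $h$ has $H$-limit at $\sigma$ if such an $L$ exists. Prime ends of $\Omega$ are the Carathéodory prime ends. The principal part $\Pi(\underline{\xi})$ of a prime end $\underline{\xi}$ is the set of all $p\in\mathbb{C}_\infty$ for which there exist a null-chain $(C_n)$ representing $\underline{\xi}$ and points $z_n\in C_n$ such that $z_n\to p$ in $\mathbb{C}_\infty$. *)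

theory Defs
  imports "HOL-Complex_Analysis.Complex_Analysis"
begin

datatype riemann_sphere = Pt complex | Infty

text \<open>Stereographic projection onto the unit sphere of \<open>complex \<times> real\<close>, the point at infinity
  going to the north pole. The distance on the Riemann sphere is the chordal one.\<close>

fun stereo :: "riemann_sphere \<Rightarrow> complex \<times> real" where
  "stereo (Pt z) = ((2 / (1 + (cmod z)\<^sup>2)) *\<^sub>R z, ((cmod z)\<^sup>2 - 1) / (1 + (cmod z)\<^sup>2))"
| "stereo Infty = (0, 1)"

lemma one_plus_cmod_pos [simp]: "1 + (cmod z)\<^sup>2 > 0" "1 + (cmod z)\<^sup>2 \<noteq> 0"
  by (auto simp: add_pos_nonneg add_nonneg_eq_0_iff)

lemma one_minus_snd_stereo: "1 - snd (stereo (Pt z)) = 2 / (1 + (cmod z)\<^sup>2)"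
  by (simp add: field_simps)

lemma fst_stereo_over: "fst (stereo (Pt z)) /\<^sub>R (1 - snd (stereo (Pt z))) = z"
proof -
  have "inverse (2 / (1 + (cmod z)\<^sup>2)) * (2 / (1 + (cmod z)\<^sup>2)) = 1"
    by (rule left_inverse) simp
  then show ?thesis
    unfolding one_minus_snd_stereo
    unfolding stereo.simps fst_conv scaleR_scaleR
    by (simp only: scaleR_one)
qed

lemma snd_stereo_Pt: "snd (stereo (Pt z)) \<noteq> 1"
  using one_minus_snd_stereo[of z] one_plus_cmod_pos[of z] by (metis diff_self divide_eq_0_iff zero_neq_numeral)

lemma inj_stereo: "inj stereo"
proof (rule injI)
  fix x y assume "stereo x = stereo y"
  then show "x = y"
    by (metis fst_stereo_over snd_stereo_Pt riemann_sphere.exhaust stereo.simps(2) snd_conv)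
qed

instantiation riemann_sphere :: metric_space
begin

definition dist_riemann_sphere :: "riemann_sphere \<Rightarrow> riemann_sphere \<Rightarrow> real" where
  "dist x y = dist (stereo x) (stereo y)"

definition uniformity_riemann_sphere :: "(riemann_sphere \<times> riemann_sphere) filter" where
  "(uniformity :: (riemann_sphere \<times> riemann_sphere) filter) =
     (INF e\<in>{0<..}. principal {(x, y). dist x y < e})"

definition open_riemann_sphere :: "riemann_sphere set \<Rightarrow> bool" where
  "open (U :: riemann_sphere set) \<longleftrightarrow> (\<forall>x\<in>U. \<forall>\<^sub>F (x', y) in uniformity. x' = x \<longrightarrow> y \<in> U)"

instance
proof
  fix x y z :: riemann_sphere
  show "dist x y = 0 \<longleftrightarrow> x = y"
    using inj_stereo by (auto simp: dist_riemann_sphere_def inj_eq)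
  show "dist x y \<le> dist x z + dist y z"
    by (simp add: dist_riemann_sphere_def dist_triangle2)
qed (simp_all add: uniformity_riemann_sphere_def open_riemann_sphere_def)

end

text \<open>The topology so obtained is that of the one-point compactification of the plane.\<close>

lemma continuous_stereo: "continuous_on S stereo"
  unfolding continuous_on_iff dist_riemann_sphere_def by blast

lemma continuous_Pt: "continuous_on S Pt"
proof -
  have "continuous_on S (\<lambda>z. stereo (Pt z))"
    by (auto intro!: continuous_intros)
  then show ?thesis
    unfolding continuous_on_iff dist_riemann_sphere_def .
qed

lemma open_Pt_image_iff: "open (Pt ` S) \<longleftrightarrow> open S"
proof
  have *: "Pt -` (Pt ` S) = S" by auto
  assume "open (Pt ` S)"
  then show "open S"
    using continuous_Pt[of UNIV] * by (metis open_vimage)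
next
  let ?A = "UNIV - {Infty}"
  let ?f = "\<lambda>x. fst (stereo x) /\<^sub>R (1 - snd (stereo x))"
  assume "open S"
  have "continuous_on ?A ?f"
  proof (intro continuous_intros continuous_stereo ballI)
    fix x assume "x \<in> ?A"
    then show "1 - snd (stereo x) \<noteq> 0"
      by (cases x) (auto simp del: stereo.simps(1) simp: snd_stereo_Pt[symmetric])
  qed
  moreover have "open ?A" by auto
  ultimately have "open (?f -` S \<inter> ?A)"
    using \<open>open S\<close> by (metis continuous_on_open_vimage)
  moreover have "?f -` S \<inter> ?A = Pt ` S"
  proof (intro set_eqI)
    fix x show "x \<in> ?f -` S \<inter> ?A \<longleftrightarrow> x \<in> Pt ` S"
      by (cases x) (auto simp del: stereo.simps(1) simp: fst_stereo_over)
  qed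
  ultimately show "open (Pt ` S)" by simp
qed

lemma range_stereo: "range stereo = sphere 0 1"
proof (intro set_eqI iffI)
  fix p assume "p \<in> range stereo"
  then obtain x where x: "p = stereo x" by auto
  show "p \<in> sphere 0 1"
  proof (cases x)
    case (Pt z)
    let ?m = "(cmod z)\<^sup>2"
    have "(norm p)\<^sup>2 = (2 / (1 + ?m))\<^sup>2 * ?m + ((?m - 1) / (1 + ?m))\<^sup>2"
      by (simp add: x Pt norm_Pair power_mult_distrib power_divide)
    also have "\<dots> = (4 * ?m + (?m - 1)\<^sup>2) / (1 + ?m)\<^sup>2"
      by (simp add: power_divide add_divide_distrib)
    also have "4 * ?m + (?m - 1)\<^sup>2 = (1 + ?m)\<^sup>2"
      by (simp add: power2_eq_square algebra_simps)
    finally have "(norm p)\<^sup>2 = 1" by simp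
    then have "norm p = 1 \<or> norm p = - 1" by (rule power2_eq_1_iff[THEN iffD1])
    then show ?thesis using norm_ge_zero[of p] by (elim disjE) simp_all
  next
    case Infty
    then show ?thesis by (simp add: x norm_Pair)
  qed
next
  fix p :: "complex \<times> real" assume p: "p \<in> sphere 0 1"
  obtain w t where wt: "p = (w, t)" by (cases p)
  have eq: "(cmod w)\<^sup>2 + t\<^sup>2 = 1" using p by (simp add: wt norm_Pair)
  show "p \<in> range stereo"
  proof (cases "t = 1")
    case True
    then have "p = stereo Infty" using eq by (simp add: wt)
    then show ?thesis by blast
  next
    case False
    define z where "z = w /\<^sub>R (1 - t)"
    have "(cmod z)\<^sup>2 = (cmod w)\<^sup>2 / (1 - t)\<^sup>2"
      by (simp only: z_def norm_scaleR power_mult_distrib power2_abs power_inverse divide_inverse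
          mult.commute)
    also have "(cmod w)\<^sup>2 = (1 - t) * (1 + t)"
      using eq by (simp add: power2_eq_square algebra_simps)
    finally have m: "(cmod z)\<^sup>2 = (1 + t) / (1 - t)"
      using False by (simp add: power2_eq_square)
    have a: "1 + (cmod z)\<^sup>2 = 2 / (1 - t)" "(cmod z)\<^sup>2 - 1 = 2 * t / (1 - t)"
      using False by (simp_all add: m field_simps)
    have "stereo (Pt z) = ((1 - t) *\<^sub>R z, t)"
      using False by (simp add: a)
    also have "\<dots> = p" using False by (simp add: z_def wt)
    finally show ?thesis by (metis rangeI)
  qed
qed

lemma compact_riemann_sphere: "compact (UNIV :: riemann_sphere set)"
proof -
  have "continuous_on (sphere 0 1) (inv stereo)"
    unfolding continuous_on_iff dist_riemann_sphere_def
    by (metis f_inv_into_f range_stereo)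
  moreover have "inv stereo ` sphere 0 1 = UNIV"
    using inj_stereo by (metis range_stereo image_inv_f_f)
  ultimately show ?thesis
    by (metis compact_continuous_image compact_sphere)
qed

definition sphere_closure :: "complex set \<Rightarrow> riemann_sphere set" where
  "sphere_closure A = closure (Pt ` A)"

definition sphere_boundary :: "complex set \<Rightarrow> riemann_sphere set" where
  "sphere_boundary A = frontier (Pt ` A)"

definition biholomorphism :: "(complex \<Rightarrow> complex) \<Rightarrow> complex set \<Rightarrow> complex set \<Rightarrow> bool" where
  "biholomorphism h A B \<longleftrightarrow>
     h holomorphic_on A \<and> bij_betw h A B \<and> inv_into A h holomorphic_on B"

abbreviation riemann_map :: "complex set \<Rightarrow> (complex \<Rightarrow> complex) \<Rightarrow> bool" where
  "riemann_map \<Omega> h \<equiv> biholomorphism h (ball 0 1) \<Omega>"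

definition Hol_d :: "complex set \<Rightarrow> (complex \<Rightarrow> complex) set" where
  "Hol_d \<Omega> = {f. f holomorphic_on \<Omega> \<and> f \<in> \<Omega> \<rightarrow> \<Omega> \<and> (\<forall>z\<in>\<Omega>. f z \<noteq> z)}"

definition Aut_d :: "complex set \<Rightarrow> (complex \<Rightarrow> complex) set" where
  "Aut_d \<Omega> = {f \<in> Hol_d \<Omega>. biholomorphism f \<Omega> \<Omega>}"

text \<open>\<open>f\<close> is a total function of which only the restriction to \<open>\<Omega>\<close> matters; the iterates of points
  of \<open>\<Omega>\<close> stay in \<open>\<Omega>\<close> for \<open>f \<in> Hol_d \<Omega>\<close>.\<close>

definition has_Denjoy_Wolff_point :: "complex set \<Rightarrow> (complex \<Rightarrow> complex) \<Rightarrow> bool" where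
  "has_Denjoy_Wolff_point \<Omega> f \<longleftrightarrow>
     (\<exists>\<tau> \<in> sphere_boundary \<Omega>. \<forall>K. compact K \<and> K \<subseteq> \<Omega> \<longrightarrow>
        uniform_limit K (\<lambda>n z. Pt ((f ^^ n) z)) (\<lambda>_. \<tau>) sequentially)"

definition Denjoy_Wolff_property :: "complex set \<Rightarrow> bool" where
  "Denjoy_Wolff_property \<Omega> \<longleftrightarrow> (\<forall>f \<in> Hol_d \<Omega>. has_Denjoy_Wolff_point \<Omega> f)"

definition disc_horosphere :: "complex \<Rightarrow> real \<Rightarrow> complex set" where
  "disc_horosphere \<sigma> R = {z \<in> ball 0 1. (cmod (\<sigma> - z))\<^sup>2 / (1 - (cmod z)\<^sup>2) < R}"

definition horospheres :: "complex set \<Rightarrow> complex set set" where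
  "horospheres \<Omega> =
     {h ` disc_horosphere \<sigma> R | h \<sigma> R. riemann_map \<Omega> h \<and> \<sigma> \<in> sphere 0 1 \<and> R > 0}"

definition has_H_limit :: "(complex \<Rightarrow> complex) \<Rightarrow> complex \<Rightarrow> bool" where
  "has_H_limit h \<sigma> \<longleftrightarrow>
     (\<exists>L. \<forall>z. (\<forall>n. z n \<in> ball 0 1) \<and> z \<longlonglongrightarrow> \<sigma> \<and>
              (\<exists>R>0. \<forall>\<^sub>F n in sequentially. z n \<in> disc_horosphere \<sigma> R)
           \<longrightarrow> (\<lambda>n. Pt (h (z n))) \<longlonglongrightarrow> L)"

text \<open>A crosscut is an open Jordan arc in \<open>\<Omega>\<close> with both ends landing on the boundary in the
  sphere. The endpoints may coincide: \<open>simple_path\<close> allows simple closed curves.\<close>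

definition crosscut :: "complex set \<Rightarrow> complex set \<Rightarrow> bool" where
  "crosscut \<Omega> C \<longleftrightarrow> C \<subseteq> \<Omega> \<and>
     (\<exists>\<gamma> :: real \<Rightarrow> riemann_sphere. simple_path \<gamma> \<and> \<gamma> ` {0<..<1} = Pt ` C \<and>
        pathstart \<gamma> \<in> sphere_boundary \<Omega> \<and> pathfinish \<gamma> \<in> sphere_boundary \<Omega>)"

definition separates :: "complex set \<Rightarrow> complex set \<Rightarrow> complex set \<Rightarrow> complex set \<Rightarrow> bool" where
  "separates \<Omega> C A B \<longleftrightarrow>
     (\<exists>U \<in> components (\<Omega> - C). \<exists>V \<in> components (\<Omega> - C). U \<noteq> V \<and> A \<subseteq> U \<and> B \<subseteq> V)"

text \<open>Null-chains, their equivalence and prime ends are as in Pommerenke, \<^emph>\<open>Boundary Behaviour of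
  Conformal Maps\<close>, Section 2.4. The diameter is the chordal one; the spherical metric is
  bi-Lipschitz equivalent to it.\<close>

definition null_chains :: "complex set \<Rightarrow> (nat \<Rightarrow> complex set) set" where
  "null_chains \<Omega> = {C.
     (\<forall>n. crosscut \<Omega> (C n)) \<and>
     (\<forall>n. sphere_closure (C n) \<inter> sphere_closure (C (Suc n)) = {}) \<and>
     (\<forall>n\<ge>1. separates \<Omega> (C n) (C 0) (C (Suc n))) \<and>
     (\<lambda>n. diameter (Pt ` C n)) \<longlonglongrightarrow> 0}"

definition null_chain_equiv ::
    "complex set \<Rightarrow> ((nat \<Rightarrow> complex set) \<times> (nat \<Rightarrow> complex set)) set" where
  "null_chain_equiv \<Omega> = {(C, C'). C \<in> null_chains \<Omega> \<and> C' \<in> null_chains \<Omega> \<and>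
     (\<forall>\<^sub>F m in sequentially. \<exists>n.
        separates \<Omega> (C' m) (C n) (C 0) \<and> separates \<Omega> (C m) (C' n) (C' 0))}"

definition prime_ends :: "complex set \<Rightarrow> (nat \<Rightarrow> complex set) set set" where
  "prime_ends \<Omega> = null_chains \<Omega> // null_chain_equiv \<Omega>"

definition principal_part :: "(nat \<Rightarrow> complex set) set \<Rightarrow> riemann_sphere set" where
  "principal_part \<xi> = {p. \<exists>C \<in> \<xi>. \<exists>z. (\<forall>n. z n \<in> C n) \<and> (\<lambda>n. Pt (z n)) \<longlonglongrightarrow> p}"

end

theory Submission
  imports Defs
begin

text \<open>
  For a Riemann map \<open>h\<close> and \<open>\<sigma>\<close> on the unit circle, compose with a Cayley transform sending \<open>\<sigma>\<close> to
  infinity: this gives \<open>g\<close> from the right half plane onto \<open>\<Omega>\<close>, horospheres at \<open>\<sigma>\<close> become half planes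
  \<open>Re w > c\<close>, and an \<open>H\<close>-limit of \<open>h\<close> at \<open>\<sigma>\<close> is a limit of \<open>g\<close> at infinity in all these half planes.

  If every automorphism has a Denjoy-Wolff point, the automorphisms conjugate to \<open>w + \<i>\<close> and \<open>w - \<i>\<close> give
  limits of \<open>g\<close> along both ends of the line \<open>Re w = c\<close>. A square root makes the univalent function \<open>g\<close>
  bounded, so the theorems of Phragmen-Lindelof and Lindelof yield the limit in the whole half plane.
  Conversely, a fixed point free map of \<open>\<Omega>\<close> becomes a map \<open>F\<close> of the half plane with
  \<open>Re (F w) \<ge> Re w\<close> for a suitable \<open>\<sigma>\<close> (Wolff), whose orbits tend to infinity inside a half plane
  \<open>Re w \<ge> c\<close>.

  For a null-chain, choose \<open>\<sigma>\<close> as an accumulation point of the parts of \<open>\<Omega>\<close> cut off by the crosscuts.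
  The image of \<open>Re w \<ge> 1\<close> meets all crosscuts from some index on. Otherwise consecutive crosscuts have
  ends tending to \<open>\<sigma>\<close> in a vertical strip, where a rotation argument shows that the limit along the end
  is the \<open>H\<close>-limit, although the closures of consecutive crosscuts are disjoint. As diameters tend to
  zero, the crosscuts converge to the \<open>H\<close>-limit at \<open>\<sigma>\<close>.
\<close>

section \<open>The Riemann sphere and the half plane model\<close>

text \<open>The obstacle is that horospheres are tangential to the circle at \<sigma>: radial or
  nontangential limits of \<open>h\<close> say nothing about them, and the values along the bounding
  horocycle on both sides of \<sigma> matter. Parabolic automorphisms probe exactly these two sides.
  Convergence to a point of the sphere has to be expressed by a bounded holomorphic function, one
  for each candidate point; the square root provides it because \<open>g\<close> is injective and
  omits a finite value. For prime ends no correspondence with points of the circle is set up. It is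
  enough to find, for each null-chain, some \<sigma> whose half plane is met by almost all
  crosscuts. The delicate case is an end of a crosscut running to infinity between the imaginary
  axis and a vertical line. Such an end may oscillate wildly, yet it cannot skip heights;
  multiplying a test function by its rotations about a point of the line transfers smallness from
  the end to the line, where the limit is known. A whole equivalence class shares one limit because
  the image of the half plane is connected and cannot jump over a separating crosscut.\<close>

lemma dist_Pt_Infty: "dist (Pt z) Infty = 2 / sqrt (1 + (cmod z)\<^sup>2)"
proof -
  let ?m = "(cmod z)\<^sup>2"
  have "(dist (Pt z) Infty)\<^sup>2 = (2 / (1 + ?m))\<^sup>2 * ?m + ((?m - 1) / (1 + ?m) - 1)\<^sup>2"
    unfolding power2_commute[of _ 1]
    by (simp add: dist_riemann_sphere_def dist_Pair_Pair dist_real_def power_mult_distrib power_divide)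
  also have "(?m - 1) / (1 + ?m) - 1 = - 2 / (1 + ?m)"
    by (simp add: field_simps)
  also have "(2 / (1 + ?m))\<^sup>2 * ?m + (- 2 / (1 + ?m))\<^sup>2 = (4 * (1 + ?m)) / (1 + ?m)\<^sup>2"
    by (simp add: power_divide add_divide_distrib[symmetric] algebra_simps)
  also have "\<dots> = (2 / sqrt (1 + ?m))\<^sup>2"
    by (simp add: power_divide power2_eq_square[of "1 + ?m"] del: distrib_left_numeral)
  finally show ?thesis
    by (rule power2_eq_imp_eq) (auto intro: divide_nonneg_nonneg add_nonneg_nonneg)
qed

lemma tendsto_Pt_iff: "((\<lambda>x. Pt (f x)) \<longlongrightarrow> Pt p) F \<longleftrightarrow> (f \<longlongrightarrow> p) F"
proof
  assume L: "((\<lambda>x. Pt (f x)) \<longlongrightarrow> Pt p) F"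
  show "(f \<longlongrightarrow> p) F"
  proof (rule topological_tendstoI)
    fix S assume "open S" "p \<in> S"
    then have "\<forall>\<^sub>F x in F. Pt (f x) \<in> Pt ` S"
      using topological_tendstoD[OF L, of "Pt ` S"] open_Pt_image_iff by blast
    then show "\<forall>\<^sub>F x in F. f x \<in> S"
      by eventually_elim auto
  qed
next
  assume "(f \<longlongrightarrow> p) F"
  then show "((\<lambda>x. Pt (f x)) \<longlongrightarrow> Pt p) F"
    by (rule continuous_on_tendsto_compose[OF continuous_Pt[of UNIV]]) auto
qed

lemma tendsto_Infty_iff: "((\<lambda>x. Pt (f x)) \<longlongrightarrow> Infty) F \<longleftrightarrow> filterlim f at_infinity F"
proof
  assume "((\<lambda>x. Pt (f x)) \<longlongrightarrow> Infty) F"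
  then have "((\<lambda>x. dist (Pt (f x)) Infty) \<longlongrightarrow> 0) F"
    by (rule tendsto_dist_iff[THEN iffD1])
  then have "LIM x F. inverse (dist (Pt (f x)) Infty) :> at_top"
    by (rule filterlim_inverse_at_top) (simp add: dist_Pt_Infty)
  then have "LIM x F. 2 * inverse (dist (Pt (f x)) Infty) :> at_top"
    by (intro filterlim_tendsto_pos_mult_at_top[OF tendsto_const]) auto
  then have "LIM x F. (-1) + 2 * inverse (dist (Pt (f x)) Infty) :> at_top"
    by (rule filterlim_tendsto_add_at_top[OF tendsto_const])
  then have "LIM x F. norm (f x) :> at_top"
  proof (rule filterlim_at_top_mono)
    have "- 1 + 2 * inverse (dist (Pt z) Infty) \<le> cmod z" for z
    proof -
      have "2 * inverse (dist (Pt z) Infty) = sqrt (1 + (cmod z)\<^sup>2)"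
        unfolding dist_Pt_Infty by simp
      also have "\<dots> \<le> 1 + cmod z"
        using sqrt_add_le_add_sqrt[of 1 "(cmod z)\<^sup>2"] by simp
      finally show ?thesis by simp
    qed
    then show "\<forall>\<^sub>F x in F. - 1 + 2 * inverse (dist (Pt (f x)) Infty) \<le> cmod (f x)"
      by (intro always_eventually allI)
  qed
  then show "filterlim f at_infinity F"
    by (simp add: filterlim_at_infinity_conv_norm_at_top)
next
  assume "filterlim f at_infinity F"
  then have "LIM x F. norm (f x) :> at_top"
    by (simp add: filterlim_at_infinity_conv_norm_at_top)
  then have "((\<lambda>x. 2 * inverse (norm (f x))) \<longlongrightarrow> 2 * 0) F"
    by (intro tendsto_intros) (rule tendsto_inverse_0_at_top)
  then have "((\<lambda>x. 2 * inverse (norm (f x))) \<longlongrightarrow> 0) F" by simp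
  moreover have "\<forall>\<^sub>F x in F. 0 < norm (f x)"
    using \<open>LIM x F. norm (f x) :> at_top\<close> unfolding filterlim_at_top_dense by blast
  then have "\<forall>\<^sub>F x in F. dist (Pt (f x)) Infty \<le> 2 * inverse (norm (f x))"
  proof eventually_elim
    case (elim x)
    have "norm (f x) \<le> sqrt (1 + (norm (f x))\<^sup>2)"
      by (rule real_le_rsqrt) simp
    then show ?case using elim
      by (simp add: dist_Pt_Infty divide_inverse)
  qed
  then have "\<forall>\<^sub>F x in F. norm (dist (Pt (f x)) Infty) \<le> 2 * inverse (norm (f x))"
    by simp
  ultimately have "((\<lambda>x. dist (Pt (f x)) Infty) \<longlongrightarrow> 0) F"
    by (rule Lim_null_comparison[rotated])
  then show "((\<lambda>x. Pt (f x)) \<longlongrightarrow> Infty) F"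
    by (rule tendsto_dist_iff[THEN iffD2])
qed

lemma sphere_boundary_eq: "open A \<Longrightarrow> sphere_boundary A = sphere_closure A - Pt ` A"
  by (simp add: sphere_boundary_def sphere_closure_def frontier_def interior_open open_Pt_image_iff)

lemma compact_convergent_subsequence:
  fixes x :: "nat \<Rightarrow> 'a::metric_space"
  assumes "compact K" "\<And>n. x n \<in> K"
  obtains l r where "l \<in> K" "strict_mono (r :: nat \<Rightarrow> nat)" "(\<lambda>n. x (r n)) \<longlonglongrightarrow> l"
  using seq_compactE[OF compact_imp_seq_compact[OF assms(1)], of x] assms(2) by (auto simp: o_def)

section \<open>Biholomorphisms with explicit inverses\<close>

lemma biholomorphismI:
  assumes "f holomorphic_on A" "g holomorphic_on B"
    and "\<And>z. z \<in> A \<Longrightarrow> f z \<in> B \<and> g (f z) = z" "\<And>z. z \<in> B \<Longrightarrow> g z \<in> A \<and> f (g z) = z"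
  shows "biholomorphism f A B"
  unfolding biholomorphism_def
proof (intro conjI)
  show bij: "bij_betw f A B"
    using assms by (intro bij_betwI[of f A B g]) auto
  have "inv_into A f z = g z" if "z \<in> B" for z
    using inv_into_f_f[of f A "g z"] assms(4)[OF that] bij by (simp add: bij_betw_def)
  then show "inv_into A f holomorphic_on B"
    by (intro holomorphic_transform[OF assms(2)]) simp
qed (use assms in auto)

lemma biholomorphismE:
  assumes "biholomorphism f A B"
  obtains g where "f holomorphic_on A" "g holomorphic_on B"
    "\<And>z. z \<in> A \<Longrightarrow> f z \<in> B" "\<And>z. z \<in> A \<Longrightarrow> g (f z) = z"
    "\<And>z. z \<in> B \<Longrightarrow> g z \<in> A" "\<And>z. z \<in> B \<Longrightarrow> f (g z) = z"
proof (rule that[of "inv_into A f"])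
  show "f holomorphic_on A" "inv_into A f holomorphic_on B"
    using assms by (auto simp: biholomorphism_def)
qed (use assms in \<open>auto simp: biholomorphism_def bij_betw_def inv_into_into f_inv_into_f\<close>)

lemma biholomorphism_compose:
  assumes "biholomorphism f A B" "biholomorphism g B C"
  shows "biholomorphism (g \<circ> f) A C"
proof -
  obtain f' where f': "f holomorphic_on A" "f' holomorphic_on B"
    "\<And>z. z \<in> A \<Longrightarrow> f z \<in> B" "\<And>z. z \<in> A \<Longrightarrow> f' (f z) = z"
    "\<And>z. z \<in> B \<Longrightarrow> f' z \<in> A" "\<And>z. z \<in> B \<Longrightarrow> f (f' z) = z"
    by (rule biholomorphismE[OF assms(1)]) (rule that)
  obtain g' where g': "g holomorphic_on B" "g' holomorphic_on C"
    "\<And>z. z \<in> B \<Longrightarrow> g z \<in> C" "\<And>z. z \<in> B \<Longrightarrow> g' (g z) = z"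
    "\<And>z. z \<in> C \<Longrightarrow> g' z \<in> B" "\<And>z. z \<in> C \<Longrightarrow> g (g' z) = z"
    by (rule biholomorphismE[OF assms(2)]) (rule that)
  show ?thesis
  proof (rule biholomorphismI[where g = "f' \<circ> g'"])
    show "g \<circ> f holomorphic_on A"
      by (rule holomorphic_on_compose_gen[OF f'(1) g'(1)]) (use f' in auto)
    show "f' \<circ> g' holomorphic_on C"
      by (rule holomorphic_on_compose_gen[OF g'(2) f'(2)]) (use g' in auto)
  qed (use f' g' in auto)
qed

lemma biholomorphism_inverse:
  assumes "f holomorphic_on A" "g holomorphic_on B"
    and "\<And>z. z \<in> A \<Longrightarrow> f z \<in> B" "\<And>z. z \<in> A \<Longrightarrow> g (f z) = z"
    "\<And>z. z \<in> B \<Longrightarrow> g z \<in> A" "\<And>z. z \<in> B \<Longrightarrow> f (g z) = z"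
  shows "biholomorphism g B A"
  using assms by (intro biholomorphismI[where g = f]) auto

section \<open>The right half plane and the Cayley transform\<close>

definition rhp :: "complex set" where
  "rhp = {w. 0 < Re w}"

lemma open_rhp: "open rhp"
  unfolding rhp_def by (rule open_halfspace_Re_gt)

lemma convex_rhp: "convex rhp"
  unfolding rhp_def by (rule convex_halfspace_Re_gt)

text \<open>Normalised so that 1 goes to the centre 0 and infinity to \<sigma>.\<close>

definition cayley :: "complex \<Rightarrow> complex \<Rightarrow> complex" where
  "cayley \<sigma> w = \<sigma> * (w - 1) / (w + 1)"

definition inv_cayley :: "complex \<Rightarrow> complex \<Rightarrow> complex" where
  "inv_cayley \<sigma> z = (\<sigma> + z) / (\<sigma> - z)"

lemma norm_sq_diff_one: "(cmod (w + 1))\<^sup>2 - (cmod (w - 1))\<^sup>2 = 4 * Re w"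
  by (simp add: cmod_power2) (simp add: power2_eq_square algebra_simps)

lemma cayley_in_ball:
  assumes "cmod \<sigma> = 1" "w \<in> rhp"
  shows "cayley \<sigma> w \<in> ball 0 1"
proof -
  have "w + 1 \<noteq> 0" using assms(2) by (auto simp: rhp_def complex_eq_iff)
  moreover have "(cmod (w - 1))\<^sup>2 < (cmod (w + 1))\<^sup>2"
    using norm_sq_diff_one[of w] assms(2) by (simp add: rhp_def)
  then have "cmod (w - 1) < cmod (w + 1)"
    by (rule power2_less_imp_less) simp
  ultimately show ?thesis
    using assms(1) by (simp add: cayley_def norm_mult norm_divide)
qed

text \<open>The right side is the Poisson kernel with pole \<sigma>, the reciprocal of the quotient
  that defines \<open>disc_horosphere\<close>. This is why radius \<open>R\<close> corresponds to
  \<open>Re w > 1 / R\<close>.\<close>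

lemma Re_inv_cayley:
  assumes "cmod \<sigma> = 1"
  shows "Re (inv_cayley \<sigma> z) = (1 - (cmod z)\<^sup>2) / (cmod (\<sigma> - z))\<^sup>2"
proof -
  have "inv_cayley \<sigma> z = (\<sigma> + z) * cnj (\<sigma> - z) / (cmod (\<sigma> - z))\<^sup>2"
    unfolding inv_cayley_def by (rule complex_div_cnj)
  then have "Re (inv_cayley \<sigma> z) = Re ((\<sigma> + z) * cnj (\<sigma> - z)) / (cmod (\<sigma> - z))\<^sup>2"
    by (simp only: Re_divide_of_real)
  also have "Re ((\<sigma> + z) * cnj (\<sigma> - z)) = (cmod \<sigma>)\<^sup>2 - (cmod z)\<^sup>2"
    by (simp add: cmod_power2) (simp add: power2_eq_square algebra_simps)
  finally show ?thesis using assms by simp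
qed

lemma inv_cayley_in_rhp:
  assumes "cmod \<sigma> = 1" "z \<in> ball 0 1"
  shows "inv_cayley \<sigma> z \<in> rhp"
proof -
  have "\<sigma> \<noteq> z" using assms by auto
  moreover have "(cmod z)\<^sup>2 < 1" using assms by (simp add: power_less_one_iff)
  ultimately show ?thesis
    by (simp add: rhp_def Re_inv_cayley[OF assms(1)])
qed

lemma inv_cayley_cayley:
  assumes "cmod \<sigma> = 1" "w \<in> rhp"
  shows "inv_cayley \<sigma> (cayley \<sigma> w) = w"
proof -
  have "\<sigma> \<noteq> 0" using assms by auto
  moreover have "w + 1 \<noteq> 0" using assms by (auto simp: rhp_def complex_eq_iff)
  ultimately have w: "w + 1 \<noteq> 0" "\<sigma> \<noteq> 0" by auto
  have "\<sigma> + cayley \<sigma> w = \<sigma> * (2 * w) / (w + 1)" "\<sigma> - cayley \<sigma> w = \<sigma> * 2 / (w + 1)"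
    using w by (simp_all add: cayley_def field_simps)
  then show ?thesis using w by (simp add: inv_cayley_def)
qed

lemma cayley_inv_cayley:
  assumes "cmod \<sigma> = 1" "z \<in> ball 0 1"
  shows "cayley \<sigma> (inv_cayley \<sigma> z) = z"
proof -
  have z: "\<sigma> - z \<noteq> 0" "\<sigma> \<noteq> 0" using assms by auto
  have "inv_cayley \<sigma> z - 1 = 2 * z / (\<sigma> - z)" "inv_cayley \<sigma> z + 1 = 2 * \<sigma> / (\<sigma> - z)"
    using z by (simp_all add: inv_cayley_def field_simps)
  then show ?thesis using z by (simp add: cayley_def)
qed

lemma cayley_biholomorphism:
  assumes "cmod \<sigma> = 1"
  shows "biholomorphism (cayley \<sigma>) rhp (ball 0 1)"
proof (rule biholomorphismI[where g = "inv_cayley \<sigma>"])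
  have "w + 1 \<noteq> 0" if "w \<in> rhp" for w
    using that by (auto simp: rhp_def complex_eq_iff)
  then show "cayley \<sigma> holomorphic_on rhp"
    unfolding cayley_def by (intro holomorphic_intros) auto
  show "inv_cayley \<sigma> holomorphic_on ball 0 1"
    unfolding inv_cayley_def by (intro holomorphic_intros) (use assms in auto)
qed (use assms cayley_in_ball inv_cayley_in_rhp inv_cayley_cayley cayley_inv_cayley in auto)

lemma disc_horosphere_iff:
  assumes "cmod \<sigma> = 1" "R > 0" "z \<in> ball 0 1"
  shows "z \<in> disc_horosphere \<sigma> R \<longleftrightarrow> 1 / R < Re (inv_cayley \<sigma> z)"
proof -
  have "\<sigma> \<noteq> z" "(cmod z)\<^sup>2 < 1" using assms by (auto simp: power_less_one_iff)
  then show ?thesis using assms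
    by (simp add: disc_horosphere_def Re_inv_cayley field_simps)
qed

lemma cayley_image_halfplane:
  assumes "cmod \<sigma> = 1" "R > 0"
  shows "cayley \<sigma> ` {w. 1 / R < Re w} = disc_horosphere \<sigma> R"
proof (intro set_eqI iffI)
  fix z assume "z \<in> cayley \<sigma> ` {w. 1 / R < Re w}"
  then obtain w where w: "z = cayley \<sigma> w" "1 / R < Re w" by auto
  have "0 < 1 / R" using assms by simp
  then have "w \<in> rhp" unfolding rhp_def using w(2) by (simp del: zero_less_divide_1_iff)
  then show "z \<in> disc_horosphere \<sigma> R"
    using assms w by (simp add: disc_horosphere_iff cayley_in_ball[simplified] inv_cayley_cayley)
next
  fix z assume z: "z \<in> disc_horosphere \<sigma> R"
  then have "z \<in> ball 0 1" by (simp add: disc_horosphere_def)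
  then have "z = cayley \<sigma> (inv_cayley \<sigma> z)" "inv_cayley \<sigma> z \<in> {w. 1 / R < Re w}"
    using assms z cayley_inv_cayley[of \<sigma> z] disc_horosphere_iff[of \<sigma> R z] by simp_all
  then show "z \<in> cayley \<sigma> ` {w. 1 / R < Re w}" by (rule image_eqI)
qed

lemma filterlim_inv_cayley:
  assumes "cmod \<sigma> = 1" "(f \<longlongrightarrow> \<sigma>) F" "\<forall>\<^sub>F x in F. f x \<in> ball 0 1"
  shows "filterlim (\<lambda>x. inv_cayley \<sigma> (f x)) at_infinity F"
  unfolding inv_cayley_def divide_inverse
proof (rule tendsto_mult_filterlim_at_infinity)
  show "((\<lambda>x. \<sigma> + f x) \<longlongrightarrow> \<sigma> + \<sigma>) F" by (intro tendsto_intros assms)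
  have "filterlim (\<lambda>x. \<sigma> - f x) (at 0) F"
  proof (rule filterlim_atI)
    show "((\<lambda>x. \<sigma> - f x) \<longlongrightarrow> 0) F"
      using tendsto_diff[OF tendsto_const assms(2), of \<sigma>] by simp
    show "\<forall>\<^sub>F x in F. \<sigma> - f x \<noteq> 0"
      using assms(3) by eventually_elim (use assms(1) in auto)
  qed
  then show "filterlim (\<lambda>x. inverse (\<sigma> - f x)) at_infinity F"
    by (rule filterlim_compose[OF filterlim_inverse_at_infinity])
qed (use assms(1) in auto)

lemma tendsto_cayley:
  assumes "cmod \<sigma> = 1" "filterlim f at_infinity F"
  shows "((\<lambda>x. cayley \<sigma> (f x)) \<longlongrightarrow> \<sigma>) F"
proof -
  have "filterlim (\<lambda>x. f x + 1) at_infinity F"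
    using assms(2) tendsto_add_filterlim_at_infinity'[OF _ tendsto_const] by blast
  then have "((\<lambda>x. inverse (f x + 1)) \<longlongrightarrow> 0) F"
    using filterlim_compose tendsto_inverse_0 by blast
  then have "((\<lambda>x. \<sigma> * (1 - 2 * inverse (f x + 1))) \<longlongrightarrow> \<sigma> * (1 - 2 * 0)) F"
    by (intro tendsto_intros)
  \<comment> \<open>At \<open>-1\<close> division by zero turns \<open>cayley\<close> into 0 and the
    rewritten form into \<sigma>, so that point has to be avoided.\<close>
  moreover have "\<forall>\<^sub>F x in F. f x \<noteq> - 1"
  proof -
    have "eventually (\<lambda>z::complex. z \<noteq> - 1) at_infinity"
      unfolding eventually_at_infinity by (rule exI[of _ 2]) auto
    then show ?thesis using assms(2) by (rule eventually_compose_filterlim)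
  qed
  then have "\<forall>\<^sub>F x in F. \<sigma> * (1 - 2 * inverse (f x + 1)) = cayley \<sigma> (f x)"
  proof eventually_elim
    case (elim x)
    then have "f x + 1 \<noteq> 0" by (simp add: add_eq_0_iff2)
    then show ?case by (simp add: cayley_def field_simps)
  qed
  ultimately show ?thesis
    by (simp add: tendsto_cong)
qed

section \<open>Reduction to bounded functions\<close>

text \<open>Koebe's trick. If \<open>s v = - s w\<close>, then \<open>g v = g w\<close>, so
  \<open>v = w\<close> by injectivity and \<open>s w = 0\<close>, which would make \<open>g\<close>
  take the omitted value \<open>a\<close>. Hence the negative of any disc inside the image of
  \<open>s\<close> is omitted; the open mapping theorem supplies such a disc around
  \<open>s 1\<close>, and \<open>b\<close> is \<open>s 1\<close>.\<close>

lemma square_root_omitting_disc: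
  assumes "biholomorphism g rhp \<Omega>" "a \<notin> \<Omega>"
  obtains s b r where "s holomorphic_on rhp" "\<And>w. w \<in> rhp \<Longrightarrow> g w = a + (s w)\<^sup>2"
    "r > 0" "\<And>w. w \<in> rhp \<Longrightarrow> r \<le> cmod (s w + b)"
proof -
  have hol: "g holomorphic_on rhp" and inj: "inj_on g rhp" and im: "\<And>w. w \<in> rhp \<Longrightarrow> g w \<in> \<Omega>"
    using assms(1) by (auto simp: biholomorphism_def bij_betw_def)
  have "simply_connected rhp"
    by (rule convex_imp_simply_connected[OF convex_rhp])
  note sqrt_exists = conjunct2[OF iffD1[OF simply_connected_eq_holomorphic_sqrt[OF open_rhp] this],
      rule_format, of "\<lambda>w. g w - a"]
  have "(\<lambda>w. g w - a) holomorphic_on rhp \<and> (\<forall>z\<in>rhp. g z - a \<noteq> 0)"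
    using hol im assms(2) by (auto intro!: holomorphic_intros)
  from sqrt_exists[OF this] obtain s where
    s: "s holomorphic_on rhp" "\<And>w. w \<in> rhp \<Longrightarrow> g w - a = (s w)\<^sup>2"
    by auto
  have eq: "g w = a + (s w)\<^sup>2" if "w \<in> rhp" for w
    using s(2)[OF that] by (simp add: algebra_simps)
  have 12: "1 \<in> rhp" "2 \<in> rhp" by (auto simp: rhp_def)
  have "\<not> s constant_on rhp"
  proof
    assume "s constant_on rhp"
    then have "s 1 = s 2" using 12 unfolding constant_on_def by metis
    then have "g 1 = g 2" using eq[OF 12(1)] eq[OF 12(2)] by simp
    then show False using inj_onD[OF inj _ 12] by simp
  qed
  then have "open (s ` rhp)"
    using open_mapping_thm[OF s(1) open_rhp convex_connected[OF convex_rhp] open_rhp] by simp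
  then obtain r where r: "r > 0" "ball (s 1) r \<subseteq> s ` rhp"
    using 12(1) by (meson imageI openE)
  have "r \<le> cmod (s w + s 1)" if w: "w \<in> rhp" for w
  proof (rule ccontr)
    assume "\<not> ?thesis"
    then have "- s w \<in> ball (s 1) r" by (simp add: dist_norm add.commute)
    then obtain v where v: "v \<in> rhp" "- s w = s v" using r(2) by auto
    then have "g v = g w" using eq[OF v(1)] eq[OF w] by (metis power2_minus)
    then have "v = w" using inj_onD[OF inj _ v(1) w] by blast
    then have "s w = 0" using v(2) by simp
    then have "g w = a" using eq[OF w] by simp
    then show False using im[OF w] assms(2) by simp
  qed
  then show ?thesis by (intro that[of s r "s 1"] s(1) eq r(1))
qed

text \<open>The injective map \<open>g\<close> need not be bounded, but convergence of \<open>g\<close> to any prescribed point of the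
  sphere is the same as convergence of a suitable bounded holomorphic function to zero.\<close>

lemma bounded_test_function:
  assumes "biholomorphism g rhp \<Omega>" "\<Omega> \<noteq> UNIV"
  obtains k M where "k holomorphic_on rhp" "\<And>w. w \<in> rhp \<Longrightarrow> cmod (k w) \<le> M"
    "\<And>F. \<forall>\<^sub>F w in F. w \<in> rhp \<Longrightarrow> (k \<longlongrightarrow> 0) F \<longleftrightarrow> ((\<lambda>w. Pt (g w)) \<longlongrightarrow> e) F"
proof -
  obtain a where "a \<notin> \<Omega>" using assms(2) by auto
  then obtain s b r where
    s: "s holomorphic_on rhp" and g: "\<And>w. w \<in> rhp \<Longrightarrow> g w = a + (s w)\<^sup>2" and
    r: "r > 0" and sb: "\<And>w. w \<in> rhp \<Longrightarrow> r \<le> cmod (s w + b)"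
    by (rule square_root_omitting_disc[OF assms(1)]) (rule that)
  have nz: "s w + b \<noteq> 0" if "w \<in> rhp" for w using sb[OF that] r by auto
  define G where "G w = 1 / (s w + b)" for w
  have G: "G holomorphic_on rhp"
    unfolding G_def using s nz by (intro holomorphic_intros) auto
  have Gle: "cmod (G w) \<le> 1 / r" if "w \<in> rhp" for w
    using sb[OF that] r by (simp add: G_def norm_divide frac_le)
  have sG: "s w * G w = 1 - b * G w" if "w \<in> rhp" for w
    using nz[OF that] by (simp add: G_def field_simps)
  show ?thesis
  proof (cases e)
    \<comment> \<open>Here \<open>G\<close> itself is the test function: it tends to zero exactly
      when \<open>s\<close>, and hence \<open>a + s^2\<close>, tends to infinity.\<close>
    case Infty
    have "(G \<longlongrightarrow> 0) F \<longleftrightarrow> ((\<lambda>w. Pt (g w)) \<longlongrightarrow> e) F" if ev: "\<forall>\<^sub>F w in F. w \<in> rhp" for F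
    proof -
      have "(G \<longlongrightarrow> 0) F \<longleftrightarrow> filterlim (\<lambda>w. s w + b) at_infinity F"
      proof
        assume "filterlim (\<lambda>w. s w + b) at_infinity F"
        then have "((\<lambda>w. inverse (s w + b)) \<longlongrightarrow> 0) F"
          by (rule filterlim_compose[OF tendsto_inverse_0])
        then show "(G \<longlongrightarrow> 0) F" by (simp add: G_def[abs_def] divide_inverse)
      next
        assume "(G \<longlongrightarrow> 0) F"
        then have "filterlim G (at 0) F"
          by (rule filterlim_atI) (use ev nz in \<open>auto elim!: eventually_mono simp: G_def\<close>)
        then have "filterlim (\<lambda>w. inverse (G w)) at_infinity F"
          by (rule filterlim_compose[OF filterlim_inverse_at_infinity])
        then show "filterlim (\<lambda>w. s w + b) at_infinity F"
          by (simp add: G_def)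
      qed
      also have "\<dots> \<longleftrightarrow> filterlim s at_infinity F"
        using tendsto_add_filterlim_at_infinity'[of s F "\<lambda>_. b" b]
          tendsto_add_filterlim_at_infinity'[of "\<lambda>w. s w + b" F "\<lambda>_. - b" "- b"] by auto
      also have "\<dots> \<longleftrightarrow> filterlim (\<lambda>w. (s w)\<^sup>2) at_infinity F"
      proof
        assume "filterlim s at_infinity F"
        then show "filterlim (\<lambda>w. (s w)\<^sup>2) at_infinity F"
          unfolding power2_eq_square by (intro filterlim_at_infinity_times)
      next
        assume "filterlim (\<lambda>w. (s w)\<^sup>2) at_infinity F"
        then have "LIM w F. sqrt (norm ((s w)\<^sup>2)) :> at_top"
          unfolding filterlim_at_infinity_conv_norm_at_top
          by (rule filterlim_compose[OF sqrt_at_top])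
        then show "filterlim s at_infinity F"
          by (simp add: filterlim_at_infinity_conv_norm_at_top norm_power)
      qed
      also have "\<dots> \<longleftrightarrow> filterlim (\<lambda>w. (s w)\<^sup>2 + a) at_infinity F"
        using tendsto_add_filterlim_at_infinity'[of "\<lambda>w. (s w)\<^sup>2" F "\<lambda>_. a" a]
          tendsto_add_filterlim_at_infinity'[of "\<lambda>w. (s w)\<^sup>2 + a" F "\<lambda>_. - a" "- a"] by auto
      also have "\<dots> \<longleftrightarrow> filterlim g at_infinity F"
        by (rule filterlim_cong[OF refl refl]) (use ev g in \<open>auto elim!: eventually_mono simp: add.commute\<close>)
      finally show ?thesis by (simp add: Infty tendsto_Infty_iff)
    qed
    then show ?thesis by (intro that[OF G Gle])
  next
    case (Pt p)
    \<comment> \<open>Since \<open>g\<close> grows like the square of \<open>s\<close>, two factors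
      \<open>G\<close> are what keeps \<open>g - p\<close> bounded, by
      \<open>s G = 1 - b G\<close>.\<close>
    define k where "k w = (g w - p) * (G w)\<^sup>2" for w
    have k_eq: "k w = (1 - b * G w)\<^sup>2 + (a - p) * (G w)\<^sup>2" if "w \<in> rhp" for w
    proof -
      have "k w = (s w * G w)\<^sup>2 + (a - p) * (G w)\<^sup>2"
        by (simp add: k_def g[OF that] power_mult_distrib algebra_simps)
      then show ?thesis using sG[OF that] by simp
    qed
    have holk: "k holomorphic_on rhp"
      unfolding k_def using G assms(1) by (auto intro!: holomorphic_intros simp: biholomorphism_def)
    have kle: "cmod (k w) \<le> (1 + cmod b * (1 / r))\<^sup>2 + cmod (a - p) * (1 / r)\<^sup>2" if "w \<in> rhp" for w
    proof -
      have 1: "cmod (1 - b * G w) \<le> 1 + cmod b * (1 / r)"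
        using norm_triangle_ineq4[of 1 "b * G w"] mult_left_mono[OF Gle[OF that], of "cmod b"]
        by (simp add: norm_mult)
      have "cmod (k w) \<le> (cmod (1 - b * G w))\<^sup>2 + cmod (a - p) * (cmod (G w))\<^sup>2"
        unfolding k_eq[OF that] by (rule order_trans[OF norm_triangle_ineq]) (simp add: norm_power norm_mult)
      also have "\<dots> \<le> (1 + cmod b * (1 / r))\<^sup>2 + cmod (a - p) * (1 / r)\<^sup>2"
        by (intro add_mono power_mono mult_left_mono 1 Gle that) auto
      finally show ?thesis .
    qed
    have "(k \<longlongrightarrow> 0) F \<longleftrightarrow> ((\<lambda>w. Pt (g w)) \<longlongrightarrow> e) F" if ev: "\<forall>\<^sub>F w in F. w \<in> rhp" for F
      unfolding Pt tendsto_Pt_iff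
    proof
      assume "(g \<longlongrightarrow> p) F"
      then have "((\<lambda>w. norm (g w - p) * (1 / r)\<^sup>2) \<longlongrightarrow> 0) F"
        by (intro tendsto_mult_left_zero tendsto_norm_zero) (simp add: LIM_zero)
      then show "(k \<longlongrightarrow> 0) F"
      proof (rule Lim_null_comparison[rotated])
        show "\<forall>\<^sub>F w in F. cmod (k w) \<le> cmod (g w - p) * (1 / r)\<^sup>2"
          using ev
        proof eventually_elim
          case (elim w)
          show ?case unfolding k_def norm_mult norm_power
            by (intro mult_left_mono power_mono Gle elim) auto
        qed
      qed
    next
      assume k0: "(k \<longlongrightarrow> 0) F"
      \<comment> \<open>Recovering \<open>g - p = k (s + b)^2\<close> from \<open>k\<close> requires
        a bound on \<open>s\<close>. Once \<open>|k| < 1/4\<close>, the inequality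
        \<open>|s + b|^2 \<le> 2 |s|^2 + 2 |b|^2\<close> lets half of \<open>|s|^2\<close> be
        absorbed, which bounds \<open>|s|^2\<close> by \<open>2 |a - p| + |b|^2\<close> and
        \<open>|s + b|^2\<close> by \<open>2 * ?C\<close>.\<close>
      let ?C = "2 * cmod (a - p) + 2 * (cmod b)\<^sup>2"
      have "\<forall>\<^sub>F w in F. cmod (k w) < 1 / 4"
        using order_tendstoD(2)[OF tendsto_norm_zero[OF k0], of "1 / 4"] by simp
      then have "\<forall>\<^sub>F w in F. cmod (g w - p) \<le> cmod (k w) * (2 * ?C)"
        using ev
      proof eventually_elim
        case (elim w)
        have 1: "g w - p = k w * (s w + b)\<^sup>2"
          using nz[OF elim(2)] by (simp add: k_def G_def power_divide)
        have 2: "(cmod (s w + b))\<^sup>2 \<le> 2 * (cmod (s w))\<^sup>2 + 2 * (cmod b)\<^sup>2"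
        proof -
          have "(cmod (s w + b))\<^sup>2 \<le> (cmod (s w) + cmod b)\<^sup>2"
            by (intro power_mono norm_triangle_ineq) auto
          also have "\<dots> \<le> 2 * (cmod (s w))\<^sup>2 + 2 * (cmod b)\<^sup>2"
            using zero_le_power2[of "cmod (s w) - cmod b"] by (simp add: power2_eq_square algebra_simps)
          finally show ?thesis .
        qed
        have "(cmod (s w))\<^sup>2 = cmod ((g w - p) - (a - p))"
          by (simp add: g[OF elim(2)] norm_power)
        also have "\<dots> \<le> cmod (g w - p) + cmod (a - p)" by (rule norm_triangle_ineq4)
        also have "cmod (g w - p) = cmod (k w) * (cmod (s w + b))\<^sup>2"
          by (simp add: 1 norm_mult norm_power)
        also have "\<dots> \<le> (1 / 4) * (2 * (cmod (s w))\<^sup>2 + 2 * (cmod b)\<^sup>2)"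
          by (intro mult_mono 2) (use elim in auto)
        finally have "(cmod (s w))\<^sup>2 \<le> (1 / 4) * (2 * (cmod (s w))\<^sup>2 + 2 * (cmod b)\<^sup>2) + cmod (a - p)"
          by simp
        then have 3: "(cmod (s w))\<^sup>2 \<le> 2 * cmod (a - p) + (cmod b)\<^sup>2"
          by (simp add: field_simps)
        have "cmod (g w - p) = cmod (k w) * (cmod (s w + b))\<^sup>2"
          by (simp add: 1 norm_mult norm_power)
        also have "\<dots> \<le> cmod (k w) * (2 * ?C)"
          using 2 3 by (intro mult_left_mono) auto
        finally show ?case .
      qed
      moreover have "((\<lambda>w. cmod (k w) * (2 * ?C)) \<longlongrightarrow> 0) F"
        by (intro tendsto_mult_left_zero tendsto_norm_zero k0)
      ultimately have "((\<lambda>w. g w - p) \<longlongrightarrow> 0) F"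
        by (rule Lim_null_comparison)
      then show "(g \<longlongrightarrow> p) F" by (rule LIM_zero_cancel)
    qed
    then show ?thesis by (intro that[OF holk kle])
  qed
qed

section \<open>Phragmen-Lindelof principles in a half plane\<close>

lemma cmod_le_cmod_add_real:
  assumes "0 \<le> Re w" "0 \<le> t"
  shows "cmod w \<le> cmod (w + complex_of_real t)"
  unfolding cmod_def using assms by (intro real_sqrt_le_mono) (simp add: power_mono)

text \<open>The maximum principle is applied to \<open>f\<^sup>n / (1 + w - c)\<close>, which tends to zero at infinity; then \<open>n\<close>
  tends to infinity.\<close>

lemma holomorphic_bounded_on_halfplane:
  assumes hol: "f holomorphic_on rhp" and M: "\<And>w. w \<in> rhp \<Longrightarrow> cmod (f w) \<le> M"
    and c: "c > 0" and edge: "\<And>w. Re w = c \<Longrightarrow> cmod (f w) \<le> \<epsilon>" and "\<epsilon> > 0" and w0: "c \<le> Re w0"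
  shows "cmod (f w0) \<le> \<epsilon>"
proof (rule ccontr)
  assume notle: "\<not> ?thesis"
  then have "1 < cmod (f w0) / \<epsilon>" using \<open>\<epsilon> > 0\<close> by simp
  \<comment> \<open>A ratio above 1 has powers exceeding the fixed factor
    \<open>1 + (w0 - c)\<close>, which is all that the auxiliary denominator costs.\<close>
  then obtain n where n: "cmod (1 + (w0 - c)) < (cmod (f w0) / \<epsilon>) ^ n"
    using real_arch_pow by blast
  have "w0 \<in> rhp" using w0 c by (simp add: rhp_def)
  then have "M \<ge> 0" using M[of w0] norm_ge_zero order_trans by blast
  \<comment> \<open>Large enough that \<open>w0\<close> lies within the disc and that on the arc,
    where the denominator has modulus at least \<open>R\<close>, the crude bound
    \<open>M ^ n / R\<close> is at most \<open>\<epsilon> ^ n\<close>.\<close>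
  define R where "R = 1 + cmod (w0 - c) + M ^ n / \<epsilon> ^ n"
  have Rpos: "R > 0" "R > cmod (w0 - c)" "M ^ n / \<epsilon> ^ n \<le> R"
    using \<open>M \<ge> 0\<close> \<open>\<epsilon> > 0\<close> by (auto simp: R_def intro!: add_pos_nonneg divide_nonneg_pos)
  define F where "F w = f w ^ n / (1 + (w - c))" for w
  define S where "S = ball (complex_of_real c) R \<inter> {w. Re w > c}"
  have w0S: "w0 \<in> S \<or> Re w0 = c" using w0 Rpos by (auto simp: S_def dist_norm norm_minus_commute)
  have openS: "open S"
    unfolding S_def by (intro open_Int open_ball open_halfspace_Re_gt)
  have clS: "closure S \<subseteq> cball c R \<inter> {w. Re w \<ge> c}"
    unfolding S_def by (rule closure_minimal) (auto intro: closed_halfspace_Re_ge)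
  have sub: "closure S \<subseteq> rhp" using clS c by (auto simp: rhp_def)
  have nz: "1 + (w - c) \<noteq> 0" if "w \<in> closure S" for w
    using that clS by (auto simp: complex_eq_iff)
  have F: "F holomorphic_on closure S"
    unfolding F_def using nz by (intro holomorphic_intros holomorphic_on_subset[OF hol sub]) auto
  have ge: "1 \<le> cmod (1 + (w - c))" "cmod (w - c) \<le> cmod (1 + (w - c))" if "Re w \<ge> c" for w
  proof -
    show "1 \<le> cmod (1 + (w - c))"
      using that complex_Re_le_cmod[of "1 + (w - c)"] by simp
    show "cmod (w - c) \<le> cmod (1 + (w - c))"
      using cmod_le_cmod_add_real[of "w - c" 1] that by (simp add: add.commute)
  qed
  have "cmod (F w) \<le> \<epsilon> ^ n" if w: "w \<in> frontier S" for w
  proof -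
    have wc: "w \<in> cball c R" "Re w \<ge> c" "w \<notin> S" "w \<in> rhp"
      using w clS openS sub by (auto simp: frontier_def interior_open)
    then consider "Re w = c" | "cmod (w - c) = R"
      by (force simp: S_def dist_norm norm_minus_commute)
    then show ?thesis
    proof cases
      case 1
      have "cmod (F w) = cmod (f w) ^ n / cmod (1 + (w - c))"
        by (simp add: F_def norm_divide norm_power)
      also have "\<dots> \<le> \<epsilon> ^ n / 1"
        using edge[OF 1] ge(1)[OF wc(2)] \<open>\<epsilon> > 0\<close> by (intro frac_le power_mono) auto
      finally show ?thesis by simp
    next
      case 2
      have "cmod (F w) = cmod (f w) ^ n / cmod (1 + (w - c))"
        by (simp add: F_def norm_divide norm_power)
      also have "\<dots> \<le> M ^ n / R"
        using M[OF wc(4)] ge(2)[OF wc(2)] 2 Rpos \<open>M \<ge> 0\<close> by (intro frac_le power_mono) auto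
      also have "\<dots> \<le> \<epsilon> ^ n"
        using Rpos \<open>\<epsilon> > 0\<close> by (simp add: field_simps)
      finally show ?thesis .
    qed
  qed
  moreover have "bounded S" using bounded_subset[OF bounded_ball] by (auto simp: S_def)
  moreover have "F holomorphic_on interior S" "continuous_on (closure S) F"
    using F openS closure_subset by (auto intro: holomorphic_on_imp_continuous_on holomorphic_on_subset
      simp: interior_open)
  ultimately have *: "cmod (F w0) \<le> \<epsilon> ^ n" if "w0 \<in> S"
    using maximum_modulus_frontier that by blast
  have "cmod (F w0) \<le> \<epsilon> ^ n"
  proof (cases "w0 \<in> S")
    case False
    then have "Re w0 = c" using w0S by simp
    then show ?thesis using edge notle by blast
  qed (rule *)
  moreover have "0 < cmod (1 + (w0 - c))" using ge(1)[OF w0] by linarith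
  ultimately have "cmod (f w0) ^ n \<le> \<epsilon> ^ n * cmod (1 + (w0 - c))"
    by (simp add: F_def norm_divide norm_power pos_divide_le_eq)
  then have "(cmod (f w0) / \<epsilon>) ^ n \<le> cmod (1 + (w0 - c))"
    using \<open>\<epsilon> > 0\<close> by (simp add: power_divide field_simps)
  then show False using n by simp
qed

text \<open>Closed half planes, so that the edge itself is included. As limits are required for
  every \<open>c > 0\<close>, the resulting notion is the same as with the open half planes that
  correspond to horospheres.\<close>

definition halfplane_at_infinity :: "real \<Rightarrow> complex filter" where
  "halfplane_at_infinity c = inf at_infinity (principal {w. c \<le> Re w})"

lemma eventually_halfplane_at_infinity:
  "eventually P (halfplane_at_infinity c) \<longleftrightarrow> (\<exists>b. \<forall>w. c \<le> Re w \<longrightarrow> b \<le> cmod w \<longrightarrow> P w)"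
  unfolding halfplane_at_infinity_def eventually_inf_principal eventually_at_infinity by auto

text \<open>The factor \<open>w / (w + K)\<close> has modulus at most one, is small on any bounded part of the edge if \<open>K\<close> is
  large, and tends to one at infinity.\<close>

lemma tendsto_zero_halfplane:
  assumes hol: "f holomorphic_on rhp" and M: "\<And>w. w \<in> rhp \<Longrightarrow> cmod (f w) \<le> M"
    and c: "c > 0" and edge: "(f \<longlongrightarrow> 0) (inf at_infinity (principal {w. Re w = c}))"
  shows "(f \<longlongrightarrow> 0) (halfplane_at_infinity c)"
proof (rule tendstoI)
  fix e :: real assume e: "e > 0"
  \<comment> \<open>A third, because undoing the factor costs \<open>|(w + K) / w| \<le> 2\<close>
    once \<open>|w| \<ge> K\<close>.\<close>
  define \<epsilon> where "\<epsilon> = e / 3"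
  have \<epsilon>: "\<epsilon> > 0" using e by (simp add: \<epsilon>_def)
  have "\<forall>\<^sub>F w in inf at_infinity (principal {w. Re w = c}). dist (f w) 0 < \<epsilon>"
    using tendstoD[OF edge \<epsilon>] .
  then obtain b where b: "\<And>w. Re w = c \<Longrightarrow> b \<le> cmod w \<Longrightarrow> cmod (f w) < \<epsilon>"
    unfolding eventually_inf_principal eventually_at_infinity by auto
  define N where "N = max 1 b"
  have "(1::complex) \<in> rhp" by (simp add: rhp_def)
  then have M0: "M \<ge> 0" using M[of 1] norm_ge_zero order_trans by blast
  \<comment> \<open>On the part \<open>|w| \<le> N\<close> of the edge this makes
    \<open>|F w| \<le> M N / K = M \<epsilon> / (M + 1)\<close>, which is at most \<epsilon>;
    further out on the edge \<open>f\<close> itself is small.\<close>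
  define K where "K = N * (M + 1) / \<epsilon>"
  have K: "K > 0" using M0 \<epsilon> by (simp add: K_def N_def)
  have nz: "w + complex_of_real K \<noteq> 0" if "w \<in> rhp" for w
    using that K by (auto simp: rhp_def complex_eq_iff)
  have leK: "cmod w \<le> cmod (w + K)" "K \<le> cmod (w + K)" if "w \<in> rhp" for w
  proof -
    have "Re w > 0" using that by (simp add: rhp_def)
    then show "cmod w \<le> cmod (w + K)"
      using K by (intro cmod_le_cmod_add_real) auto
    show "K \<le> cmod (w + K)"
      using \<open>Re w > 0\<close> complex_Re_le_cmod[of "w + K"] by simp
  qed
  define F where "F w = f w * (w / (w + K))" for w
  have F: "F holomorphic_on rhp"
    unfolding F_def by (intro holomorphic_intros hol nz)
  have quot: "cmod (w / (w + K)) \<le> 1" if "w \<in> rhp" for w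
    using leK(1)[OF that] nz[OF that] by (simp add: norm_divide)
  have FM: "cmod (F w) \<le> M" if "w \<in> rhp" for w
    unfolding F_def norm_mult using mult_mono[OF M[OF that] quot[OF that]] M0 by simp
  have Fe: "cmod (F w) \<le> \<epsilon>" if "Re w = c" for w
  proof -
    have w: "w \<in> rhp" using that c by (simp add: rhp_def)
    show ?thesis
    proof (cases "b \<le> cmod w")
      case True
      then show ?thesis
        unfolding F_def norm_mult
        using mult_mono[OF less_imp_le[OF b[OF that True]] quot[OF w]] \<epsilon> by simp
    next
      case False
      then have "cmod w \<le> N" "0 \<le> N" by (simp_all add: N_def)
      then have "cmod (w / (w + K)) \<le> N / K"
        unfolding norm_divide using leK(2)[OF w] K by (intro frac_le) auto
      then have "cmod (F w) \<le> M * (N / K)"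
        unfolding F_def norm_mult by (intro mult_mono M[OF w] M0) auto
      also have "N / K = \<epsilon> / (M + 1)" using M0 \<epsilon> by (simp add: K_def N_def)
      also have "M * (\<epsilon> / (M + 1)) \<le> \<epsilon>" using M0 \<epsilon> by (simp add: field_simps)
      finally show ?thesis .
    qed
  qed
  have "cmod (f w) < e" if w: "c \<le> Re w" "K \<le> cmod w" for w
  proof -
    have wr: "w \<in> rhp" using w c by (simp add: rhp_def)
    have w0: "w \<noteq> 0" using w c by auto
    have "cmod (f w) = cmod (F w) * cmod ((w + K) / w)"
      using w0 nz[OF wr] by (simp add: F_def flip: norm_mult)
    also have "\<dots> \<le> \<epsilon> * 2"
    proof (intro mult_mono)
      show "cmod (F w) \<le> \<epsilon>"
        by (rule holomorphic_bounded_on_halfplane[OF F FM c Fe \<epsilon> w(1)])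
      have "cmod (w + K) \<le> 2 * cmod w"
        using norm_triangle_ineq[of w "complex_of_real K"] K w(2) by simp
      then show "cmod ((w + K) / w) \<le> 2" using w0 by (simp add: norm_divide field_simps)
    qed (use \<epsilon> in auto)
    also have "\<dots> < e" using e by (simp add: \<epsilon>_def)
    finally show ?thesis .
  qed
  then show "\<forall>\<^sub>F w in halfplane_at_infinity c. dist (f w) 0 < e"
    unfolding eventually_halfplane_at_infinity by auto
qed

section \<open>Automorphisms with Denjoy-Wolff points\<close>

definition halfplane_limit :: "(complex \<Rightarrow> complex) \<Rightarrow> riemann_sphere \<Rightarrow> bool" where
  "halfplane_limit g L \<longleftrightarrow> (\<forall>c>0. ((\<lambda>w. Pt (g w)) \<longlongrightarrow> L) (halfplane_at_infinity c))"

text \<open>Vertical translations are the parabolic automorphisms of the half plane that fix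
  infinity. Their orbits stay on one line \<open>Re w = c\<close>, so each sign of \<open>t\<close>
  probes one side of the horocycle.\<close>

lemma translation_automorphism:
  assumes g: "biholomorphism g rhp \<Omega>" and "t \<noteq> 0"
  obtains f where "f \<in> Aut_d \<Omega>"
    "\<And>w n. w \<in> rhp \<Longrightarrow> (f ^^ n) (g w) = g (w + \<i> * of_real t * of_nat n)"
proof -
  obtain h where gh: "g holomorphic_on rhp" "h holomorphic_on \<Omega>"
    "\<And>z. z \<in> rhp \<Longrightarrow> g z \<in> \<Omega>" "\<And>z. z \<in> rhp \<Longrightarrow> h (g z) = z"
    "\<And>z. z \<in> \<Omega> \<Longrightarrow> h z \<in> rhp" "\<And>z. z \<in> \<Omega> \<Longrightarrow> g (h z) = z"
    by (rule biholomorphismE[OF g]) (rule that)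
  define \<tau> where "\<tau> w = w + \<i> * complex_of_real t" for w
  have \<tau>: "biholomorphism \<tau> rhp rhp"
    unfolding \<tau>_def
    by (rule biholomorphismI[where g = "\<lambda>w. w - \<i> * complex_of_real t"])
      (auto intro!: holomorphic_intros simp: rhp_def)
  have h: "biholomorphism h \<Omega> rhp"
    by (rule biholomorphism_inverse[OF gh])
  define f where "f = g \<circ> (\<tau> \<circ> h)"
  have f: "biholomorphism f \<Omega> \<Omega>"
    unfolding f_def by (intro biholomorphism_compose[OF biholomorphism_compose[OF h \<tau>] g])
  have \<tau>_rhp: "\<tau> w \<in> rhp" if "w \<in> rhp" for w
    using that by (simp add: \<tau>_def rhp_def)
  have "f z \<noteq> z" if z: "z \<in> \<Omega>" for z
  proof
    assume "f z = z"
    then have "h (g (\<tau> (h z))) = h z" by (simp add: f_def)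
    then have "\<tau> (h z) = h z" using gh(4)[OF \<tau>_rhp[OF gh(5)[OF z]]] by simp
    then show False using assms(2) by (simp add: \<tau>_def)
  qed
  then have "f \<in> Aut_d \<Omega>"
    using f by (auto simp: Aut_d_def Hol_d_def biholomorphism_def bij_betw_def)
  moreover have "(f ^^ n) (g w) = g (w + \<i> * of_real t * of_nat n)" if w: "w \<in> rhp" for w n
  proof (induction n)
    case (Suc n)
    have "w + \<i> * of_real t * of_nat n \<in> rhp" using w by (simp add: rhp_def)
    then have "f (g (w + \<i> * of_real t * of_nat n)) = g (\<tau> (w + \<i> * of_real t * of_nat n))"
      by (simp add: f_def gh(4))
    then show ?case by (simp add: Suc \<tau>_def algebra_simps)
  qed simp
  ultimately show ?thesis by (rule that)
qed

text \<open>A single orbit only sees the heights \<open>t * s + t * n\<close>; uniform convergence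
  on the compact image of one period, \<open>s\<close> in \<open>[0, 1]\<close>, covers all heights
  in between. The point \<tau> comes from the automorphism alone and is the same for all
  \<open>c\<close>.\<close>

lemma vertical_limit_exists:
  assumes g: "biholomorphism g rhp \<Omega>" and aut: "\<forall>f\<in>Aut_d \<Omega>. has_Denjoy_Wolff_point \<Omega> f"
    and "t \<noteq> 0"
  obtains \<tau> where "\<tau> \<in> sphere_boundary \<Omega>"
    "\<And>c. c > 0 \<Longrightarrow> ((\<lambda>y. Pt (g (Complex c (t * y)))) \<longlongrightarrow> \<tau>) at_top"
proof -
  obtain f where f: "f \<in> Aut_d \<Omega>"
    and iter: "\<And>w n. w \<in> rhp \<Longrightarrow> (f ^^ n) (g w) = g (w + \<i> * of_real t * of_nat n)"
    by (rule translation_automorphism[OF g \<open>t \<noteq> 0\<close>]) (rule that)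
  have "has_Denjoy_Wolff_point \<Omega> f" using aut f by blast
  then obtain \<tau> where \<tau>: "\<tau> \<in> sphere_boundary \<Omega>"
    and lim: "\<And>K. compact K \<Longrightarrow> K \<subseteq> \<Omega> \<Longrightarrow> uniform_limit K (\<lambda>n z. Pt ((f ^^ n) z)) (\<lambda>_. \<tau>) sequentially"
    by (auto simp: has_Denjoy_Wolff_point_def)
  have "((\<lambda>y. Pt (g (Complex c (t * y)))) \<longlongrightarrow> \<tau>) at_top" if c: "c > 0" for c
  proof (rule tendstoI)
    fix e :: real assume "e > 0"
    define K where "K = (\<lambda>s. g (Complex c (t * s))) ` {0..1}"
    have rhp: "Complex c x \<in> rhp" for x using c by (simp add: rhp_def)
    have hol: "g holomorphic_on rhp" using g by (simp add: biholomorphism_def)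
    have "continuous_on {0..1} (\<lambda>s. Complex c (t * s))"
      unfolding Complex_eq by (intro continuous_intros)
    then have "continuous_on {0..1} (\<lambda>s. g (Complex c (t * s)))"
      by (rule continuous_on_compose2[OF holomorphic_on_imp_continuous_on[OF hol]]) (use rhp in auto)
    then have "compact K" unfolding K_def by (intro compact_continuous_image) auto
    moreover have "K \<subseteq> \<Omega>"
      using g rhp by (auto simp: K_def biholomorphism_def bij_betw_def)
    ultimately have "\<forall>\<^sub>F n in sequentially. \<forall>z\<in>K. dist (Pt ((f ^^ n) z)) \<tau> < e"
      using uniform_limitD[OF lim \<open>e > 0\<close>] by blast
    then obtain N where N: "\<And>n z. n \<ge> N \<Longrightarrow> z \<in> K \<Longrightarrow> dist (Pt ((f ^^ n) z)) \<tau> < e"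
      unfolding eventually_sequentially by blast
    show "\<forall>\<^sub>F y in at_top. dist (Pt (g (Complex c (t * y)))) \<tau> < e"
      using eventually_ge_at_top[of "real N"]
    proof eventually_elim
      case (elim y)
      define n where "n = nat \<lfloor>y\<rfloor>"
      define s where "s = y - real n"
      have y0: "0 \<le> y" using elim by (rule order_trans[rotated]) simp
      have s: "s \<in> {0..1}" using y0 unfolding s_def n_def by (auto simp: of_nat_floor) linarith
      have n: "n \<ge> N" using elim unfolding n_def by (simp add: le_nat_floor)
      have "(f ^^ n) (g (Complex c (t * s))) = g (Complex c (t * s) + \<i> * of_real t * of_nat n)"
        by (rule iter[OF rhp])
      also have "Complex c (t * s) + \<i> * of_real t * of_nat n = Complex c (t * y)"
        by (simp add: complex_eq_iff s_def algebra_simps)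
      finally show ?case
        using N[OF n, of "g (Complex c (t * s))"] s by (auto simp: K_def)
    qed
  qed
  then show ?thesis using that[OF \<tau>] by blast
qed

section \<open>Lindelof's theorem: from the two ends of a line to the half plane\<close>

lemma tendsto_vertical_line:
  fixes k :: "complex \<Rightarrow> 'a::metric_space"
  assumes "((\<lambda>y. k (Complex c y)) \<longlongrightarrow> l) at_top" "((\<lambda>y. k (Complex c (- y))) \<longlongrightarrow> l) at_top"
  shows "(k \<longlongrightarrow> l) (inf at_infinity (principal {w. Re w = c}))"
proof (rule tendstoI)
  fix e :: real assume e: "e > 0"
  have "\<forall>\<^sub>F y in at_top. dist (k (Complex c y)) l < e \<and> dist (k (Complex c (- y))) l < e"
    using tendstoD[OF assms(1) e] tendstoD[OF assms(2) e] by (rule eventually_conj)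
  then obtain b where b: "\<And>y. y \<ge> b \<Longrightarrow> dist (k (Complex c y)) l < e \<and> dist (k (Complex c (- y))) l < e"
    unfolding eventually_at_top_linorder by blast
  have "dist (k w) l < e" if "\<bar>c\<bar> + b \<le> cmod w" "Re w = c" for w
  proof -
    have "b \<le> \<bar>Im w\<bar>" using cmod_le[of w] that by linarith
    then have "dist (k (Complex c (Im w))) l < e"
      using b[of "Im w"] b[of "- Im w"] by (cases "Im w \<ge> 0") auto
    then show ?thesis using that(2) by (metis complex_surj)
  qed
  then show "\<forall>\<^sub>F w in inf at_infinity (principal {w. Re w = c}). dist (k w) l < e"
    unfolding eventually_inf_principal eventually_at_infinity by auto
qed

lemma half_circle_in_halfplane:
  fixes c R \<theta> :: real
  assumes "0 \<le> R" "\<theta> \<in> {-(pi/2)..pi/2}"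
  shows "c \<le> Re (c + R * cis \<theta>)" "R - \<bar>c\<bar> \<le> cmod (c + R * cis \<theta>)"
proof -
  show "c \<le> Re (c + R * cis \<theta>)"
    using assms by (simp add: cos_ge_zero)
  have "cmod (R * cis \<theta>) \<le> cmod (c + R * cis \<theta>) + cmod (complex_of_real c)"
    using norm_triangle_ineq4[of "c + R * cis \<theta>" "complex_of_real c"] by simp
  then show "R - \<bar>c\<bar> \<le> cmod (c + R * cis \<theta>)"
    using assms by (simp add: norm_mult)
qed

lemma halfplane_at_infinity_le_rhp:
  assumes "c > 0"
  shows "\<forall>\<^sub>F w in halfplane_at_infinity c. w \<in> rhp"
  unfolding eventually_halfplane_at_infinity using assms by (auto simp: rhp_def)

lemma filterlim_halfplane_at_infinity:
  "filterlim x (halfplane_at_infinity c) F \<longleftrightarrow>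
     filterlim x at_infinity F \<and> (\<forall>\<^sub>F n in F. c \<le> Re (x n))"
  unfolding halfplane_at_infinity_def by (simp add: filterlim_inf filterlim_principal)

text \<open>If the limits along the two ends of the line were different points, a
  half circle joining the two ends would carry a value of \<open>g\<close> at half the distance from the first of
  them, although every cluster value at infinity is one of the two.\<close>

lemma two_ended_limit:
  assumes g: "biholomorphism g rhp \<Omega>" and "\<Omega> \<noteq> UNIV" and c: "c > 0"
    and up: "((\<lambda>y. Pt (g (Complex c y))) \<longlongrightarrow> \<tau>) at_top"
    and down: "((\<lambda>y. Pt (g (Complex c (- y)))) \<longlongrightarrow> \<tau>') at_top"
  shows "\<tau>' = \<tau> \<and> ((\<lambda>w. Pt (g w)) \<longlongrightarrow> \<tau>) (halfplane_at_infinity c)"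
proof -
  obtain k M where k: "k holomorphic_on rhp" "\<And>w. w \<in> rhp \<Longrightarrow> cmod (k w) \<le> M"
    and k_iff: "\<And>F. \<forall>\<^sub>F w in F. w \<in> rhp \<Longrightarrow> (k \<longlongrightarrow> 0) F \<longleftrightarrow> ((\<lambda>w. Pt (g w)) \<longlongrightarrow> \<tau>) F"
    by (rule bounded_test_function[OF g \<open>\<Omega> \<noteq> UNIV\<close>]) (rule that)
  obtain k' M' where k': "k' holomorphic_on rhp" "\<And>w. w \<in> rhp \<Longrightarrow> cmod (k' w) \<le> M'"
    and k'_iff: "\<And>F. \<forall>\<^sub>F w in F. w \<in> rhp \<Longrightarrow> (k' \<longlongrightarrow> 0) F \<longleftrightarrow> ((\<lambda>w. Pt (g w)) \<longlongrightarrow> \<tau>') F"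
    by (rule bounded_test_function[OF g \<open>\<Omega> \<noteq> UNIV\<close>]) (rule that)
  have k_iff_seq: "((\<lambda>n. k (x n)) \<longlongrightarrow> 0) F \<longleftrightarrow> ((\<lambda>n. Pt (g (x n))) \<longlongrightarrow> \<tau>) F"
    if "\<And>n. x n \<in> rhp" for x :: "'b \<Rightarrow> complex" and F
    using k_iff[of "filtermap x F"] that by (simp add: eventually_filtermap filterlim_filtermap)
  have k'_iff_seq: "((\<lambda>n. k' (x n)) \<longlongrightarrow> 0) F \<longleftrightarrow> ((\<lambda>n. Pt (g (x n))) \<longlongrightarrow> \<tau>') F"
    if "\<And>n. x n \<in> rhp" for x :: "'b \<Rightarrow> complex" and F
    using k'_iff[of "filtermap x F"] that by (simp add: eventually_filtermap filterlim_filtermap)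
  have vert: "Complex c y \<in> rhp" for y using c by (simp add: rhp_def)
  have ku: "((\<lambda>y. k (Complex c y)) \<longlongrightarrow> 0) at_top"
    using up k_iff_seq[of "\<lambda>y. Complex c y" at_top] vert by blast
  have k'd: "((\<lambda>y. k' (Complex c (- y))) \<longlongrightarrow> 0) at_top"
    using down k'_iff_seq[of "\<lambda>y. Complex c (- y)" at_top] vert by blast
  have M0: "0 \<le> M" "0 \<le> M'"
    using k(2)[OF vert] k'(2)[OF vert] norm_ge_zero order_trans by blast+
  \<comment> \<open>\<open>k\<close> tends to zero along the upper end and \<open>k'\<close> along
    the lower one, and both are bounded. So the product tends to zero along the whole line, and the
    half plane principle applies to it.\<close>
  define p where "p w = k w * k' w" for w
  have p_hol: "p holomorphic_on rhp" unfolding p_def by (intro holomorphic_intros k k')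
  have p_le: "cmod (p w) \<le> M * M'" if "w \<in> rhp" for w
    unfolding p_def norm_mult by (intro mult_mono k(2) k'(2) that M0 norm_ge_zero)
  have "((\<lambda>y. p (Complex c y)) \<longlongrightarrow> 0) at_top"
  proof (rule Lim_null_comparison)
    show "\<forall>\<^sub>F y in at_top. cmod (p (Complex c y)) \<le> cmod (k (Complex c y)) * M'"
      unfolding p_def norm_mult by (intro always_eventually allI mult_left_mono k'(2) vert norm_ge_zero)
    show "((\<lambda>y. cmod (k (Complex c y)) * M') \<longlongrightarrow> 0) at_top"
      by (intro tendsto_mult_left_zero tendsto_norm_zero ku)
  qed
  moreover have "((\<lambda>y. p (Complex c (- y))) \<longlongrightarrow> 0) at_top"
  proof (rule Lim_null_comparison)
    show "\<forall>\<^sub>F y in at_top. cmod (p (Complex c (- y))) \<le> M * cmod (k' (Complex c (- y)))"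
      unfolding p_def norm_mult by (intro always_eventually allI mult_right_mono k(2) vert norm_ge_zero)
    show "((\<lambda>y. M * cmod (k' (Complex c (- y)))) \<longlongrightarrow> 0) at_top"
      by (intro tendsto_mult_right_zero tendsto_norm_zero k'd)
  qed
  ultimately have p0: "(p \<longlongrightarrow> 0) (halfplane_at_infinity c)"
    by (intro tendsto_zero_halfplane[OF p_hol p_le c] tendsto_vertical_line)
  have "\<tau>' = \<tau>"
  proof (rule ccontr)
    assume ne: "\<tau>' \<noteq> \<tau>"
    define d where "d = dist \<tau>' \<tau>"
    have d: "d > 0" using ne by (simp add: d_def)
    have "\<forall>\<^sub>F y in at_top. dist (Pt (g (Complex c y))) \<tau> < d / 2 \<and>
        dist (Pt (g (Complex c (- y)))) \<tau>' < d / 2"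
      using tendstoD[OF up, of "d / 2"] tendstoD[OF down, of "d / 2"] d by (auto intro: eventually_conj)
    then obtain b where b: "\<And>y. y \<ge> b \<Longrightarrow> dist (Pt (g (Complex c y))) \<tau> < d / 2 \<and>
        dist (Pt (g (Complex c (- y)))) \<tau>' < d / 2"
      unfolding eventually_at_top_linorder by blast
    have "\<exists>w. c \<le> Re w \<and> real n \<le> cmod w \<and> dist (Pt (g w)) \<tau> = d / 2" for n
    proof -
      \<comment> \<open>Both ends \<open>Complex c R\<close> and \<open>Complex c (- R)\<close> of
        the half circle lie beyond \<open>b\<close>, and the arc keeps a distance of at least
        \<open>R - |c|\<close>, hence of at least \<open>n\<close>, from 0.\<close>
      define R where "R = \<bar>b\<bar> + \<bar>c\<bar> + real n"
      have R: "0 \<le> R" "b \<le> R" by (auto simp: R_def)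
      let ?w = "\<lambda>\<theta>. complex_of_real c + R * cis \<theta>"
      let ?D = "\<lambda>\<theta>. dist (Pt (g (?w \<theta>))) \<tau>"
      have w_rhp: "?w \<theta> \<in> rhp" if "\<theta> \<in> {-(pi/2)..pi/2}" for \<theta>
        using half_circle_in_halfplane(1)[OF R(1) that, of c] c unfolding rhp_def by simp
      have cont: "continuous_on {-(pi/2)..pi/2} ?D"
      proof -
        have "continuous_on rhp g" using g by (simp add: biholomorphism_def holomorphic_on_imp_continuous_on)
        moreover have "continuous_on {-(pi/2)..pi/2} ?w" by (intro continuous_intros)
        ultimately have "continuous_on {-(pi/2)..pi/2} (\<lambda>\<theta>. g (?w \<theta>))"
          by (rule continuous_on_compose2) (use w_rhp in auto)
        then have "continuous_on {-(pi/2)..pi/2} (\<lambda>\<theta>. Pt (g (?w \<theta>)))"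
          by (rule continuous_on_compose2[OF continuous_Pt[of UNIV]]) auto
        then show ?thesis by (intro continuous_intros)
      qed
      have "?w (pi/2) = Complex c R" "?w (-(pi/2)) = Complex c (- R)"
        by (simp_all add: complex_eq_iff)
      then have "?D (pi/2) < d / 2" "dist (Pt (g (?w (-(pi/2))))) \<tau>' < d / 2"
        using b[OF R(2)] by simp_all
      moreover have "d \<le> dist (Pt (g (?w (-(pi/2))))) \<tau>' + ?D (-(pi/2))"
        unfolding d_def by (metis dist_commute dist_triangle)
      ultimately have "?D (pi/2) \<le> d / 2" "d / 2 \<le> ?D (-(pi/2))" by linarith+
      then obtain \<theta> where \<theta>: "- (pi/2) \<le> \<theta>" "\<theta> \<le> pi/2" "?D \<theta> = d / 2"
        using IVT2'[of ?D "pi/2" "d/2" "-(pi/2)"] cont by auto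
      then have "\<theta> \<in> {-(pi/2)..pi/2}" by simp
      from half_circle_in_halfplane[OF R(1) this, of c] \<theta>(3) show ?thesis
        by (intro exI[of _ "?w \<theta>"]) (auto simp: R_def)
    qed
    then obtain x where x: "\<And>n. c \<le> Re (x n)" "\<And>n. real n \<le> cmod (x n)"
        "\<And>n. dist (Pt (g (x n))) \<tau> = d / 2"
      by metis
    have x_rhp: "x n \<in> rhp" for n using x(1)[of n] c by (simp add: rhp_def)
    have "filterlim x at_infinity sequentially"
      unfolding filterlim_at_infinity_conv_norm_at_top
      by (rule filterlim_at_top_mono[OF filterlim_real_sequentially]) (use x(2) in auto)
    then have xlim: "filterlim x (halfplane_at_infinity c) sequentially"
      using x(1) by (simp add: filterlim_halfplane_at_infinity)
    \<comment> \<open>No convergence of \<open>g\<close> is known along \<open>x\<close>, but the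
      bounded pair of test functions has a convergent subsequence, and the product of its two limits
      is zero.\<close>
    have "(k (x n), k' (x n)) \<in> cball 0 M \<times> cball 0 M'" for n
      using k(2)[OF x_rhp] k'(2)[OF x_rhp] by simp
    then obtain l r where r: "strict_mono (r :: nat \<Rightarrow> nat)"
      and l: "(\<lambda>n. (k (x (r n)), k' (x (r n)))) \<longlonglongrightarrow> l"
      by (rule compact_convergent_subsequence[OF compact_Times[OF compact_cball compact_cball]]) (rule that)
    have l12: "(\<lambda>n. k (x (r n))) \<longlonglongrightarrow> fst l" "(\<lambda>n. k' (x (r n))) \<longlonglongrightarrow> snd l"
      using tendsto_fst[OF l] tendsto_snd[OF l] by simp_all
    have "(\<lambda>n. p (x (r n))) \<longlonglongrightarrow> fst l * snd l"
      unfolding p_def by (intro tendsto_mult l12)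
    moreover have "(\<lambda>n. p (x (r n))) \<longlonglongrightarrow> 0"
      using filterlim_compose[OF p0 filterlim_compose[OF xlim filterlim_subseq[OF r]]] .
    ultimately have "fst l * snd l = 0" by (rule LIMSEQ_unique)
    \<comment> \<open>Whichever factor vanishes, the distance of \<open>g\<close> to \<tau> tends to
      0 or to \<open>d\<close> along the subsequence; by construction it is constantly
      \<open>d / 2\<close>.\<close>
    then consider "fst l = 0" | "snd l = 0" by auto
    then show False
    proof cases
      case 1
      then have "(\<lambda>n. Pt (g (x (r n)))) \<longlonglongrightarrow> \<tau>"
        using l12(1) k_iff_seq[of "\<lambda>n. x (r n)" sequentially] x_rhp by simp
      then have "(\<lambda>n. dist (Pt (g (x (r n)))) \<tau>) \<longlonglongrightarrow> 0" by (rule tendsto_dist_iff[THEN iffD1])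
      then show False using d by (simp add: x(3) LIMSEQ_const_iff)
    next
      case 2
      then have "(\<lambda>n. Pt (g (x (r n)))) \<longlonglongrightarrow> \<tau>'"
        using l12(2) k'_iff_seq[of "\<lambda>n. x (r n)" sequentially] x_rhp by simp
      then have "(\<lambda>n. dist (Pt (g (x (r n)))) \<tau>) \<longlonglongrightarrow> dist \<tau>' \<tau>" by (intro tendsto_intros)
      then show False using d by (simp add: x(3) LIMSEQ_const_iff d_def)
    qed
  qed
  moreover have "((\<lambda>w. Pt (g w)) \<longlongrightarrow> \<tau>) (halfplane_at_infinity c)"
  proof -
    have kd: "((\<lambda>y. k (Complex c (- y))) \<longlongrightarrow> 0) at_top"
      using down k_iff_seq[of "\<lambda>y. Complex c (- y)" at_top] vert calculation by blast
    have "(k \<longlongrightarrow> 0) (halfplane_at_infinity c)"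
      by (intro tendsto_zero_halfplane[OF k c] tendsto_vertical_line ku kd)
    then show ?thesis using k_iff[OF halfplane_at_infinity_le_rhp[OF c]] by blast
  qed
  ultimately show ?thesis by blast
qed

lemma halfplane_limit_of_automorphisms:
  assumes g: "biholomorphism g rhp \<Omega>" and "\<Omega> \<noteq> UNIV"
    and aut: "\<forall>f\<in>Aut_d \<Omega>. has_Denjoy_Wolff_point \<Omega> f"
  obtains L where "L \<in> sphere_boundary \<Omega>" "halfplane_limit g L"
proof -
  obtain \<tau> where \<tau>: "\<tau> \<in> sphere_boundary \<Omega>"
    "\<And>c. c > 0 \<Longrightarrow> ((\<lambda>y. Pt (g (Complex c (1 * y)))) \<longlongrightarrow> \<tau>) at_top"
    by (rule vertical_limit_exists[OF g aut, of 1]) (auto intro: that)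
  obtain \<tau>' where \<tau>':
    "\<And>c. c > 0 \<Longrightarrow> ((\<lambda>y. Pt (g (Complex c ((-1) * y)))) \<longlongrightarrow> \<tau>') at_top"
    by (rule vertical_limit_exists[OF g aut, of "-1"]) (auto intro: that)
  have "halfplane_limit g \<tau>"
    unfolding halfplane_limit_def
  proof (intro allI impI)
    fix c :: real assume "c > 0"
    then show "((\<lambda>w. Pt (g w)) \<longlongrightarrow> \<tau>) (halfplane_at_infinity c)"
      using two_ended_limit[OF g \<open>\<Omega> \<noteq> UNIV\<close>, of c \<tau> \<tau>'] \<tau>(2) \<tau>' by simp
  qed
  with \<tau>(1) show ?thesis by (rule that)
qed

section \<open>Wolff's lemma and iteration\<close>

text \<open>The Schwarz lemma conjugated by the Moebius map taking \<open>p\<close> to 0. The common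
  factor \<open>1 - |p|^2\<close>, which would degenerate, is cancelled and the denominators are
  cleared, so that the inequality survives when \<open>p\<close> approaches the unit circle.\<close>

lemma Schwarz_Pick_at_fixed_point:
  assumes hol: "\<psi> holomorphic_on ball 0 1" and im: "\<And>z. z \<in> ball 0 1 \<Longrightarrow> \<psi> z \<in> ball 0 1"
    and p: "p \<in> ball 0 1" "\<psi> p = p" and z: "z \<in> ball 0 1"
  shows "(cmod (1 - cnj p * \<psi> z))\<^sup>2 * (1 - (cmod z)\<^sup>2) \<le> (cmod (1 - cnj p * z))\<^sup>2 * (1 - (cmod (\<psi> z))\<^sup>2)"
proof -
  let ?M = "Moebius_function 0 p" and ?N = "Moebius_function 0 (- p)"
  define \<Theta> where "\<Theta> = ?M \<circ> (\<psi> \<circ> ?N)"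
  have np: "cmod p < 1" "cmod (- p) < 1" using p by auto
  have "\<Theta> holomorphic_on ball 0 1"
    unfolding \<Theta>_def
  proof (intro holomorphic_on_compose_gen[where t = "ball 0 1"])
    show "?N holomorphic_on ball 0 1" "?M holomorphic_on ball 0 1"
      by (rule Moebius_function_holomorphic, rule np)+
    show "?N ` ball 0 1 \<subseteq> ball 0 1"
      using Moebius_function_norm_lt_1[OF np(2)] by auto
    show "(\<psi> \<circ> ?N) ` ball 0 1 \<subseteq> ball 0 1"
      using im Moebius_function_norm_lt_1[OF np(2)] by auto
  qed (rule hol)
  moreover have "\<Theta> 0 = 0"
    by (simp add: \<Theta>_def Moebius_function_of_zero p(2) Moebius_function_eq_zero)
  moreover have "cmod (\<Theta> \<xi>) < 1" if "cmod \<xi> < 1" for \<xi>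
    using Moebius_function_norm_lt_1[OF np(1)] im Moebius_function_norm_lt_1[OF np(2) that] by (simp add: \<Theta>_def)
  moreover have "cmod (?M z) < 1"
    using Moebius_function_norm_lt_1[OF np(1)] z by auto
  ultimately have "cmod (\<Theta> (?M z)) \<le> cmod (?M z)"
    by (rule Schwarz_Lemma(1))
  moreover have "?N (?M z) = z"
    by (rule Moebius_function_compose) (use np z in auto)
  ultimately have "(cmod (?M (\<psi> z)))\<^sup>2 \<le> (cmod (?M z))\<^sup>2"
    by (simp add: \<Theta>_def power_mono)
  moreover have eq: "1 - (cmod (?M v))\<^sup>2 = (1 - (cmod p)\<^sup>2) * ((1 - (cmod v)\<^sup>2) / (cmod (1 - cnj p * v))\<^sup>2)"
    and nz: "cmod (1 - cnj p * v) > 0"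
    if "v \<in> ball 0 1" for v
  proof -
    have "cmod (cnj p * v) < 1" using np that by (simp add: norm_mult) (metis mult_less_cancel_left2 mult_strict_mono' norm_ge_zero mult_1)
    then show nz: "cmod (1 - cnj p * v) > 0" by auto
    have "(cmod (1 - cnj p * v))\<^sup>2 - (cmod (v - p))\<^sup>2 = (1 - (cmod p)\<^sup>2) * (1 - (cmod v)\<^sup>2)"
      unfolding cmod_power2 by (simp add: power2_eq_square algebra_simps)
    then show "1 - (cmod (?M v))\<^sup>2 = (1 - (cmod p)\<^sup>2) * ((1 - (cmod v)\<^sup>2) / (cmod (1 - cnj p * v))\<^sup>2)"
      using nz by (simp add: Moebius_function_simple norm_divide power_divide field_simps)
  qed
  ultimately have "(1 - (cmod p)\<^sup>2) * ((1 - (cmod z)\<^sup>2) / (cmod (1 - cnj p * z))\<^sup>2)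
      \<le> (1 - (cmod p)\<^sup>2) * ((1 - (cmod (\<psi> z))\<^sup>2) / (cmod (1 - cnj p * \<psi> z))\<^sup>2)"
    using eq[OF z] eq[OF im[OF z]] by linarith
  moreover have "0 < 1 - (cmod p)\<^sup>2" using np by (simp add: power_less_one_iff)
  ultimately have "(1 - (cmod z)\<^sup>2) / (cmod (1 - cnj p * z))\<^sup>2
      \<le> (1 - (cmod (\<psi> z))\<^sup>2) / (cmod (1 - cnj p * \<psi> z))\<^sup>2"
    by (rule mult_left_le_imp_le)
  then show ?thesis
    using nz[OF z] nz[OF im[OF z]] by (simp add: field_simps)
qed

text \<open>The point \<open>\<sigma>\<close> is a limit of fixed points of \<open>r \<phi>\<close> as \<open>r\<close> tends to one.\<close>

lemma Wolff_lemma: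
  assumes hol: "\<phi> holomorphic_on ball 0 1" and im: "\<And>z. z \<in> ball 0 1 \<Longrightarrow> \<phi> z \<in> ball 0 1"
    and nofix: "\<And>z. z \<in> ball 0 1 \<Longrightarrow> \<phi> z \<noteq> z"
  obtains \<sigma> where "cmod \<sigma> = 1"
    "\<And>z. z \<in> ball 0 1 \<Longrightarrow> Re (inv_cayley \<sigma> z) \<le> Re (inv_cayley \<sigma> (\<phi> z))"
proof -
  \<comment> \<open>The shift by 2 keeps every \<open>r n\<close> strictly between 0 and 1,
    including \<open>r 0\<close>.\<close>
  define r where "r n = 1 - inverse (real n + 2)" for n
  have r: "0 < r n" "r n < 1" for n by (auto simp: r_def field_simps)
  have "(\<lambda>n. inverse (real (n + 2))) \<longlonglongrightarrow> 0"
    by (rule LIMSEQ_ignore_initial_segment) (rule lim_inverse_n)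
  then have "(\<lambda>n. 1 - inverse (real (n + 2))) \<longlonglongrightarrow> 1 - 0" by (intro tendsto_intros)
  then have rlim: "r \<longlonglongrightarrow> 1" by (simp add: r_def[abs_def] add.commute)
  have "\<exists>p. p \<in> ball 0 1 \<and> r n * \<phi> p = p" for n
  proof -
    have sub: "cball 0 (r n) \<subseteq> ball (0::complex) 1" using r[of n] by auto
    obtain p where "p \<in> cball 0 (r n)" "r n * \<phi> p = p"
    proof (rule brouwer_ball[OF r(1)[of n], where f = "\<lambda>p. r n * \<phi> p"])
      show "continuous_on (cball 0 (r n)) (\<lambda>p. r n * \<phi> p)"
        by (intro continuous_intros continuous_on_subset[OF _ sub] holomorphic_on_imp_continuous_on[OF hol])
      show "(\<lambda>p. r n * \<phi> p) \<in> cball 0 (r n) \<rightarrow> cball 0 (r n)"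
      proof
        fix z :: complex assume "z \<in> cball 0 (r n)"
        then have "cmod (\<phi> z) \<le> 1" using im[of z] sub by force
        then show "r n * \<phi> z \<in> cball 0 (r n)"
          using r(1)[of n] mult_left_mono[of "cmod (\<phi> z)" 1 "r n"] by (simp add: norm_mult)
      qed
    qed (rule that)
    then show ?thesis using sub by blast
  qed
  then obtain p where p: "\<And>n. p n \<in> ball 0 1" "\<And>n. r n * \<phi> (p n) = p n" by metis
  have "p n \<in> cball 0 1" for n using p(1) by (simp add: less_imp_le)
  then obtain \<sigma> s where \<sigma>: "\<sigma> \<in> cball 0 1" and s: "strict_mono (s :: nat \<Rightarrow> nat)"
    and lim: "(\<lambda>n. p (s n)) \<longlonglongrightarrow> \<sigma>"
    by (rule compact_convergent_subsequence[OF compact_cball]) (rule that)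
  have rs: "(\<lambda>n. r (s n)) \<longlonglongrightarrow> 1" using LIMSEQ_subseq_LIMSEQ[OF rlim s] by (simp add: o_def)
  then have rsc: "(\<lambda>n. complex_of_real (r (s n))) \<longlonglongrightarrow> 1" using tendsto_of_real by fastforce
  \<comment> \<open>Inside the disc, continuity would turn the limit of the fixed points of
    \<open>r n * \<phi>\<close> into a fixed point of \<phi>.\<close>
  have \<sigma>1: "cmod \<sigma> = 1"
  proof (rule ccontr)
    assume "cmod \<sigma> \<noteq> 1"
    then have \<sigma>b: "\<sigma> \<in> ball 0 1" using \<sigma> by simp
    then have "isCont \<phi> \<sigma>"
      using hol holomorphic_on_imp_continuous_on continuous_on_interior by (metis interior_ball)
    then have "(\<lambda>n. \<phi> (p (s n))) \<longlonglongrightarrow> \<phi> \<sigma>" using lim by (rule isCont_tendsto_compose)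
    then have "(\<lambda>n. r (s n) * \<phi> (p (s n))) \<longlonglongrightarrow> 1 * \<phi> \<sigma>" by (intro tendsto_mult rsc)
    then have "(\<lambda>n. p (s n)) \<longlonglongrightarrow> \<phi> \<sigma>" by (simp add: p(2))
    then have "\<phi> \<sigma> = \<sigma>" using lim LIMSEQ_unique by blast
    then show False using nofix[OF \<sigma>b] by simp
  qed
  \<comment> \<open>On the unit circle \<open>1 - cnj \<sigma> * v\<close> and
    \<open>\<sigma> - v\<close> differ by the unimodular factor \<sigma>. The limiting Schwarz-Pick
    inequality thereby becomes a comparison of Poisson kernels.\<close>
  have norm_eq: "cmod (1 - cnj \<sigma> * v) = cmod (\<sigma> - v)" for v
  proof -
    have "\<sigma> * cnj \<sigma> = 1" using \<sigma>1 by (simp add: complex_norm_square[symmetric])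
    then have "\<sigma> * (1 - cnj \<sigma> * v) = \<sigma> - v" by (simp add: algebra_simps)
    then have "cmod \<sigma> * cmod (1 - cnj \<sigma> * v) = cmod (\<sigma> - v)" by (simp flip: norm_mult)
    then show ?thesis using \<sigma>1 by simp
  qed
  have "Re (inv_cayley \<sigma> z) \<le> Re (inv_cayley \<sigma> (\<phi> z))" if z: "z \<in> ball 0 1" for z
  proof -
    have le: "(cmod (1 - cnj (p n) * (r n * \<phi> z)))\<^sup>2 * (1 - (cmod z)\<^sup>2)
        \<le> (cmod (1 - cnj (p n) * z))\<^sup>2 * (1 - (cmod (r n * \<phi> z))\<^sup>2)" for n
    proof (rule Schwarz_Pick_at_fixed_point[of "\<lambda>v. r n * \<phi> v", OF _ _ p(1) p(2) z])
      show "(\<lambda>v. r n * \<phi> v) holomorphic_on ball 0 1" by (intro holomorphic_intros hol)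
      show "r n * \<phi> v \<in> ball 0 1" if "v \<in> ball 0 1" for v
      proof -
        have "r n * cmod (\<phi> v) < 1 * 1"
          using im[OF that] r[of n] by (intro mult_strict_mono) auto
        then show ?thesis using r(1)[of n] by (simp add: norm_mult)
      qed
    qed
    have "(cmod (1 - cnj \<sigma> * (1 * \<phi> z)))\<^sup>2 * (1 - (cmod z)\<^sup>2)
        \<le> (cmod (1 - cnj \<sigma> * z))\<^sup>2 * (1 - (cmod (1 * \<phi> z))\<^sup>2)"
    proof (rule LIMSEQ_le)
      show "(\<lambda>n. (cmod (1 - cnj (p (s n)) * (r (s n) * \<phi> z)))\<^sup>2 * (1 - (cmod z)\<^sup>2)) \<longlonglongrightarrow>
          (cmod (1 - cnj \<sigma> * (1 * \<phi> z)))\<^sup>2 * (1 - (cmod z)\<^sup>2)"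
        by (intro tendsto_intros lim rsc)
      show "(\<lambda>n. (cmod (1 - cnj (p (s n)) * z))\<^sup>2 * (1 - (cmod (r (s n) * \<phi> z))\<^sup>2)) \<longlonglongrightarrow>
          (cmod (1 - cnj \<sigma> * z))\<^sup>2 * (1 - (cmod (1 * \<phi> z))\<^sup>2)"
        by (intro tendsto_intros lim rsc)
    qed (use le in auto)
    then have "(cmod (\<sigma> - \<phi> z))\<^sup>2 * (1 - (cmod z)\<^sup>2) \<le> (cmod (\<sigma> - z))\<^sup>2 * (1 - (cmod (\<phi> z))\<^sup>2)"
      by (simp add: norm_eq)
    moreover have "cmod (\<sigma> - z) > 0" "cmod (\<sigma> - \<phi> z) > 0"
      using z im[OF z] \<sigma>1 by auto
    ultimately show ?thesis
      by (simp add: Re_inv_cayley[OF \<sigma>1] field_simps)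
  qed
  then show ?thesis using that[OF \<sigma>1] by blast
qed

text \<open>\<open>F w - w\<close> has nonnegative real part, and real part 0 at the interior point
  \<open>v\<close>. A nonconstant holomorphic function is open and would also take values with
  negative real part near \<open>v\<close>.\<close>

lemma halfplane_map_translation:
  assumes hol: "F holomorphic_on rhp" and Re_le: "\<And>w. w \<in> rhp \<Longrightarrow> Re w \<le> Re (F w)"
    and v: "v \<in> rhp" "Re (F v) = Re v" and w: "w \<in> rhp"
  shows "F w = w + (F v - v)"
proof -
  define D where "D w = F w - w" for w
  have "D constant_on rhp"
  proof (rule ccontr)
    assume "\<not> D constant_on rhp"
    moreover have "D holomorphic_on rhp" unfolding D_def by (intro holomorphic_intros hol)
    ultimately have "open (D ` rhp)"
      using open_mapping_thm[OF _ open_rhp convex_connected[OF convex_rhp] open_rhp] by blast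
    then obtain e where e: "e > 0" "ball (D v) e \<subseteq> D ` rhp"
      using v(1) by (meson imageI openE)
    have "D v - complex_of_real (e / 2) \<in> ball (D v) e" using e(1) by (simp add: dist_norm)
    then obtain u where u: "u \<in> rhp" "D v - complex_of_real (e / 2) = D u" using e(2) by blast
    have "Re (D v) = 0" using v(2) by (simp add: D_def)
    then have "Re (D u) = - e / 2" by (simp flip: u(2))
    then show False using Re_le[OF u(1)] e(1) by (simp add: D_def)
  qed
  then have "D w = D v" using v(1) w unfolding constant_on_def by metis
  then show ?thesis by (simp add: D_def algebra_simps)
qed

section \<open>Orbits of a fixed point free map that never decreases the real part\<close>

context
  fixes F :: "complex \<Rightarrow> complex"
  assumes hol: "F holomorphic_on rhp"
    and Re_le: "\<And>w. w \<in> rhp \<Longrightarrow> Re w \<le> Re (F w)"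
    and nofix: "\<And>w. w \<in> rhp \<Longrightarrow> F w \<noteq> w"
begin

lemma iterate_rhp: "w \<in> rhp \<Longrightarrow> (F ^^ n) w \<in> rhp"
proof (induction n)
  case (Suc n)
  then show ?case using Re_le[of "(F ^^ n) w"] by (simp add: rhp_def)
qed simp

lemma incseq_Re_iterate: "w \<in> rhp \<Longrightarrow> incseq (\<lambda>n. Re ((F ^^ n) w))"
  using Re_le iterate_rhp by (intro incseq_SucI) simp

lemma iterate_holomorphic: "(F ^^ n) holomorphic_on rhp"
proof (induction n)
  case (Suc n)
  then have "F \<circ> (F ^^ n) holomorphic_on rhp"
    by (rule holomorphic_on_compose_gen[OF _ hol]) (use iterate_rhp in auto)
  then show ?case by (simp add: o_def)
qed (simp add: holomorphic_on_id id_def)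

text \<open>Real parts increase along the orbit, so at a finite cluster point \<open>v\<close>
  nothing is left to gain: \<open>Re (F v) = Re v\<close>. Then \<open>F\<close> is a translation by
  the nonzero number \<open>F v - v\<close>, and its orbits have no bounded subsequence.\<close>

lemma iterate_tendsto_infinity:
  assumes w: "w \<in> rhp"
  shows "filterlim (\<lambda>n. (F ^^ n) w) at_infinity sequentially"
proof (rule ccontr)
  assume "\<not> ?thesis"
  then obtain B where "\<not> (\<forall>\<^sub>F n in sequentially. B \<le> cmod ((F ^^ n) w))"
    unfolding filterlim_at_infinity_conv_norm_at_top filterlim_at_top by blast
  then obtain r where r: "strict_mono (r :: nat \<Rightarrow> nat)" "\<And>n. cmod ((F ^^ r n) w) < B"
    using not_eventually_sequentiallyD by (metis not_le)
  have "(F ^^ r n) w \<in> cball 0 B" for n using r(2) by (simp add: less_imp_le)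
  then obtain v s where s: "strict_mono (s :: nat \<Rightarrow> nat)"
    and v_lim: "(\<lambda>n. (F ^^ r (s n)) w) \<longlonglongrightarrow> v"
    by (rule compact_convergent_subsequence[OF compact_cball]) (rule that)
  define q where "q = r \<circ> s"
  have q: "strict_mono q" unfolding q_def by (rule strict_mono_o[OF r(1) s])
  have lim: "(\<lambda>n. (F ^^ q n) w) \<longlonglongrightarrow> v"
    using v_lim by (simp add: q_def o_def)
  have Relim: "(\<lambda>n. Re ((F ^^ q n) w)) \<longlonglongrightarrow> Re v" by (intro tendsto_intros lim)
  have "incseq (\<lambda>n. Re ((F ^^ q n) w))"
    using incseq_Re_iterate[OF w] strict_mono_mono[OF q] by (auto simp: mono_def)
  then have "Re ((F ^^ q n) w) \<le> Re v" for n using incseq_le[OF _ Relim] by blast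
  \<comment> \<open>Because \<open>q n \<ge> n\<close>, the bound extends from the subsequence to
    the whole orbit, in particular to the times \<open>Suc (q n)\<close>.\<close>
  moreover have "Re ((F ^^ n) w) \<le> Re ((F ^^ q n) w)" for n
    using incseq_Re_iterate[OF w] seq_suble[OF q] by (simp add: mono_def)
  ultimately have le: "Re ((F ^^ n) w) \<le> Re v" for n using order_trans by blast
  have v: "v \<in> rhp" using le[of 0] w by (simp add: rhp_def)
  have "isCont F v"
    using continuous_on_interior[OF holomorphic_on_imp_continuous_on[OF hol]] v open_rhp
    by (simp add: interior_open)
  then have "(\<lambda>n. F ((F ^^ q n) w)) \<longlonglongrightarrow> F v" using lim by (rule isCont_tendsto_compose)
  then have "(\<lambda>n. Re ((F ^^ Suc (q n)) w)) \<longlonglongrightarrow> Re (F v)" by (auto intro: tendsto_intros)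
  then have "Re (F v) \<le> Re v" by (rule LIMSEQ_le_const2) (use le in blast)
  then have "Re (F v) = Re v" using Re_le[OF v] by simp
  then have transl: "F u = u + (F v - v)" if "u \<in> rhp" for u
    using halfplane_map_translation[OF hol Re_le v] that by blast
  have iter: "(F ^^ n) w = w + of_nat n * (F v - v)" for n
  proof (induction n)
    case (Suc n)
    have "(F ^^ Suc n) w = (F ^^ n) w + (F v - v)" using transl[OF iterate_rhp[OF w, of n]] by simp
    then show ?case by (simp add: Suc algebra_simps)
  qed simp
  have pos: "0 < cmod (F v - v)" using nofix[OF v] by simp
  obtain n where n: "B + cmod w < real n * cmod (F v - v)" using reals_Archimedean3[OF pos] by blast
  have "real n * cmod (F v - v) \<le> real (r n) * cmod (F v - v)"
    using seq_suble[OF r(1), of n] pos by simp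
  also have "\<dots> = cmod ((F ^^ r n) w - w)" by (simp add: iter norm_mult)
  also have "\<dots> \<le> cmod ((F ^^ r n) w) + cmod w" by (rule norm_triangle_ineq4)
  finally show False using n r(2)[of n] by linarith
qed

text \<open>The reciprocals of the iterates are bounded on compact sets, since the real part never
  drops below its initial minimum. Montel's theorem gives a locally uniform limit along a
  subsequence, and pointwise escape identifies this limit as 0.\<close>

lemma iterate_uniformly_infinity:
  assumes K: "compact K" "K \<subseteq> rhp"
  shows "\<forall>\<^sub>F n in sequentially. \<forall>w\<in>K. B \<le> cmod ((F ^^ n) w)"
proof (rule ccontr)
  assume "\<not> ?thesis"
  then obtain r where r: "strict_mono (r :: nat \<Rightarrow> nat)" "\<And>n. \<not> (\<forall>w\<in>K. B \<le> cmod ((F ^^ r n) w))"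
    using not_eventually_sequentiallyD by blast
  define G where "G n w = inverse ((F ^^ r n) w)" for n w
  have nz: "(F ^^ n) w \<noteq> 0" if "w \<in> rhp" for n w
    using iterate_rhp[OF that, of n] by (auto simp: rhp_def)
  have "G n holomorphic_on rhp" for n
    unfolding G_def by (intro holomorphic_intros iterate_holomorphic nz)
  then have hol: "h holomorphic_on rhp" if "h \<in> range G" for h using that by auto
  have bdd: "\<exists>b. \<forall>h\<in>range G. \<forall>w\<in>L. cmod (h w) \<le> b" if L: "compact L" "L \<subseteq> rhp" for L
  proof (cases "L = {}")
    case False
    have "continuous_on L Re" by (intro continuous_intros)
    then obtain u where u: "u \<in> L" "\<And>w. w \<in> L \<Longrightarrow> Re u \<le> Re w"
      using continuous_attains_inf[OF L(1) False, of Re] by blast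
    have "cmod (G n w) \<le> inverse (Re u)" if "w \<in> L" for n w
    proof -
      have "0 < Re u" using u(1) L(2) by (auto simp: rhp_def)
      moreover have "Re u \<le> cmod ((F ^^ r n) w)"
        using u(2)[OF that] incseq_Re_iterate[of w, THEN incseqD, of 0 "r n"] that L(2)
          complex_Re_le_cmod[of "(F ^^ r n) w"] by auto
      ultimately show ?thesis unfolding G_def norm_inverse by (rule le_imp_inverse_le[rotated])
    qed
    then show ?thesis by auto
  qed auto
  obtain l s where s: "strict_mono (s :: nat \<Rightarrow> nat)"
    "\<And>w. w \<in> rhp \<Longrightarrow> (\<lambda>n. G (s n) w) \<longlonglongrightarrow> l w"
    "\<And>L. compact L \<Longrightarrow> L \<subseteq> rhp \<Longrightarrow> uniform_limit L (G \<circ> s) l sequentially"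
  proof (rule Montel[OF open_rhp, of "range G" G])
    fix l r assume "strict_mono (r :: nat \<Rightarrow> nat)" "\<And>w. w \<in> rhp \<Longrightarrow> (\<lambda>n. G (r n) w) \<longlonglongrightarrow> l w"
      "\<And>L. compact L \<Longrightarrow> L \<subseteq> rhp \<Longrightarrow> uniform_limit L (G \<circ> r) l sequentially"
    then show thesis by (rule that)
  qed (use hol bdd in auto)
  have l0: "l w = 0" if "w \<in> rhp" for w
  proof -
    have "filterlim (\<lambda>n. (F ^^ r (s n)) w) at_infinity sequentially"
      using filterlim_compose[OF iterate_tendsto_infinity[OF that]
          filterlim_compose[OF filterlim_subseq[OF r(1)] filterlim_subseq[OF s(1)]]] .
    then have "(\<lambda>n. G (s n) w) \<longlonglongrightarrow> 0"
      unfolding G_def by (rule filterlim_compose[OF tendsto_inverse_0])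
    then show ?thesis using s(2)[OF that] LIMSEQ_unique by blast
  qed
  define b where "b = max B 1"
  have b: "b > 0" "B \<le> b" by (auto simp: b_def)
  have "\<forall>\<^sub>F n in sequentially. \<forall>w\<in>K. dist ((G \<circ> s) n w) (l w) < inverse b"
    by (rule uniform_limitD[OF s(3)[OF K]]) (use b in simp)
  then obtain n where n: "\<And>w. w \<in> K \<Longrightarrow> dist ((G \<circ> s) n w) (l w) < inverse b"
    using eventually_happens sequentially_bot by blast
  obtain w where w: "w \<in> K" "cmod ((F ^^ r (s n)) w) < B" using r(2)[of "s n"] by force
  have "w \<in> rhp" using w K by blast
  then have "inverse (cmod ((F ^^ r (s n)) w)) < inverse b"
    using n[OF w(1)] l0 by (simp add: G_def norm_inverse)
  then have "b < cmod ((F ^^ r (s n)) w)"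
    by (rule inverse_less_imp_less) (use nz[OF \<open>w \<in> rhp\<close>] in simp)
  then show False using w b by linarith
qed

end

text \<open>If the limit were a point of \<Omega>, continuity of the inverse of \<open>g\<close>
  would force \<open>x\<close> to converge to a finite point.\<close>

lemma escaping_limit_in_boundary:
  assumes g: "biholomorphism g rhp \<Omega>" and "open \<Omega>" and x: "\<And>n. x n \<in> rhp"
    and inf: "filterlim x at_infinity sequentially" and lim: "(\<lambda>n. Pt (g (x n))) \<longlonglongrightarrow> q"
  shows "q \<in> sphere_boundary \<Omega>"
proof -
  obtain g' where g': "g holomorphic_on rhp" "g' holomorphic_on \<Omega>"
    "\<And>z. z \<in> rhp \<Longrightarrow> g z \<in> \<Omega>" "\<And>z. z \<in> rhp \<Longrightarrow> g' (g z) = z"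
    "\<And>z. z \<in> \<Omega> \<Longrightarrow> g' z \<in> rhp" "\<And>z. z \<in> \<Omega> \<Longrightarrow> g (g' z) = z"
    by (rule biholomorphismE[OF g]) (rule that)
  have "q \<notin> Pt ` \<Omega>"
  proof
    assume "q \<in> Pt ` \<Omega>"
    then obtain p where p: "p \<in> \<Omega>" "q = Pt p" by auto
    then have "(\<lambda>n. g (x n)) \<longlonglongrightarrow> p" using lim tendsto_Pt_iff by blast
    moreover have "isCont g' p"
      using continuous_on_interior[OF holomorphic_on_imp_continuous_on[OF g'(2)]] p \<open>open \<Omega>\<close>
      by (simp add: interior_open)
    ultimately have "(\<lambda>n. g' (g (x n))) \<longlonglongrightarrow> g' p" by (rule isCont_tendsto_compose[rotated])
    then have "x \<longlonglongrightarrow> g' p" by (simp add: g'(4)[OF x])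
    then show False using inf not_tendsto_and_filterlim_at_infinity sequentially_bot by blast
  qed
  moreover have "q \<in> sphere_closure \<Omega>"
    unfolding sphere_closure_def closure_sequential
    using lim g'(3)[OF x] by (intro exI[of _ "\<lambda>n. Pt (g (x n))"]) auto
  ultimately show ?thesis using sphere_boundary_eq[OF \<open>open \<Omega>\<close>] by simp
qed

lemma halfplane_limit_in_boundary:
  assumes g: "biholomorphism g rhp \<Omega>" and "open \<Omega>" and L: "halfplane_limit g L"
  shows "L \<in> sphere_boundary \<Omega>"
proof (rule escaping_limit_in_boundary[OF g \<open>open \<Omega>\<close>])
  define x where "x n = complex_of_real (real n + 1)" for n
  have x: "1 \<le> Re (x n)" for n by (simp add: x_def)
  show "x n \<in> rhp" for n using x[of n] by (simp add: rhp_def)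
  show inf: "filterlim x at_infinity sequentially"
    unfolding filterlim_at_infinity_conv_norm_at_top
    by (rule filterlim_at_top_mono[OF filterlim_real_sequentially]) (auto simp: x_def simp del: of_real_add)
  have "filterlim x (halfplane_at_infinity 1) sequentially"
    using inf x by (simp add: filterlim_halfplane_at_infinity)
  then show "(\<lambda>n. Pt (g (x n))) \<longlonglongrightarrow> L"
    using filterlim_compose[of "\<lambda>w. Pt (g w)" "nhds L" "halfplane_at_infinity 1"] L
    by (simp add: halfplane_limit_def)
qed

text \<open>The Riemann map \<open>h\<close> is fixed and carries every fixed point free self-map to
  the disc; Wolff's lemma selects \<sigma> there, and only then is the half plane belonging to this
  \<sigma> used.\<close>

lemma Denjoy_Wolff_of_halfplane_limits:
  assumes h: "riemann_map \<Omega> h" and "open \<Omega>"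
    and lim: "\<And>\<sigma>. cmod \<sigma> = 1 \<Longrightarrow> \<exists>L. halfplane_limit (h \<circ> cayley \<sigma>) L"
  shows "Denjoy_Wolff_property \<Omega>"
  unfolding Denjoy_Wolff_property_def
proof
  fix f assume "f \<in> Hol_d \<Omega>"
  then have f: "f holomorphic_on \<Omega>" "\<And>z. z \<in> \<Omega> \<Longrightarrow> f z \<in> \<Omega>" "\<And>z. z \<in> \<Omega> \<Longrightarrow> f z \<noteq> z"
    by (auto simp: Hol_d_def)
  obtain h' where h': "h holomorphic_on ball 0 1" "h' holomorphic_on \<Omega>"
    "\<And>z. z \<in> ball 0 1 \<Longrightarrow> h z \<in> \<Omega>" "\<And>z. z \<in> ball 0 1 \<Longrightarrow> h' (h z) = z"
    "\<And>z. z \<in> \<Omega> \<Longrightarrow> h' z \<in> ball 0 1" "\<And>z. z \<in> \<Omega> \<Longrightarrow> h (h' z) = z"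
    by (rule biholomorphismE[OF h]) (rule that)
  define \<phi> where "\<phi> = h' \<circ> (f \<circ> h)"
  have \<phi>: "\<phi> holomorphic_on ball 0 1" "\<And>z. z \<in> ball 0 1 \<Longrightarrow> \<phi> z \<in> ball 0 1"
    unfolding \<phi>_def
    by (intro holomorphic_on_compose_gen[OF _ h'(2)] holomorphic_on_compose_gen[OF h'(1) f(1)])
      (use h' f in auto)
  have \<phi>_fix: "\<phi> z \<noteq> z" if z: "z \<in> ball 0 1" for z
  proof
    assume "\<phi> z = z"
    then have "h (h' (f (h z))) = h z" by (simp add: \<phi>_def)
    then show False using f(3)[OF h'(3)[OF z]] h'(6)[OF f(2)[OF h'(3)[OF z]]] by simp
  qed
  obtain \<sigma> where \<sigma>: "cmod \<sigma> = 1"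
    and Wolff: "\<And>z. z \<in> ball 0 1 \<Longrightarrow> Re (inv_cayley \<sigma> z) \<le> Re (inv_cayley \<sigma> (\<phi> z))"
    by (rule Wolff_lemma[OF \<phi> \<phi>_fix]) (assumption | rule that)+
  define g where "g = h \<circ> cayley \<sigma>"
  have g: "biholomorphism g rhp \<Omega>"
    unfolding g_def by (rule biholomorphism_compose[OF cayley_biholomorphism[OF \<sigma>] h])
  obtain L where L: "halfplane_limit g L" using lim[OF \<sigma>] by (auto simp: g_def)
  obtain g' where g': "g holomorphic_on rhp" "g' holomorphic_on \<Omega>"
    "\<And>z. z \<in> rhp \<Longrightarrow> g z \<in> \<Omega>" "\<And>z. z \<in> rhp \<Longrightarrow> g' (g z) = z"
    "\<And>z. z \<in> \<Omega> \<Longrightarrow> g' z \<in> rhp" "\<And>z. z \<in> \<Omega> \<Longrightarrow> g (g' z) = z"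
    by (rule biholomorphismE[OF g]) (rule that)
  have g'_eq: "g' z = inv_cayley \<sigma> (h' z)" if z: "z \<in> \<Omega>" for z
  proof -
    have "h (cayley \<sigma> (g' z)) = z" using g'(6)[OF z] by (simp add: g_def)
    then have "h' z = cayley \<sigma> (g' z)" using h'(4)[OF cayley_in_ball[OF \<sigma> g'(5)[OF z]]] by simp
    then show ?thesis using inv_cayley_cayley[OF \<sigma> g'(5)[OF z]] by simp
  qed
  define F where "F = g' \<circ> (f \<circ> g)"
  have F_hol: "F holomorphic_on rhp"
    unfolding F_def
    by (intro holomorphic_on_compose_gen[OF _ g'(2)] holomorphic_on_compose_gen[OF g'(1) f(1)])
      (use g' f in auto)
  have F_Re: "Re w \<le> Re (F w)" if w: "w \<in> rhp" for w
  proof -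
    have "F w = inv_cayley \<sigma> (\<phi> (cayley \<sigma> w))"
      using g'_eq[OF f(2)[OF g'(3)[OF w]]] by (simp add: F_def \<phi>_def g_def)
    then show ?thesis using Wolff[OF cayley_in_ball[OF \<sigma> w]] inv_cayley_cayley[OF \<sigma> w] by simp
  qed
  have gF: "g (F w) = f (g w)" if "w \<in> rhp" for w
    using that by (simp add: F_def g'(6) f(2) g'(3))
  have F_fix: "F w \<noteq> w" if "w \<in> rhp" for w
    using gF[OF that] f(3)[OF g'(3)[OF that]] by auto
  have iter: "(f ^^ n) (g w) = g ((F ^^ n) w)" if "w \<in> rhp" for w n
    by (induction n) (simp_all add: gF[OF iterate_rhp[OF F_hol F_Re F_fix that]])
  show "has_Denjoy_Wolff_point \<Omega> f"
    unfolding has_Denjoy_Wolff_point_def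
  proof (intro bexI[of _ L] allI impI)
    show "L \<in> sphere_boundary \<Omega>" by (rule halfplane_limit_in_boundary[OF g \<open>open \<Omega>\<close> L])
    fix K assume K: "compact K \<and> K \<subseteq> \<Omega>"
    define K' where "K' = g' ` K"
    have K': "compact K'" "K' \<subseteq> rhp"
      unfolding K'_def using K g'(5)
      by (auto intro!: compact_continuous_image continuous_on_subset[OF holomorphic_on_imp_continuous_on[OF g'(2)]])
    show "uniform_limit K (\<lambda>n z. Pt ((f ^^ n) z)) (\<lambda>_. L) sequentially"
    proof (cases "K = {}")
      case False
      \<comment> \<open>Orbits starting in \<open>K'\<close> never go left of the smallest real part
        on \<open>K'\<close>, so the limit of \<open>g\<close> in this one half plane serves all of
        them.\<close>
      then obtain u where u: "u \<in> K'" "\<And>w. w \<in> K' \<Longrightarrow> Re u \<le> Re w"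
        using continuous_attains_inf[OF K'(1), of Re] by (auto simp: K'_def continuous_on_Re)
      have u0: "0 < Re u" using u(1) K'(2) by (auto simp: rhp_def)
      show ?thesis
      proof (rule uniform_limitI)
        fix e :: real assume "e > 0"
        then have "\<forall>\<^sub>F w in halfplane_at_infinity (Re u). dist (Pt (g w)) L < e"
          using L u0 by (auto simp: halfplane_limit_def intro: tendstoD)
        then obtain b where b: "\<And>w. Re u \<le> Re w \<Longrightarrow> b \<le> cmod w \<Longrightarrow> dist (Pt (g w)) L < e"
          unfolding eventually_halfplane_at_infinity by blast
        have "\<forall>\<^sub>F n in sequentially. \<forall>w\<in>K'. b \<le> cmod ((F ^^ n) w)"
          by (rule iterate_uniformly_infinity[OF F_hol F_Re F_fix K'])
        then show "\<forall>\<^sub>F n in sequentially. \<forall>z\<in>K. dist (Pt ((f ^^ n) z)) L < e"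
        proof eventually_elim
          case (elim n)
          show ?case
          proof
            fix z assume z: "z \<in> K"
            then have z': "g' z \<in> K'" "g' z \<in> rhp" "g (g' z) = z"
              using K g' by (auto simp: K'_def)
            have "Re u \<le> Re ((F ^^ n) (g' z))"
              using u(2)[OF z'(1)] incseqD[OF incseq_Re_iterate[OF F_hol F_Re F_fix z'(2)], of 0 n] by simp
            then show "dist (Pt ((f ^^ n) z)) L < e"
              using b elim z'(1) iter[OF z'(2), of n] z'(3) by simp
          qed
        qed
      qed
    qed simp
  qed
qed

section \<open>Limits along the ends of crosscuts\<close>

lemma fashoda_complex:
  fixes p q :: "real \<Rightarrow> complex"
  assumes "path p" "path q" "path_image p \<subseteq> cbox a b" "path_image q \<subseteq> cbox a b"
    and "Re (pathstart p) = Re a" "Re (pathfinish p) = Re b"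
    and "Im (pathstart q) = Im a" "Im (pathfinish q) = Im b"
  obtains z where "z \<in> path_image p" "z \<in> path_image q"
proof -
  define \<phi> :: "complex \<Rightarrow> real^2" where "\<phi> z = (\<chi> i. if i = 1 then Re z else Im z)" for z
  have nth: "\<phi> z $ 1 = Re z" "\<phi> z $ 2 = Im z" for z by (simp_all add: \<phi>_def)
  have cont: "continuous_on S \<phi>" for S
    unfolding \<phi>_def
  proof (rule continuous_on_vec_lambda)
    show "continuous_on S (\<lambda>z. if i = 1 then Re z else Im z)" for i :: 2
      by (cases "i = 1") (auto intro!: continuous_intros)
  qed
  have inj: "\<phi> z = \<phi> w \<Longrightarrow> z = w" for z w
    using nth by (metis complex_eqI)
  have box: "\<phi> z \<in> cbox (\<phi> a) (\<phi> b)" if "z \<in> cbox a b" for z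
    using that by (auto simp: mem_box_cart forall_2 nth in_cbox_complex_iff)
  obtain z where "z \<in> path_image (\<phi> \<circ> p)" "z \<in> path_image (\<phi> \<circ> q)"
  proof (rule fashoda[of "\<phi> \<circ> p" "\<phi> \<circ> q" "\<phi> a" "\<phi> b"])
    show "path (\<phi> \<circ> p)" "path (\<phi> \<circ> q)"
      using assms(1,2) cont by (auto intro: path_continuous_image)
    show "path_image (\<phi> \<circ> p) \<subseteq> cbox (\<phi> a) (\<phi> b)" "path_image (\<phi> \<circ> q) \<subseteq> cbox (\<phi> a) (\<phi> b)"
      using assms(3,4) box by (auto simp: path_image_compose)
  qed (use assms(5-) nth in \<open>auto simp: pathstart_compose pathfinish_compose\<close>)
  then show ?thesis using inj that by (auto simp: path_image_compose)
qed

text \<open>\<open>q\<close> is prolonged vertically to the horizontal sides of a tall box,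
  \<open>p\<close> horizontally from 0 to the right side, and the crossing theorem applies. The
  prolongations create no crossing: those of \<open>q\<close> satisfy \<open>|Im z| > d\<close>,
  outside the square that contains \<open>p\<close>, and that of \<open>p\<close> lies in
  \<open>Re z \<ge> 0\<close>, where \<open>q\<close> and its prolongations never go.\<close>

lemma path_separates_side_of_square:
  assumes q: "path q" "path_image q \<subseteq> {z. - d < Re z \<and> Re z < 0}"
    and q_ends: "Im (pathstart q) < - d" "d < Im (pathfinish q)" and "d > 0"
    and p: "path p" "path_image p \<subseteq> cbox (Complex (- d) (- d)) (Complex d d)"
    and p_ends: "Re (pathstart p) = - d" "pathfinish p = 0"
    and disj: "path_image p \<inter> path_image q = {}"
  shows False
proof -
  obtain H where H: "\<And>z. z \<in> path_image q \<Longrightarrow> cmod z \<le> H"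
    using compact_imp_bounded[OF compact_path_image[OF q(1)]] by (auto simp: bounded_iff)
  have Im_le: "\<bar>Im z\<bar> \<le> H" if "z \<in> path_image q" for z
    using H[OF that] abs_Im_le_cmod[of z] by linarith
  have ends: "pathstart q \<in> path_image q" "pathfinish q \<in> path_image q" by auto
  have dH: "d < H" using Im_le[OF ends(2)] q_ends(2) by linarith
  have Re_ends: "- d < Re (pathstart q)" "Re (pathstart q) < 0" "- d < Re (pathfinish q)" "Re (pathfinish q) < 0"
    using ends q(2) by auto
  define lo where "lo = linepath (Complex (Re (pathstart q)) (- H)) (pathstart q)"
  define hi where "hi = linepath (pathfinish q) (Complex (Re (pathfinish q)) H)"
  define q' where "q' = (lo +++ q) +++ hi"
  define p' where "p' = p +++ linepath 0 (complex_of_real d)"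
  have q'_image: "path_image q' = path_image lo \<union> path_image q \<union> path_image hi"
    unfolding q'_def by (simp add: path_image_join lo_def hi_def)
  have p'_image: "path_image p' = path_image p \<union> closed_segment 0 (complex_of_real d)"
    unfolding p'_def by (simp add: path_image_join p_ends)
  have lo: "path_image lo = {z. Re z = Re (pathstart q) \<and> - H \<le> Im z \<and> Im z \<le> Im (pathstart q)}"
    using Im_le[OF ends(1)] by (auto simp: lo_def closed_segment_same_Re closed_segment_eq_real_ivl)
  have hi: "path_image hi = {z. Re z = Re (pathfinish q) \<and> Im (pathfinish q) \<le> Im z \<and> Im z \<le> H}"
    using Im_le[OF ends(2)] by (auto simp: hi_def closed_segment_same_Re closed_segment_eq_real_ivl)
  have seg: "closed_segment 0 (complex_of_real d) = {z. Im z = 0 \<and> 0 \<le> Re z \<and> Re z \<le> d}"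
    using \<open>d > 0\<close> by (auto simp: closed_segment_same_Im closed_segment_eq_real_ivl)
  obtain z where z: "z \<in> path_image p'" "z \<in> path_image q'"
  proof (rule fashoda_complex[of p' q' "Complex (- d) (- H)" "Complex d H"])
    show "path p'" "path q'"
      using p(1) q(1) p_ends by (auto simp: p'_def q'_def lo_def hi_def)
    show "path_image p' \<subseteq> cbox (Complex (- d) (- H)) (Complex d H)"
      using p(2) dH \<open>d > 0\<close> unfolding p'_image seg by (fastforce simp: in_cbox_complex_iff)
    show "path_image q' \<subseteq> cbox (Complex (- d) (- H)) (Complex d H)"
    proof
      fix z assume "z \<in> path_image q'"
      then consider "z \<in> path_image lo" | "z \<in> path_image q" | "z \<in> path_image hi"
        by (auto simp: q'_image)
      then show "z \<in> cbox (Complex (- d) (- H)) (Complex d H)"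
      proof cases
        case 1
        then show ?thesis using Re_ends q_ends dH \<open>d > 0\<close> by (simp add: lo in_cbox_complex_iff)
      next
        case 2
        then have "- d < Re z" "Re z < 0" "\<bar>Im z\<bar> \<le> H" using q(2) Im_le by auto
        then show ?thesis using \<open>d > 0\<close> by (simp add: in_cbox_complex_iff abs_le_iff)
      next
        case 3
        then show ?thesis using Re_ends q_ends dH \<open>d > 0\<close> by (simp add: hi in_cbox_complex_iff)
      qed
    qed
  qed (auto simp: p'_def q'_def lo_def hi_def p_ends intro: that)
  from z(2) have "Re z < 0" using Re_ends q(2) unfolding q'_image lo hi by auto
  then have "z \<in> path_image p" using z(1) by (auto simp: p'_image seg)
  then have "z \<notin> path_image q" "z \<in> cbox (Complex (- d) (- d)) (Complex d d)" using disj p(2) by auto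
  then have "z \<notin> path_image q" "- d \<le> Im z" "Im z \<le> d" by (simp_all add: in_cbox_complex_iff)
  then show False using z(2) q_ends by (auto simp: q'_image lo hi)
qed

text \<open>The product of the four rotations of \<open>f\<close> is small on the union of the four rotations of the path,
  and this union separates the centre of the square from its boundary.\<close>

lemma square_rotation_bound:
  fixes d :: real
  defines "B \<equiv> cbox (Complex (- d) (- d)) (Complex d d)"
  assumes d: "d > 0" and hol: "f holomorphic_on B" and M: "\<And>z. z \<in> B \<Longrightarrow> cmod (f z) \<le> M"
    and q: "path q" "path_image q \<subseteq> {z. - d < Re z \<and> Re z < 0}"
    and q_ends: "Im (pathstart q) < - d" "d < Im (pathfinish q)"
    and \<epsilon>: "\<And>z. z \<in> path_image q \<Longrightarrow> z \<in> B \<Longrightarrow> cmod (f z) \<le> \<epsilon>" "\<epsilon> \<ge> 0"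
  shows "cmod (f 0) ^ 4 \<le> \<epsilon> * M ^ 3"
proof -
  let ?\<Gamma> = "path_image q"
  define T where "T = {u. u \<in> ?\<Gamma> \<or> \<i> * u \<in> ?\<Gamma> \<or> - u \<in> ?\<Gamma> \<or> - (\<i> * u) \<in> ?\<Gamma>}"
  define F where "F u = f u * f (\<i> * u) * f (- u) * f (- (\<i> * u))" for u
  define Q where "Q = box (Complex (- d) (- d)) (Complex d d)"
  have B: "z \<in> B \<longleftrightarrow> \<bar>Re z\<bar> \<le> d \<and> \<bar>Im z\<bar> \<le> d" for z
    by (auto simp: B_def in_cbox_complex_iff)
  have Q: "z \<in> Q \<longleftrightarrow> \<bar>Re z\<bar> < d \<and> \<bar>Im z\<bar> < d" for z
    by (auto simp: Q_def in_box_complex_iff)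
  have B_rot: "\<i> * z \<in> B" "- z \<in> B" "- (\<i> * z) \<in> B" if "z \<in> B" for z using that by (auto simp: B)
  have "closed ?\<Gamma>" using q(1) by (rule closed_path_image)
  have "T = (\<lambda>u. u) -` ?\<Gamma> \<union> (\<lambda>u. \<i> * u) -` ?\<Gamma> \<union> (\<lambda>u. - u) -` ?\<Gamma> \<union> (\<lambda>u. - (\<i> * u)) -` ?\<Gamma>"
    by (auto simp: T_def)
  then have "closed T"
    using \<open>closed ?\<Gamma>\<close> by (auto intro!: closed_Un continuous_closed_vimage continuous_intros)
  have T_rot: "\<i> * z \<notin> T" "- z \<notin> T" "- (\<i> * z) \<notin> T" if "z \<notin> T" for z
    using that by (auto simp: T_def simp flip: mult.assoc)
  have T0: "0 \<notin> T" using q(2) by (auto simp: T_def)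
  have M0: "M \<ge> 0" using order_trans[OF norm_ge_zero M[of 0]] d by (simp add: B)
  have F_T: "cmod (F z) \<le> \<epsilon> * M ^ 3" if "z \<in> T" "z \<in> B" for z
  proof -
    note Bs = that(2) B_rot[OF that(2)]
    have le: "a * b * c * e \<le> \<epsilon> * M ^ 3"
      if "0 \<le> a" "0 \<le> b" "0 \<le> c" "0 \<le> e" "a \<le> M" "b \<le> M" "c \<le> M" "e \<le> M"
        "a \<le> \<epsilon> \<or> b \<le> \<epsilon> \<or> c \<le> \<epsilon> \<or> e \<le> \<epsilon>" for a b c e :: real
    proof -
      have *: "x * y * z * t \<le> \<epsilon> * M ^ 3"
        if "0 \<le> x" "0 \<le> y" "0 \<le> z" "0 \<le> t" "x \<le> \<epsilon>" "y \<le> M" "z \<le> M" "t \<le> M" for x y z t :: real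
      proof -
        have "x * y * z * t \<le> \<epsilon> * M * M * M"
          using that \<epsilon>(2) M0 by (intro mult_mono mult_nonneg_nonneg) auto
        then show ?thesis by (simp add: power3_eq_cube mult.assoc)
      qed
      from that(9) show ?thesis
        using *[of a b c e] *[of b a c e] *[of c a b e] *[of e a b c] that
        by (elim disjE) (simp_all add: mult_ac)
    qed
    have "cmod (F z) = cmod (f z) * cmod (f (\<i> * z)) * cmod (f (- z)) * cmod (f (- (\<i> * z)))"
      by (simp add: F_def norm_mult)
    also have "\<dots> \<le> \<epsilon> * M ^ 3"
      using that(1) Bs by (intro le M norm_ge_zero) (auto simp: T_def intro: \<epsilon>)
    finally show ?thesis .
  qed
  \<comment> \<open>A point of the square off its interior lies on one of the four sides, and
    multiplication by a power of \<i> moves it to the left side. As \<open>T\<close> is invariant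
    under these rotations, the rotated path still avoids the image of \<open>q\<close>.\<close>
  have no_path: False if P: "path P" "path_image P \<subseteq> B - T" "pathstart P = z" "pathfinish P = 0" and z: "z \<notin> Q" for P z
  proof -
    have left: False if "path P'" "path_image P' \<subseteq> B - T" "Re (pathstart P') = - d" "pathfinish P' = 0" for P'
      using path_separates_side_of_square[OF q q_ends d that(1) _ that(3,4)] that(2) by (auto simp: B_def T_def)
    have rot: "path (\<lambda>t. \<omega> * P t)" "path_image (\<lambda>t. \<omega> * P t) = (*) \<omega> ` path_image P"
      "pathstart (\<lambda>t. \<omega> * P t) = \<omega> * z" "pathfinish (\<lambda>t. \<omega> * P t) = 0" for \<omega>
      using P by (auto simp: path_def path_image_def pathstart_def pathfinish_def intro!: continuous_intros)
    have sub: "path_image (\<lambda>t. \<omega> * P t) \<subseteq> B - T" if "\<omega> \<in> {1, \<i>, -1, - \<i>}" for \<omega>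
      unfolding rot(2) using that P(2) B_rot T_rot by auto
    have "z \<in> B" using P(2,3) pathstart_in_path_image by blast
    then have "Re z = - d \<or> Im z = d \<or> Re z = d \<or> Im z = - d"
      using z unfolding B Q by linarith
    then consider "Re z = - d" | "Re (\<i> * z) = - d" | "Re ((-1) * z) = - d" | "Re ((- \<i>) * z) = - d"
      by fastforce
    then show False
    proof cases
      case 1
      then show ?thesis using left[of P] P by simp
    next
      case 2
      then show ?thesis using left[OF rot(1) sub, of \<i>] rot(3,4)[of \<i>] by simp
    next
      case 3
      then show ?thesis using left[OF rot(1) sub, of "-1"] rot(3,4)[of "-1"] by simp
    next
      case 4
      then show ?thesis using left[OF rot(1) sub, of "- \<i>"] rot(3,4)[of "- \<i>"] by simp
    qed
  qed
  \<comment> \<open>The maximum principle is applied to this component: its frontier lies in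
    \<open>T\<close>, where one of the four factors of \<open>F\<close> is at most
    \<epsilon>.\<close>
  define O' where "O' = connected_component_set (Q - T) 0"
  have "open (Q - T)" using \<open>closed T\<close> by (auto simp: Q_def)
  then have openO: "open O'" unfolding O'_def by (rule open_connected_component)
  have connO: "connected O'" unfolding O'_def by simp
  have O_sub: "O' \<subseteq> Q - T" unfolding O'_def by (rule connected_component_subset)
  have O0: "0 \<in> O'" unfolding O'_def using T0 d by (simp add: Q)
  have QB: "Q \<subseteq> B" by (auto simp: Q B)
  have closB: "closed B" "convex B" by (simp_all add: B_def closed_cbox)
  have clO: "closure O' \<subseteq> B" using O_sub QB closB by (intro closure_minimal) auto
  have "cmod (F z) \<le> \<epsilon> * M ^ 3" if z: "z \<in> frontier O'" for z
  proof (rule F_T)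
    have zc: "z \<in> closure O'" "z \<notin> O'" using z openO by (auto simp: frontier_def interior_open)
    then show zB: "z \<in> B" using clO by auto
    show "z \<in> T"
    proof (rule ccontr)
      assume "z \<notin> T"
      then obtain e where e: "e > 0" "ball z e \<subseteq> - T" using \<open>closed T\<close> by (meson ComplI open_Compl openE)
      show False
      \<comment> \<open>Inside the open square a small disc would enlarge the component; on the
        boundary of the square, a short segment followed by a path within the component would reach
        0 without meeting \<open>T\<close>.\<close>
      proof (cases "z \<in> Q")
        case True
        then obtain e' where e': "e' > 0" "ball z e' \<subseteq> Q - T"
          using \<open>open (Q - T)\<close> \<open>z \<notin> T\<close> by (meson DiffI openE)
        obtain x where x: "x \<in> O'" "x \<in> ball z e'"
          using zc(1) e'(1) closure_approachable[of z O'] by (auto simp: dist_commute)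
        have "connected (O' \<union> ball z e')"
          using x by (intro connected_Un connO) auto
        then have "O' \<union> ball z e' \<subseteq> connected_component_set (Q - T) 0"
          using O0 O_sub e'(2) by (intro connected_component_maximal) auto
        then have "z \<in> O'" unfolding O'_def using centre_in_ball[of z e'] e'(1) by blast
        then show False using zc(2) by blast
      next
        case False
        obtain x where x: "x \<in> O'" "x \<in> ball z e"
          using zc(1) e(1) closure_approachable[of z O'] by (auto simp: dist_commute)
        have "path_component O' x 0"
          using connected_open_path_connected[OF openO connO] x(1) O0 by (auto simp: path_connected_component)
        then obtain P where P: "path P" "path_image P \<subseteq> O'" "pathstart P = x" "pathfinish P = 0"
          by (auto simp: path_component_def)
        have "closed_segment z x \<subseteq> B" using x(1) zB O_sub QB closB(2) by (intro closed_segment_subset) auto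
        moreover have "closed_segment z x \<subseteq> - T"
          using x(2) e by (intro order_trans[OF closed_segment_subset e(2)]) auto
        ultimately have "path_image (linepath z x +++ P) \<subseteq> B - T"
          using P O_sub QB by (auto simp: path_image_join)
        then show False using no_path[of "linepath z x +++ P" z] P False by simp
      qed
    qed
  qed
  moreover have "F holomorphic_on B"
  proof -
    have "(\<lambda>z. f (\<omega> * z)) holomorphic_on B" if "\<omega> \<in> {1, \<i>, -1, - \<i>}" for \<omega>
    proof -
      have "f \<circ> (\<lambda>z. \<omega> * z) holomorphic_on B"
        by (rule holomorphic_on_compose_gen[OF _ hol]) (use that B_rot in \<open>auto intro!: holomorphic_intros\<close>)
      then show ?thesis by (simp add: o_def)
    qed
    from this[of 1] this[of \<i>] this[of "-1"] this[of "- \<i>"] show ?thesis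
      unfolding F_def by (intro holomorphic_intros) simp_all
  qed
  then have "F holomorphic_on interior O'" "continuous_on (closure O') F"
    using clO openO O_sub QB
    by (auto simp: interior_open intro!: holomorphic_on_imp_continuous_on elim!: holomorphic_on_subset)
  moreover have "bounded O'" using O_sub by (auto simp: Q_def intro: bounded_subset[OF bounded_box])
  ultimately have "cmod (F 0) \<le> \<epsilon> * M ^ 3"
    using maximum_modulus_frontier[of F O'] O0 by blast
  then show ?thesis by (simp add: F_def norm_mult power4_eq_xxxx)
qed

text \<open>A square centred at \<open>Complex c y\<close>, on the right edge of the strip, has the
  path passing to the left of its centre and running from below its bottom to above its top.\<close>

lemma halfplane_crossing_bound:
  assumes hol: "f holomorphic_on rhp" and M: "\<And>w. w \<in> rhp \<Longrightarrow> cmod (f w) \<le> M"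
    and q: "path q" "path_image q \<subseteq> {w. 0 < Re w \<and> Re w < c}"
    and q_ends: "Im (pathstart q) \<le> y - c" "y + c \<le> Im (pathfinish q)"
    and \<epsilon>: "\<And>w. w \<in> path_image q \<Longrightarrow> cmod (f w) \<le> \<epsilon>"
  shows "cmod (f (Complex c y)) ^ 4 \<le> \<epsilon> * M ^ 3"
proof -
  have "compact (path_image q)" "path_image q \<noteq> {}" using q(1) by auto
  then obtain u where u: "u \<in> path_image q" "\<And>w. w \<in> path_image q \<Longrightarrow> Re u \<le> Re w"
    using continuous_attains_inf[of "path_image q" Re] continuous_on_Re[OF continuous_on_id] by blast
  have u0: "0 < Re u" "Re u < c" using u(1) q(2) by auto
  \<comment> \<open>Strictly between \<open>c - Re u\<close> and \<open>c\<close>: less than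
    \<open>c\<close> keeps the square inside the half plane, more than \<open>c - Re u\<close> keeps
    the path to the right of the square's left side.\<close>
  define d where "d = c - Re u / 2"
  have d: "d > 0" "d < c" "c - Re u < d" using u0 by (auto simp: d_def)
  let ?p = "\<lambda>t. q t - Complex c y"
  let ?f = "\<lambda>z. f (z + Complex c y)"
  let ?B = "cbox (Complex (- d) (- d)) (Complex d d)"
  have B: "z + Complex c y \<in> rhp" if "z \<in> ?B" for z
    using that d by (auto simp: in_cbox_complex_iff rhp_def)
  have p_image: "path_image ?p = (\<lambda>w. w - Complex c y) ` path_image q"
    by (auto simp: path_image_def)
  have "cmod (?f 0) ^ 4 \<le> \<epsilon> * M ^ 3"
  proof (rule square_rotation_bound[where q = ?p, OF d(1)])
    have "f \<circ> (\<lambda>z. z + Complex c y) holomorphic_on ?B"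
      by (rule holomorphic_on_compose_gen[OF _ hol]) (use B in \<open>auto intro!: holomorphic_intros\<close>)
    then show "?f holomorphic_on ?B" by (simp add: o_def)
    show "cmod (?f z) \<le> M" if "z \<in> ?B" for z using M[OF B[OF that]] .
    show "path ?p" using q(1) by (auto simp: path_def intro!: continuous_intros)
    show "path_image ?p \<subseteq> {z. - d < Re z \<and> Re z < 0}"
      unfolding p_image using u(2) q(2) d by force
    show "Im (pathstart ?p) < - d" "d < Im (pathfinish ?p)"
      using q_ends d by (auto simp: pathstart_def pathfinish_def)
    show "cmod (?f z) \<le> \<epsilon>" if "z \<in> path_image ?p" for z
      using that \<epsilon> by (auto simp: p_image)
    show "0 \<le> \<epsilon>" using \<epsilon>[OF u(1)] norm_ge_zero order_trans by blast
  qed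
  then show ?thesis by simp
qed

text \<open>The value at \<open>Infty\<close> is a placeholder; only values at interior points of
  crosscuts, which are finite, matter.\<close>

fun finite_part :: "riemann_sphere \<Rightarrow> complex" where
  "finite_part (Pt z) = z"
| "finite_part Infty = 0"

lemma continuous_finite_part: "continuous_on (range Pt) finite_part"
  unfolding continuous_on_def
proof
  fix x assume "x \<in> range Pt"
  then obtain z where z: "x = Pt z" by auto
  have "((\<lambda>y. y) \<longlongrightarrow> Pt z) (at x within range Pt)" by (simp add: z tendsto_ident_at)
  moreover have "\<forall>\<^sub>F y in at x within range Pt. y = Pt (finite_part y)"
    unfolding eventually_at_filter by (intro always_eventually) auto
  ultimately have "((\<lambda>y. Pt (finite_part y)) \<longlongrightarrow> Pt z) (at x within range Pt)"
    using tendsto_cong[of "\<lambda>y. y" "\<lambda>y. Pt (finite_part y)"] by blast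
  then show "(finite_part \<longlongrightarrow> finite_part x) (at x within range Pt)"
    by (simp add: tendsto_Pt_iff z)
qed

text \<open>Pulled back by \<open>g\<close>, the crosscut is a curve in the strip
  \<open>0 < Re w < c\<close> that is unbounded near an end parameter \<open>t\<close>. A test
  function \<open>k\<close> for the point \<open>\<gamma> t\<close> is small on this curve near
  \<open>t\<close>, and the rotation bound carries the smallness to points
  \<open>Complex c y\<close> with arbitrarily large \<open>|y|\<close>. Along these points
  \<open>g\<close> also tends to \<open>L\<close>, so \<open>\<gamma> t = L\<close>.\<close>

lemma crosscut_end_limit:
  assumes g: "biholomorphism g rhp \<Omega>" and "\<Omega> \<noteq> UNIV" and L: "halfplane_limit g L"
    and \<gamma>: "path \<gamma>" "\<gamma> ` {0<..<1} = Pt ` C" and C: "C \<subseteq> \<Omega>"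
    and c: "c > 0" and strip: "\<And>w. c \<le> Re w \<Longrightarrow> g w \<notin> C"
    and unb: "\<And>\<rho>. \<exists>w\<in>rhp. \<rho> < cmod w \<and> g w \<in> C"
  shows "L \<in> {pathstart \<gamma>, pathfinish \<gamma>}"
proof -
  obtain g' where g': "g holomorphic_on rhp" "g' holomorphic_on \<Omega>"
    "\<And>z. z \<in> rhp \<Longrightarrow> g z \<in> \<Omega>" "\<And>z. z \<in> rhp \<Longrightarrow> g' (g z) = z"
    "\<And>z. z \<in> \<Omega> \<Longrightarrow> g' z \<in> rhp" "\<And>z. z \<in> \<Omega> \<Longrightarrow> g (g' z) = z"
    by (rule biholomorphismE[OF g]) (rule that)
  define \<alpha> where "\<alpha> t = g' (finite_part (\<gamma> t))" for t
  have \<gamma>_C: "finite_part (\<gamma> t) \<in> C" "\<gamma> t = Pt (finite_part (\<gamma> t))" if "t \<in> {0<..<1}" for t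
  proof -
    have "\<gamma> t \<in> Pt ` C" using \<gamma>(2) that by blast
    then show "finite_part (\<gamma> t) \<in> C" "\<gamma> t = Pt (finite_part (\<gamma> t))" by auto
  qed
  have \<gamma>_cont: "continuous_on {0..1} \<gamma>" using \<gamma>(1) by (simp add: path_def)
  have \<alpha>_cont: "continuous_on {0<..<1} \<alpha>"
  proof -
    have "continuous_on {0<..<1} \<gamma>" using \<gamma>_cont by (rule continuous_on_subset) auto
    then have "continuous_on {0<..<1} (\<lambda>t. finite_part (\<gamma> t))"
      by (rule continuous_on_compose2[OF continuous_finite_part]) (use \<gamma>(2) in auto)
    then show ?thesis unfolding \<alpha>_def
      by (rule continuous_on_compose2[OF holomorphic_on_imp_continuous_on[OF g'(2)]]) (use \<gamma>_C C in auto)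
  qed
  have \<alpha>_rhp: "\<alpha> t \<in> rhp" and g\<alpha>: "g (\<alpha> t) = finite_part (\<gamma> t)" if "t \<in> {0<..<1}" for t
    using \<gamma>_C(1)[OF that] C g'(5,6) by (auto simp: \<alpha>_def)
  have \<alpha>_strip: "0 < Re (\<alpha> t)" "Re (\<alpha> t) < c" if "t \<in> {0<..<1}" for t
    using \<alpha>_rhp[OF that] strip[of "\<alpha> t"] g\<alpha>[OF that] \<gamma>_C(1)[OF that] by (auto simp: rhp_def not_le[symmetric])
  have "\<exists>t\<in>{0<..<1}. real n < cmod (\<alpha> t)" for n
  proof -
    obtain w where w: "w \<in> rhp" "real n < cmod w" "g w \<in> C" using unb by blast
    have "Pt (g w) \<in> \<gamma> ` {0<..<1}" using w(3) \<gamma>(2) by simp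
    then obtain t where t: "t \<in> {0<..<1}" "Pt (g w) = \<gamma> t" by auto
    have "finite_part (\<gamma> t) = g w" by (simp flip: t(2))
    then have "\<alpha> t = w" by (simp add: \<alpha>_def g'(4)[OF w(1)])
    then show ?thesis using w(2) t(1) by blast
  qed
  then obtain x where x: "\<And>n. x n \<in> {0<..<1}" "\<And>n. real n < cmod (\<alpha> (x n))" by metis
  have "x n \<in> {0..1}" for n using x(1)[of n] by auto
  then obtain t r where t: "t \<in> {0..1}" and r: "strict_mono (r :: nat \<Rightarrow> nat)" and lim: "(\<lambda>n. x (r n)) \<longlonglongrightarrow> t"
    by (rule compact_convergent_subsequence[OF compact_Icc]) (rule that)
  have \<alpha>_inf: "filterlim (\<lambda>n. \<alpha> (x (r n))) at_infinity sequentially"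
  proof -
    have "filterlim (\<lambda>n. \<alpha> (x n)) at_infinity sequentially"
      unfolding filterlim_at_infinity_conv_norm_at_top
      by (rule filterlim_at_top_mono[OF filterlim_real_sequentially]) (use less_imp_le[OF x(2)] in simp)
    then show ?thesis by (rule filterlim_compose[OF _ filterlim_subseq[OF r]])
  qed
  \<comment> \<open>At an interior parameter \<alpha> is continuous and could not be
    unbounded.\<close>
  have t_end: "t = 0 \<or> t = 1"
  proof (rule ccontr)
    assume "\<not> ?thesis"
    then have "t \<in> {0<..<1}" using t by auto
    then have "isCont \<alpha> t" using \<alpha>_cont by (simp add: continuous_on_eq_continuous_at)
    then have "(\<lambda>n. \<alpha> (x (r n))) \<longlonglongrightarrow> \<alpha> t" using lim by (rule isCont_tendsto_compose)
    then show False using \<alpha>_inf not_tendsto_and_filterlim_at_infinity sequentially_bot by blast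
  qed
  define F where "F = at t within {0<..<1}"
  have ev: "\<forall>\<^sub>F s in F. s \<in> {0<..<1}" unfolding F_def eventually_at_filter by simp
  obtain k M where k: "k holomorphic_on rhp" "\<And>w. w \<in> rhp \<Longrightarrow> cmod (k w) \<le> M"
    and k_iff: "\<And>F. \<forall>\<^sub>F w in F. w \<in> rhp \<Longrightarrow> (k \<longlongrightarrow> 0) F \<longleftrightarrow> ((\<lambda>w. Pt (g w)) \<longlongrightarrow> \<gamma> t) F"
    by (rule bounded_test_function[OF g \<open>\<Omega> \<noteq> UNIV\<close>]) (rule that)
  have M0: "0 \<le> M" using order_trans[OF norm_ge_zero k(2)[OF \<alpha>_rhp[OF x(1)]]] .
  have "(\<gamma> \<longlongrightarrow> \<gamma> t) F"
  proof -
    have "(\<gamma> \<longlongrightarrow> \<gamma> t) (at t within {0..1})" using \<gamma>_cont t by (simp add: continuous_on_def)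
    then show ?thesis unfolding F_def by (rule tendsto_within_subset) auto
  qed
  moreover have "\<forall>\<^sub>F s in F. \<gamma> s = Pt (g (\<alpha> s))"
    using ev by eventually_elim (use \<gamma>_C(2) g\<alpha> in auto)
  ultimately have "((\<lambda>s. Pt (g (\<alpha> s))) \<longlongrightarrow> \<gamma> t) F"
    using tendsto_cong[of \<gamma> "\<lambda>s. Pt (g (\<alpha> s))" F] by blast
  moreover have "\<forall>\<^sub>F s in F. \<alpha> s \<in> rhp" using ev by eventually_elim (rule \<alpha>_rhp)
  ultimately have k0: "((\<lambda>s. k (\<alpha> s)) \<longlongrightarrow> 0) F"
    using k_iff[of "filtermap \<alpha> F"] by (simp add: eventually_filtermap filterlim_filtermap)
  have "\<exists>y. real j \<le> \<bar>y\<bar> \<and> cmod (k (Complex c y)) ^ 4 \<le> inverse (real (Suc j)) * M ^ 3" for j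
  proof -
    let ?\<epsilon> = "inverse (real (Suc j))"
    have "\<forall>\<^sub>F s in F. cmod (k (\<alpha> s)) < ?\<epsilon>"
      using tendstoD[OF k0, of ?\<epsilon>] by simp
    then obtain \<delta> where \<delta>: "\<delta> > 0"
      "\<And>s. s \<in> {0<..<1} \<Longrightarrow> s \<noteq> t \<Longrightarrow> dist s t < \<delta> \<Longrightarrow> cmod (k (\<alpha> s)) < ?\<epsilon>"
      unfolding F_def eventually_at by blast
    have close: "\<forall>\<^sub>F n in sequentially. dist (x (r n)) t < \<delta>" using tendstoD[OF lim \<delta>(1)] .
    then obtain m where m: "dist (x (r m)) t < \<delta>" using eventually_happens sequentially_bot by blast
    \<comment> \<open>One \<open>c\<close> is lost in passing from the modulus to the imaginary
      part, \<open>2 * c\<close> is the height of the window around \<open>y\<close>, and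
      \<open>real j\<close> ensures \<open>|y| \<ge> j\<close>.\<close>
    let ?B = "cmod (\<alpha> (x (r m))) + 3 * c + real j"
    have "\<forall>\<^sub>F n in sequentially. ?B \<le> cmod (\<alpha> (x (r n)))"
      using \<alpha>_inf unfolding filterlim_at_infinity_conv_norm_at_top filterlim_at_top by blast
    with close have "\<forall>\<^sub>F n in sequentially. dist (x (r n)) t < \<delta> \<and> ?B \<le> cmod (\<alpha> (x (r n)))"
      by (rule eventually_conj)
    then obtain n where n: "dist (x (r n)) t < \<delta>" "?B \<le> cmod (\<alpha> (x (r n)))"
      using eventually_happens sequentially_bot by blast
    define a where "a = x (r m)"
    define b where "b = x (r n)"
    have ab: "a \<in> {0<..<1}" "b \<in> {0<..<1}" using x(1) by (auto simp: a_def b_def)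
    have seg: "s \<in> {0<..<1}" "dist s t < \<delta>" "s \<noteq> t" if "s \<in> closed_segment u v" "u \<in> {a, b}" "v \<in> {a, b}" for s u v
    proof -
      have "closed_segment u v \<subseteq> {0<..<1} \<inter> ball t \<delta>"
        using ab m n that by (intro closed_segment_subset convex_Int) (auto simp: a_def b_def dist_commute)
      then show "s \<in> {0<..<1}" "dist s t < \<delta>" using that(1) by (auto simp: dist_commute)
      then show "s \<noteq> t" using t_end by auto
    qed
    have bound: "cmod (k (Complex c y)) ^ 4 \<le> ?\<epsilon> * M ^ 3"
      if uv: "u \<in> {a, b}" "v \<in> {a, b}" and y: "Im (\<alpha> u) \<le> y - c" "y + c \<le> Im (\<alpha> v)" for u v y
    proof (rule halfplane_crossing_bound[OF k, of "\<alpha> \<circ> linepath u v"])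
      have img: "path_image (\<alpha> \<circ> linepath u v) = \<alpha> ` closed_segment u v"
        by (simp add: path_image_compose)
      show "path (\<alpha> \<circ> linepath u v)"
      proof (rule path_continuous_image[OF path_linepath])
        have "closed_segment u v \<subseteq> {0<..<1}" using seg(1)[OF _ uv] by blast
        then show "continuous_on (path_image (linepath u v)) \<alpha>"
          using continuous_on_subset[OF \<alpha>_cont] by simp
      qed
      show "path_image (\<alpha> \<circ> linepath u v) \<subseteq> {w. 0 < Re w \<and> Re w < c}"
        unfolding img using seg(1)[OF _ uv] \<alpha>_strip by blast
      show "Im (pathstart (\<alpha> \<circ> linepath u v)) \<le> y - c" "y + c \<le> Im (pathfinish (\<alpha> \<circ> linepath u v))"
        using y by (simp_all add: pathstart_compose pathfinish_compose)
      show "cmod (k w) \<le> ?\<epsilon>" if "w \<in> path_image (\<alpha> \<circ> linepath u v)" for w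
        using that \<delta>(2) seg[OF _ uv] unfolding img by (auto intro!: less_imp_le)
    qed
    have Im_b: "cmod (\<alpha> b) \<le> c + \<bar>Im (\<alpha> b)\<bar>"
      using cmod_le[of "\<alpha> b"] \<alpha>_strip[OF ab(2)] by linarith
    have Im_a: "\<bar>Im (\<alpha> a)\<bar> \<le> cmod (\<alpha> a)" by (rule abs_Im_le_cmod)
    have B: "cmod (\<alpha> a) + 3 * c + real j \<le> cmod (\<alpha> b)" using n(2) by (simp add: a_def b_def)
    show ?thesis
    \<comment> \<open>The curve may escape upwards or downwards; in the second case the piece is
      traversed from \<open>b\<close> to \<open>a\<close>, so that it still rises through the
      window.\<close>
    proof (cases "0 \<le> Im (\<alpha> b)")
      case True
      show ?thesis
        using bound[of a b "Im (\<alpha> b) - c"] True Im_b Im_a B c norm_ge_zero[of "\<alpha> a"]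
        by (intro exI[of _ "Im (\<alpha> b) - c"]) (auto simp: abs_le_iff)
    next
      case False
      show ?thesis
        using bound[of b a "Im (\<alpha> b) + c"] False Im_b Im_a B c norm_ge_zero[of "\<alpha> a"]
        by (intro exI[of _ "Im (\<alpha> b) + c"]) (auto simp: abs_le_iff)
    qed
  qed
  then obtain y where y: "\<And>j. real j \<le> \<bar>y j\<bar>"
    "\<And>j. cmod (k (Complex c (y j))) ^ 4 \<le> inverse (real (Suc j)) * M ^ 3"
    by metis
  have y_rhp: "Complex c (y j) \<in> rhp" for j using c by (simp add: rhp_def)
  have "(\<lambda>j. cmod (k (Complex c (y j))) ^ 4) \<longlonglongrightarrow> 0"
  proof (rule Lim_null_comparison)
    show "\<forall>\<^sub>F j in sequentially. norm (cmod (k (Complex c (y j))) ^ 4) \<le> inverse (real (Suc j)) * M ^ 3"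
      using y(2) by simp
    show "(\<lambda>j. inverse (real (Suc j)) * M ^ 3) \<longlonglongrightarrow> 0"
      by (intro tendsto_mult_left_zero LIMSEQ_inverse_real_of_nat)
  qed
  then have "(\<lambda>j. root 4 (cmod (k (Complex c (y j))) ^ 4)) \<longlonglongrightarrow> root 4 0"
    by (rule tendsto_real_root)
  then have "(\<lambda>j. k (Complex c (y j))) \<longlonglongrightarrow> 0"
    by (simp add: real_root_power_cancel tendsto_norm_zero_iff)
  then have "(\<lambda>j. Pt (g (Complex c (y j)))) \<longlonglongrightarrow> \<gamma> t"
    using k_iff[of "filtermap (\<lambda>j. Complex c (y j)) sequentially"] y_rhp
    by (simp add: eventually_filtermap filterlim_filtermap)
  moreover have "filterlim (\<lambda>j. Complex c (y j)) (halfplane_at_infinity c) sequentially"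
  proof -
    have "real j \<le> cmod (Complex c (y j))" for j
      using y(1)[of j] abs_Im_le_cmod[of "Complex c (y j)"] by simp
    then have "filterlim (\<lambda>j. Complex c (y j)) at_infinity sequentially"
      unfolding filterlim_at_infinity_conv_norm_at_top
      by (intro filterlim_at_top_mono[OF filterlim_real_sequentially]) auto
    then show ?thesis by (simp add: filterlim_halfplane_at_infinity)
  qed
  then have "(\<lambda>j. Pt (g (Complex c (y j)))) \<longlonglongrightarrow> L"
    using L c filterlim_compose[of "\<lambda>w. Pt (g w)" "nhds L" "halfplane_at_infinity c"]
    by (simp add: halfplane_limit_def)
  ultimately have "\<gamma> t = L" by (rule LIMSEQ_unique)
  then show ?thesis using t_end by (auto simp: pathstart_def pathfinish_def)
qed

section \<open>Null-chains\<close>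

lemma crosscutE:
  assumes "crosscut \<Omega> C"
  obtains \<gamma> where "path \<gamma>" "\<gamma> ` {0<..<1} = Pt ` C" "C \<subseteq> \<Omega>"
    "pathstart \<gamma> \<in> sphere_boundary \<Omega>" "pathfinish \<gamma> \<in> sphere_boundary \<Omega>"
    "pathstart \<gamma> \<in> sphere_closure C" "pathfinish \<gamma> \<in> sphere_closure C"
proof -
  obtain \<gamma> where \<gamma>: "simple_path \<gamma>" "\<gamma> ` {0<..<1} = Pt ` C" "C \<subseteq> \<Omega>"
    "pathstart \<gamma> \<in> sphere_boundary \<Omega>" "pathfinish \<gamma> \<in> sphere_boundary \<Omega>"
    using assms by (auto simp: crosscut_def)
  have "path \<gamma>" using \<gamma>(1) by (rule simple_path_imp_path)
  have "\<gamma> ` {0..1} \<subseteq> closure (Pt ` C)"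
  proof -
    have "\<gamma> ` closure {0<..<1} \<subseteq> closure (Pt ` C)"
    proof (rule image_closure_subset)
      show "continuous_on (closure {0<..<1}) \<gamma>" using \<open>path \<gamma>\<close> by (simp add: path_def)
      show "\<gamma> ` {0<..<1} \<subseteq> closure (Pt ` C)" unfolding \<gamma>(2) by (rule closure_subset)
    qed simp
    then show ?thesis by simp
  qed
  then have "pathstart \<gamma> \<in> sphere_closure C" "pathfinish \<gamma> \<in> sphere_closure C"
    by (auto simp: pathstart_def pathfinish_def sphere_closure_def)
  with \<open>path \<gamma>\<close> \<gamma>(2-) show ?thesis by (intro that)
qed

text \<open>The closed arc is compact in the sphere and its end points are not in \<Omega>. Removing
  it from \<Omega> therefore removes exactly \<open>C\<close>, which is thus relatively
  closed.\<close>

lemma crosscut_topology: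
  assumes "crosscut \<Omega> C" "open \<Omega>"
  shows "C \<noteq> {}" "connected C" "open (\<Omega> - C)" "C \<subseteq> \<Omega>"
proof -
  obtain \<gamma> where \<gamma>: "path \<gamma>" "\<gamma> ` {0<..<1} = Pt ` C" "C \<subseteq> \<Omega>"
    "pathstart \<gamma> \<in> sphere_boundary \<Omega>" "pathfinish \<gamma> \<in> sphere_boundary \<Omega>"
    by (rule crosscutE[OF assms(1)]) (rule that)
  have cont: "continuous_on {0<..<1} \<gamma>"
    using \<gamma>(1) unfolding path_def by (rule continuous_on_subset) auto
  have "\<gamma> (1/2) \<in> Pt ` C" using \<gamma>(2) by auto
  then show "C \<noteq> {}" by auto
  have "finite_part ` Pt ` C = C" by (simp add: image_image)
  moreover have "connected (finite_part ` Pt ` C)"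
    unfolding \<gamma>(2)[symmetric]
    by (intro connected_continuous_image cont continuous_on_subset[OF continuous_finite_part]) (use \<gamma>(2) in auto)
  ultimately show "connected C" by simp
  show "C \<subseteq> \<Omega>" by fact
  have "Pt z \<in> path_image \<gamma> \<longleftrightarrow> z \<in> C" if "z \<in> \<Omega>" for z
  proof
    assume "Pt z \<in> path_image \<gamma>"
    then obtain t where t: "t \<in> {0..1}" "Pt z = \<gamma> t" by (auto simp: path_image_def)
    have "Pt z \<notin> sphere_boundary \<Omega>" using that sphere_boundary_eq[OF assms(2)] by auto
    then have "t \<noteq> 0" "t \<noteq> 1" using \<gamma>(4,5) t(2) by (auto simp: pathstart_def pathfinish_def)
    then have "Pt z \<in> Pt ` C" using t \<gamma>(2) by auto
    then show "z \<in> C" by auto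
  next
    assume "z \<in> C"
    then have "Pt z \<in> \<gamma> ` {0<..<1}" using \<gamma>(2) by simp
    then show "Pt z \<in> path_image \<gamma>" by (force simp: path_image_def)
  qed
  then have "\<Omega> - C = \<Omega> \<inter> Pt -` (- path_image \<gamma>)" by auto
  moreover have "open (Pt -` (- path_image \<gamma>))"
    using continuous_Pt[of UNIV] closed_path_image[OF \<gamma>(1)] by (intro open_vimage) auto
  ultimately show "open (\<Omega> - C)" using assms(2) by auto
qed

text \<open>Otherwise \<open>U\<close> would be open and closed in the connected set
  \<Omega>.\<close>

lemma closure_component_meets:
  fixes \<Omega> A U :: "complex set"
  assumes "connected \<Omega>" "open (\<Omega> - A)" "U \<in> components (\<Omega> - A)" "U \<noteq> \<Omega>"
  obtains p where "p \<in> closure U" "p \<in> A" "p \<in> \<Omega>"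
proof (rule ccontr)
  assume "\<not> thesis"
  then have no: "\<And>p. p \<in> closure U \<Longrightarrow> p \<in> \<Omega> \<Longrightarrow> p \<notin> A" using that by blast
  have U: "open U" "U \<subseteq> \<Omega> - A" "U \<noteq> {}"
    using assms(2,3) open_components in_components_subset in_components_nonempty by blast+
  have "U = \<Omega> \<inter> closure U"
  proof
    show "U \<subseteq> \<Omega> \<inter> closure U" using U closure_subset by blast
    show "\<Omega> \<inter> closure U \<subseteq> U"
    proof
      fix z assume z: "z \<in> \<Omega> \<inter> closure U"
      then have "z \<in> \<Omega> - A" using no by blast
      then obtain Z where Z: "Z \<in> components (\<Omega> - A)" "z \<in> Z" by (metis Union_components UnionE)
      have "open Z" using Z assms(2) open_components by blast
      then have "Z \<inter> U \<noteq> {}" using Z z open_Int_closure_eq_empty[of Z U] by blast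
      then have "Z = U" using Z assms(3) components_nonoverlap by blast
      then show "z \<in> U" using Z by simp
    qed
  qed
  then have "openin (top_of_set \<Omega>) U" "closedin (top_of_set \<Omega>) U"
    using U by (auto simp: openin_open closedin_closed)
  then show False using assms(1,4) U(3) unfolding connected_clopen by blast
qed

text \<open>The closure of \<open>U\<close> reaches \<open>A\<close>, so \<open>U\<close> together
  with \<open>A\<close> is contained in a connected set that misses \<open>A'\<close>, and hence
  lies in \<open>U'\<close>. Therefore \<open>V'\<close> misses \<open>A\<close>, and since its
  closure reaches \<open>A'\<close> inside the open set \<open>V\<close>, it is contained in
  \<open>V\<close>. For null-chains this makes the parts behind successive crosscuts
  decrease.\<close>

lemma nested_complementary_components:
  fixes \<Omega> A A' :: "complex set"
  assumes "connected \<Omega>" and A: "open (\<Omega> - A)" "connected A" "A \<subseteq> \<Omega>" and A': "open (\<Omega> - A')" "A' \<subseteq> \<Omega>"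
    and UV: "U \<in> components (\<Omega> - A)" "V \<in> components (\<Omega> - A)" "U \<noteq> V" "A' \<subseteq> V"
    and UV': "U' \<in> components (\<Omega> - A')" "V' \<in> components (\<Omega> - A')" "U' \<noteq> V'"
    and meet: "U \<inter> U' \<noteq> {}"
  shows "V' \<subseteq> V"
proof -
  have sub: "U \<subseteq> \<Omega> - A" "V \<subseteq> \<Omega> - A" "U' \<subseteq> \<Omega> - A'" "V' \<subseteq> \<Omega> - A'"
    using UV UV' in_components_subset by blast+
  have ne: "U \<noteq> {}" "V \<noteq> {}" "U' \<noteq> {}" "V' \<noteq> {}"
    using UV UV' in_components_nonempty by blast+
  have disj: "U \<inter> V = {}" "U' \<inter> V' = {}" using UV UV' components_nonoverlap by blast+
  have "U \<noteq> \<Omega>" using disj sub ne by blast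
  then obtain p where p: "p \<in> closure U" "p \<in> A"
    by (rule closure_component_meets[OF assms(1) A(1) UV(1)]) (rule that)
  have "connected (insert p U)"
    using connected_intermediate_closure[of U "insert p U"] in_components_connected[OF UV(1)] p closure_subset by blast
  then have "connected (insert p U \<union> A)"
    using A(2) p(2) by (intro connected_Un) auto
  moreover have "insert p U \<union> A \<subseteq> \<Omega> - A'"
    using UV(4) sub(1,2) disj(1) A(3) p(2) by blast
  ultimately have "insert p U \<union> A \<subseteq> U'"
    using components_maximal[OF UV'(1)] meet by blast
  then have V'_sub: "V' \<subseteq> \<Omega> - A" using disj(2) sub(4) by blast
  have "V' \<noteq> \<Omega>" using disj(2) sub ne by blast
  then obtain p' where p': "p' \<in> closure V'" "p' \<in> A'"
    by (rule closure_component_meets[OF assms(1) A'(1) UV'(2)]) (rule that)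
  have "open V" using open_components[OF A(1) UV(2)] .
  then have "V \<inter> V' \<noteq> {}" using p' UV(4) open_Int_closure_eq_empty[of V V'] by blast
  then show ?thesis
    using components_maximal[OF UV(2) in_components_connected[OF UV'(2)] V'_sub] by blast
qed

text \<open>In logarithmic coordinates the region is a convex half strip.\<close>

lemma connected_halfplane_outside_disc:
  assumes "\<rho> > 0"
  shows "connected {w. 0 < Re w \<and> \<rho> < cmod w}"
proof -
  let ?S = "{z. ln \<rho> < Re z} \<inter> ({z. - (pi/2) < Im z} \<inter> {z. Im z < pi/2})"
  have "convex ?S"
    by (intro convex_Int convex_halfspace_Re_gt convex_halfspace_Im_gt convex_halfspace_Im_lt)
  then have "connected (exp ` ?S)"
    by (intro connected_continuous_image convex_connected continuous_intros)
  also have "exp ` ?S = {w. 0 < Re w \<and> \<rho> < cmod w}"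
  proof (intro set_eqI iffI)
    fix w assume "w \<in> exp ` ?S"
    then obtain z where z: "w = exp z" "ln \<rho> < Re z" "- (pi/2) < Im z" "Im z < pi/2" by auto
    have "\<rho> < exp (Re z)" using z(2) assms by (metis exp_less_mono exp_ln)
    moreover have "0 < cos (Im z)" using z by (intro cos_gt_zero_pi) auto
    ultimately show "w \<in> {w. 0 < Re w \<and> \<rho> < cmod w}" using z(1) by (simp add: Re_exp)
  next
    fix w assume w: "w \<in> {w. 0 < Re w \<and> \<rho> < cmod w}"
    then have "w \<noteq> 0" by auto
    moreover have "\<bar>Im (Ln w)\<bar> < pi/2" using w Re_Ln_pos_lt[OF \<open>w \<noteq> 0\<close>] by simp
    moreover have "ln \<rho> < Re (Ln w)" using w assms \<open>w \<noteq> 0\<close> by simp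
    ultimately show "w \<in> exp ` ?S" by (intro image_eqI[of _ _ "Ln w"]) (auto simp: abs_less_iff)
  qed
  finally show ?thesis .
qed

lemma dist_le_sphere_diameter:
  fixes S :: "riemann_sphere set"
  assumes "x \<in> S" "y \<in> S"
  shows "dist x y \<le> diameter S"
  using diameter_bounded_bound[OF _ assms] bounded_subset[OF compact_imp_bounded[OF compact_riemann_sphere]]
  by blast

text \<open>Crosscuts have end points on the boundary and diameters tending to zero, so an
  accumulation point in \<open>K\<close> would be a limit of boundary points. The boundary is closed
  and disjoint from the open set \<Omega>.\<close>

lemma null_chain_leaves_compact:
  assumes C: "C \<in> null_chains \<Omega>" and "open \<Omega>" and K: "compact K" "K \<subseteq> \<Omega>"
  shows "\<forall>\<^sub>F n in sequentially. C n \<inter> K = {}"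
proof (rule ccontr)
  assume "\<not> ?thesis"
  then obtain r where r: "strict_mono (r :: nat \<Rightarrow> nat)" "\<And>n. C (r n) \<inter> K \<noteq> {}"
    using not_eventually_sequentiallyD by blast
  have "\<forall>n. \<exists>z. z \<in> C (r n) \<inter> K" using r(2) by blast
  from choice[OF this] obtain x where x: "\<And>n. x n \<in> C (r n)" "\<And>n. x n \<in> K" by auto
  obtain l s where l: "l \<in> K" and s: "strict_mono (s :: nat \<Rightarrow> nat)" and lim: "(\<lambda>n. x (s n)) \<longlonglongrightarrow> l"
    by (rule compact_convergent_subsequence[OF K(1) x(2)]) (rule that)
  have cc: "crosscut \<Omega> (C n)" for n using C by (simp add: null_chains_def)
  have diam: "(\<lambda>n. diameter (Pt ` C n)) \<longlonglongrightarrow> 0" using C by (simp add: null_chains_def)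
  have "\<forall>n. \<exists>e. e \<in> sphere_boundary \<Omega> \<and> e \<in> sphere_closure (C n)"
    by (intro allI, rule crosscutE[OF cc]) (intro exI conjI)
  from choice[OF this] obtain e where
    e: "\<And>n. e n \<in> sphere_boundary \<Omega>" "\<And>n. e n \<in> sphere_closure (C n)" by auto
  have le: "dist (e (r n)) (Pt (x n)) \<le> diameter (Pt ` C (r n))" for n
  proof -
    have "dist (e (r n)) (Pt (x n)) \<le> diameter (closure (Pt ` C (r n)))"
      using e(2)[of "r n"] x(1)[of n] closure_subset[of "Pt ` C (r n)"] by (intro dist_le_sphere_diameter) (auto simp: sphere_closure_def)
    also have "\<dots> = diameter (Pt ` C (r n))"
      by (intro diameter_closure bounded_subset[OF compact_imp_bounded[OF compact_riemann_sphere]]) auto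
    finally show ?thesis .
  qed
  have lim': "(\<lambda>n. Pt (x (s n))) \<longlonglongrightarrow> Pt l" using lim by (simp add: tendsto_Pt_iff)
  have "(\<lambda>n. dist (e (r (s n))) (Pt l)) \<longlonglongrightarrow> 0"
  proof (rule Lim_null_comparison)
    have "dist (e (r (s n))) (Pt l) \<le> diameter (Pt ` C (r (s n))) + dist (Pt (x (s n))) (Pt l)" for n
      using le[of "s n"] dist_triangle[of "e (r (s n))" "Pt l" "Pt (x (s n))"] by linarith
    then show "\<forall>\<^sub>F n in sequentially. norm (dist (e (r (s n))) (Pt l)) \<le>
        diameter (Pt ` C (r (s n))) + dist (Pt (x (s n))) (Pt l)"
      by simp
    have "(\<lambda>n. diameter (Pt ` C (r (s n)))) \<longlonglongrightarrow> 0"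
      using filterlim_compose[OF diam filterlim_compose[OF filterlim_subseq[OF r(1)] filterlim_subseq[OF s]]] .
    from tendsto_add[OF this iffD1[OF tendsto_dist_iff lim']]
    show "(\<lambda>n. diameter (Pt ` C (r (s n))) + dist (Pt (x (s n))) (Pt l)) \<longlonglongrightarrow> 0" by simp
  qed
  then have "(\<lambda>n. e (r (s n))) \<longlonglongrightarrow> Pt l" by (rule iffD2[OF tendsto_dist_iff])
  then have "Pt l \<in> sphere_boundary \<Omega>"
    using e(1) closed_sequentially[of "sphere_boundary \<Omega>" "\<lambda>n. e (r (s n))"]
    by (auto simp: sphere_boundary_def)
  then show False using l K(2) sphere_boundary_eq[OF \<open>open \<Omega>\<close>] by auto
qed

text \<open>The image of a closed concentric disc serves as \<open>K\<close>. By connectedness, a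
  crosscut that avoids \<open>K\<close> leaves all of \<open>P\<close> in one component.\<close>

lemma null_chain_avoids_connected:
  assumes h: "riemann_map \<Omega> h" and C: "C \<in> null_chains \<Omega>" and "open \<Omega>"
    and P: "compact P" "P \<subseteq> \<Omega>"
  obtains K where "connected K" "P \<subseteq> K" "K \<subseteq> \<Omega>" "\<forall>\<^sub>F n in sequentially. C n \<inter> K = {}"
proof -
  obtain h' where h': "h holomorphic_on ball 0 1" "h' holomorphic_on \<Omega>"
    "\<And>z. z \<in> ball 0 1 \<Longrightarrow> h z \<in> \<Omega>" "\<And>z. z \<in> ball 0 1 \<Longrightarrow> h' (h z) = z"
    "\<And>z. z \<in> \<Omega> \<Longrightarrow> h' z \<in> ball 0 1" "\<And>z. z \<in> \<Omega> \<Longrightarrow> h (h' z) = z"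
    by (rule biholomorphismE[OF h]) (rule that)
  obtain \<rho> where \<rho>: "\<rho> < 1" "\<And>z. z \<in> P \<Longrightarrow> cmod (h' z) \<le> \<rho>"
  proof (cases "P = {}")
    case True
    then show ?thesis using that[of 0] by simp
  next
    case False
    have "continuous_on P (\<lambda>z. cmod (h' z))"
      by (intro continuous_intros continuous_on_subset[OF holomorphic_on_imp_continuous_on[OF h'(2)] P(2)])
    from continuous_attains_sup[OF P(1) False this]
    obtain u where "u \<in> P" "\<And>z. z \<in> P \<Longrightarrow> cmod (h' z) \<le> cmod (h' u)" by blast
    then show ?thesis using that[of "cmod (h' u)"] h'(5)[of u] P(2) by auto
  qed
  define K where "K = h ` cball 0 \<rho>"
  have sub: "cball 0 \<rho> \<subseteq> ball (0::complex) 1" using \<rho>(1) by auto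
  have cont: "continuous_on (cball 0 \<rho>) h"
    by (rule continuous_on_subset[OF holomorphic_on_imp_continuous_on[OF h'(1)] sub])
  have "K \<subseteq> \<Omega>" using h'(3) sub by (auto simp: K_def)
  moreover have "compact K" "connected K"
    unfolding K_def by (intro compact_continuous_image connected_continuous_image cont convex_connected
        compact_cball convex_cball)+
  moreover have "P \<subseteq> K"
  proof
    fix z assume z: "z \<in> P"
    then have "z = h (h' z)" "h' z \<in> cball 0 \<rho>" using h'(6) P(2) \<rho>(2) by auto
    then show "z \<in> K" unfolding K_def by (rule image_eqI)
  qed
  ultimately show ?thesis using null_chain_leaves_compact[OF C \<open>open \<Omega>\<close>] that by blast
qed

text \<open>If the half plane missed the components behind the crosscuts, two consecutive crosscuts would both
  have an end running to infinity in a vertical strip, and these ends would have the same limit.\<close>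

lemma null_chain_meets_halfplane:
  assumes h: "riemann_map \<Omega> h" and C: "C \<in> null_chains \<Omega>"
    and \<Omega>: "open \<Omega>" "connected \<Omega>" "\<Omega> \<noteq> UNIV"
    and lim: "\<And>\<sigma>. cmod \<sigma> = 1 \<Longrightarrow> \<exists>L. halfplane_limit (h \<circ> cayley \<sigma>) L"
  obtains \<sigma> where "cmod \<sigma> = 1"
    "\<forall>\<^sub>F n in sequentially. C n \<inter> (h \<circ> cayley \<sigma>) ` {w. 1 \<le> Re w} \<noteq> {}"
proof -
  obtain h' where h': "h holomorphic_on ball 0 1" "h' holomorphic_on \<Omega>"
    "\<And>z. z \<in> ball 0 1 \<Longrightarrow> h z \<in> \<Omega>" "\<And>z. z \<in> ball 0 1 \<Longrightarrow> h' (h z) = z"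
    "\<And>z. z \<in> \<Omega> \<Longrightarrow> h' z \<in> ball 0 1" "\<And>z. z \<in> \<Omega> \<Longrightarrow> h (h' z) = z"
    by (rule biholomorphismE[OF h]) (rule that)
  have cc: "crosscut \<Omega> (C n)" for n using C by (simp add: null_chains_def)
  note top = crosscut_topology[OF cc \<Omega>(1)]
  have disj_closure: "sphere_closure (C n) \<inter> sphere_closure (C (Suc n)) = {}" for n
    using C by (simp add: null_chains_def)
  obtain c0 where c0: "c0 \<in> C 0" using top(1) by blast
  have "\<forall>n. \<exists>UV. n \<ge> 1 \<longrightarrow> fst UV \<in> components (\<Omega> - C n) \<and> snd UV \<in> components (\<Omega> - C n) \<and>
      fst UV \<noteq> snd UV \<and> C 0 \<subseteq> fst UV \<and> C (Suc n) \<subseteq> snd UV"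
  proof
    fix n
    show "\<exists>UV. n \<ge> 1 \<longrightarrow> fst UV \<in> components (\<Omega> - C n) \<and> snd UV \<in> components (\<Omega> - C n) \<and>
      fst UV \<noteq> snd UV \<and> C 0 \<subseteq> fst UV \<and> C (Suc n) \<subseteq> snd UV"
    proof (cases "n \<ge> 1")
      case True
      then have "separates \<Omega> (C n) (C 0) (C (Suc n))" using C by (simp add: null_chains_def)
      then obtain U V where "U \<in> components (\<Omega> - C n)" "V \<in> components (\<Omega> - C n)" "U \<noteq> V"
        "C 0 \<subseteq> U" "C (Suc n) \<subseteq> V" unfolding separates_def by blast
      then show ?thesis by (intro exI[of _ "(U, V)"]) simp
    qed simp
  qed
  from choice[OF this] obtain UV where UV: "\<forall>n\<ge>1. fst (UV n) \<in> components (\<Omega> - C n) \<and>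
      snd (UV n) \<in> components (\<Omega> - C n) \<and> fst (UV n) \<noteq> snd (UV n) \<and>
      C 0 \<subseteq> fst (UV n) \<and> C (Suc n) \<subseteq> snd (UV n)" by auto
  \<comment> \<open>\<open>V n\<close> is the part cut off by \<open>C n\<close>, and
    \<open>U n\<close> the part containing \<open>C 0\<close>. Both are specified for
    \<open>n \<ge> 1\<close> only, as separation is required from index 1 on.\<close>
  define U where "U n = fst (UV n)" for n
  define V where "V n = snd (UV n)" for n
  have U: "U n \<in> components (\<Omega> - C n)" and V: "V n \<in> components (\<Omega> - C n)" and ne: "U n \<noteq> V n"
    and C0U: "C 0 \<subseteq> U n" and CV: "C (Suc n) \<subseteq> V n" if "n \<ge> 1" for n
    using UV that by (auto simp: U_def V_def)
  have UV_disj: "U n \<inter> V n = {}" if "n \<ge> 1" for n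
    using U[OF that] V[OF that] ne[OF that] components_nonoverlap by blast
  have V_sub: "V n \<subseteq> \<Omega> - C n" if "n \<ge> 1" for n using V[OF that] in_components_subset by blast
  have V_max: "S \<subseteq> V n" if "n \<ge> 1" "connected S" "S \<subseteq> \<Omega>" "S \<inter> C n = {}" "V n \<inter> S \<noteq> {}" for S n
    by (rule components_maximal[OF V[OF that(1)] that(2) _ that(5)]) (use that in blast)
  have U_max: "S \<subseteq> U n" if "n \<ge> 1" "connected S" "S \<subseteq> \<Omega>" "S \<inter> C n = {}" "U n \<inter> S \<noteq> {}" for S n
    by (rule components_maximal[OF U[OF that(1)] that(2) _ that(5)]) (use that in blast)
  have nest: "V (Suc n) \<subseteq> V n" if n: "n \<ge> 1" for n
  proof (rule nested_complementary_components[OF \<Omega>(2) top(3,2,4) top(3,4)])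
    show "U n \<in> components (\<Omega> - C n)" "V n \<in> components (\<Omega> - C n)" "U n \<noteq> V n" "C (Suc n) \<subseteq> V n"
      using U V ne CV n by auto
    show "U (Suc n) \<in> components (\<Omega> - C (Suc n))" "V (Suc n) \<in> components (\<Omega> - C (Suc n))"
      "U (Suc n) \<noteq> V (Suc n)" using U V ne by auto
    show "U n \<inter> U (Suc n) \<noteq> {}" using C0U[of n] C0U[of "Suc n"] c0 n by auto
  qed
  have mono: "V n \<subseteq> V N" if "N \<le> n" "N \<ge> 1" for N n
    using that
  proof (induction n rule: dec_induct)
    case (step n)
    then show ?case using nest[of n] by auto
  qed simp
  \<comment> \<open>A point of \<open>C 0\<close> and the set \<open>P\<close> lie in a connected
    set that late crosscuts avoid; this puts \<open>P\<close> on the side of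
    \<open>U n\<close>.\<close>
  have leaves: "\<forall>\<^sub>F n in sequentially. V n \<inter> P = {}" if P: "compact P" "P \<subseteq> \<Omega>" for P
  proof -
    have c0\<Omega>: "c0 \<in> \<Omega>" using c0 top(4) by blast
    obtain K where K: "connected K" "insert c0 P \<subseteq> K" "K \<subseteq> \<Omega>" "\<forall>\<^sub>F n in sequentially. C n \<inter> K = {}"
      by (rule null_chain_avoids_connected[OF h C \<Omega>(1), of "insert c0 P"])
        (use P c0\<Omega> that in \<open>auto simp: compact_insert\<close>)
    from K(4) eventually_ge_at_top[of 1] show ?thesis
    proof eventually_elim
      case (elim n)
      have "K \<subseteq> U n"
        using elim K(2) c0 C0U[of n] by (intro U_max K(1,3)) auto
      then show ?case using UV_disj[of n] elim K(2) by auto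
    qed
  qed
  \<comment> \<open>The index \<open>Suc n\<close> skips the unspecified \<open>V 0\<close>.\<close>
  have "\<forall>n. \<exists>v. v \<in> V (Suc n)" using in_components_nonempty[OF V] by (metis Suc_eq_plus1 ex_in_conv le_add2)
  from choice[OF this] obtain v where v: "\<And>n. v n \<in> V (Suc n)" by auto
  have v\<Omega>: "v n \<in> \<Omega>" for n using v[of n] V_sub[of "Suc n"] by auto
  have "h' (v n) \<in> cball 0 1" for n using h'(5)[OF v\<Omega>[of n]] by simp
  then obtain \<sigma> r where \<sigma>: "\<sigma> \<in> cball 0 1" and r: "strict_mono (r :: nat \<Rightarrow> nat)"
    and r_lim: "(\<lambda>n. h' (v (r n))) \<longlonglongrightarrow> \<sigma>"
    by (rule compact_convergent_subsequence[OF compact_cball]) (rule that)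
  have \<sigma>1: "cmod \<sigma> = 1"
  proof (rule ccontr)
    assume "cmod \<sigma> \<noteq> 1"
    then have "cmod \<sigma> < 1" using \<sigma> by simp
    define \<rho> where "\<rho> = (1 + cmod \<sigma>) / 2"
    have \<rho>: "cmod \<sigma> < \<rho>" "\<rho> < 1" using \<open>cmod \<sigma> < 1\<close> by (auto simp: \<rho>_def)
    have sub: "cball 0 \<rho> \<subseteq> ball (0::complex) 1" using \<rho> by auto
    have "compact (h ` cball 0 \<rho>)"
      by (intro compact_continuous_image compact_cball
          continuous_on_subset[OF holomorphic_on_imp_continuous_on[OF h'(1)] sub])
    then have "\<forall>\<^sub>F n in sequentially. V n \<inter> h ` cball 0 \<rho> = {}"
      by (rule leaves) (use h'(3) sub in auto)
    then have "\<forall>\<^sub>F n in sequentially. V (Suc (r n)) \<inter> h ` cball 0 \<rho> = {}"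
      using filterlim_compose[OF filterlim_Suc filterlim_subseq[OF r]] by (rule eventually_compose_filterlim)
    moreover have "\<forall>\<^sub>F n in sequentially. cmod (h' (v (r n))) < \<rho>"
      by (rule order_tendstoD(2)[OF tendsto_norm[OF r_lim] \<rho>(1)])
    ultimately have "\<forall>\<^sub>F n in sequentially. False"
    proof eventually_elim
      case (elim n)
      then have "h (h' (v (r n))) \<in> h ` cball 0 \<rho>" by simp
      then show ?case using elim(1) v[of "r n"] h'(6)[OF v\<Omega>[of "r n"]] by auto
    qed
    then show False by simp
  qed
  define g where "g = h \<circ> cayley \<sigma>"
  have g: "biholomorphism g rhp \<Omega>"
    unfolding g_def by (rule biholomorphism_compose[OF cayley_biholomorphism[OF \<sigma>1] h])
  have g_rhp: "g w \<in> \<Omega>" if "w \<in> rhp" for w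
    using g that by (auto simp: biholomorphism_def bij_betw_def)
  have g_cont: "continuous_on rhp g" using g by (simp add: biholomorphism_def holomorphic_on_imp_continuous_on)
  obtain L where L: "halfplane_limit g L" using lim[OF \<sigma>1] by (auto simp: g_def)
  define w where "w n = inv_cayley \<sigma> (h' (v (r n)))" for n
  have w: "w n \<in> rhp" "g (w n) = v (r n)" for n
    using inv_cayley_in_rhp[OF \<sigma>1 h'(5)[OF v\<Omega>]] cayley_inv_cayley[OF \<sigma>1 h'(5)[OF v\<Omega>]] h'(6)[OF v\<Omega>]
    by (auto simp: w_def g_def)
  have w_inf: "filterlim w at_infinity sequentially"
    unfolding w_def using h'(5)[OF v\<Omega>] by (intro filterlim_inv_cayley[OF \<sigma>1 r_lim]) auto
  define E where "E = g ` {w. 1 \<le> Re w}"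
  have E_sub: "{w. 1 \<le> Re w} \<subseteq> rhp" by (auto simp: rhp_def)
  have E: "connected E" "E \<subseteq> \<Omega>"
    unfolding E_def
    by (intro connected_continuous_image continuous_on_subset[OF g_cont E_sub] convex_connected
        convex_halfspace_Re_ge) (use E_sub g_rhp in auto)
  have E_V: "E \<inter> V N \<noteq> {}" if N: "N \<ge> 1" for N
  proof (rule ccontr)
    assume "\<not> ?thesis"
    then have no: "g u \<notin> V N" if "1 \<le> Re u" for u using that by (auto simp: E_def)
    have L_end: "L \<in> sphere_closure (C (Suc n))" if n: "n \<ge> N" for n
    proof -
      obtain \<gamma> where \<gamma>: "path \<gamma>" "\<gamma> ` {0<..<1} = Pt ` C (Suc n)" "C (Suc n) \<subseteq> \<Omega>"
        "pathstart \<gamma> \<in> sphere_closure (C (Suc n))" "pathfinish \<gamma> \<in> sphere_closure (C (Suc n))"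
        by (rule crosscutE[OF cc[of "Suc n"]]) (rule that)
      have "L \<in> {pathstart \<gamma>, pathfinish \<gamma>}"
      proof (rule crosscut_end_limit[OF g \<Omega>(3) L \<gamma>(1-3), of 1])
        show "g u \<notin> C (Suc n)" if "1 \<le> Re u" for u
          using no[OF that] CV[of n] mono[of N n] n N by auto
        show "\<exists>u\<in>rhp. \<rho> < cmod u \<and> g u \<in> C (Suc n)" for \<rho>
        proof (rule ccontr)
          \<comment> \<open>If the crosscut stayed bounded, the connected part of the half plane
            outside a large disc would be mapped entirely into \<open>V (Suc n)\<close>, because it
            contains some \<open>w m\<close>. But it also contains large positive reals, whose
            images lie in \<open>E\<close>.\<close>
          assume far: "\<not> ?thesis"
          define \<rho>' where "\<rho>' = max \<rho> 1"
          let ?D = "{u. 0 < Re u \<and> \<rho>' < cmod u}"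
          have D_sub: "?D \<subseteq> rhp" by (auto simp: rhp_def)
          have "\<forall>\<^sub>F m in sequentially. \<rho>' + 1 \<le> cmod (w m)"
            using w_inf unfolding filterlim_at_infinity_conv_norm_at_top filterlim_at_top by blast
          with eventually_ge_at_top[of n] have "\<forall>\<^sub>F m in sequentially. n \<le> m \<and> \<rho>' + 1 \<le> cmod (w m)"
            by (rule eventually_conj)
          then obtain m where m: "n \<le> m" "\<rho>' + 1 \<le> cmod (w m)"
            using eventually_happens sequentially_bot by blast
          have "w m \<in> ?D" using w(1)[of m] m(2) by (simp add: rhp_def)
          have "Suc n \<le> Suc (r m)" using m(1) seq_suble[OF r, of m] by simp
          then have "g (w m) \<in> V (Suc n)" using v[of "r m"] mono[of "Suc n" "Suc (r m)"] w(2) by auto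
          have "g ` ?D \<subseteq> V (Suc n)"
          proof (rule V_max)
            show "connected (g ` ?D)"
              by (intro connected_continuous_image continuous_on_subset[OF g_cont D_sub]
                  connected_halfplane_outside_disc) (simp add: \<rho>'_def)
            show "g ` ?D \<subseteq> \<Omega>" using D_sub g_rhp by auto
            show "g ` ?D \<inter> C (Suc n) = {}" using far D_sub by (auto simp: \<rho>'_def)
            show "V (Suc n) \<inter> g ` ?D \<noteq> {}" using \<open>w m \<in> ?D\<close> \<open>g (w m) \<in> V (Suc n)\<close> by blast
          qed simp
          moreover have "1 \<le> \<rho>'" by (simp add: \<rho>'_def)
          then have "complex_of_real (\<rho>' + 1) \<in> ?D" by (simp del: of_real_add)
          ultimately have "g (complex_of_real (\<rho>' + 1)) \<in> V (Suc n)" by blast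
          moreover have "1 \<le> Re (complex_of_real (\<rho>' + 1))" using \<open>1 \<le> \<rho>'\<close> by simp
          ultimately show False using no mono[of N "Suc n"] n N by (meson le_SucI subsetD)
        qed
      qed simp
      then show ?thesis using \<gamma>(4,5) by auto
    qed
    \<comment> \<open>\<open>L\<close> would be a common point of the closures of two consecutive
      crosscuts.\<close>
    show False using L_end[of N] L_end[of "Suc N"] disj_closure[of "Suc N"] by auto
  qed
  \<comment> \<open>A fixed witness: \<open>E\<close> is connected, meets \<open>V n\<close>, and
    its point \<open>g 1\<close> is eventually outside \<open>V n\<close>, so \<open>E\<close> has
    to meet \<open>C n\<close>.\<close>
  have g1: "g 1 \<in> E" "g 1 \<in> \<Omega>" using E(2) by (auto simp: E_def)
  have "\<forall>\<^sub>F n in sequentially. V n \<inter> {g 1} = {}"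
    by (rule leaves) (use g1 in auto)
  with eventually_ge_at_top[of 1] have "\<forall>\<^sub>F n in sequentially. C n \<inter> E \<noteq> {}"
  proof eventually_elim
    case (elim n)
    show ?case
    proof
      assume "C n \<inter> E = {}"
      then have "E \<subseteq> V n" using E_V[OF elim(1)] elim(1) by (intro V_max E) auto
      then show False using elim(2) g1(1) by auto
    qed
  qed
  then show ?thesis using that[OF \<sigma>1] by (simp add: E_def g_def)
qed

section \<open>Horospheres, \<open>H\<close>-limits and prime ends\<close>

lemma tendsto_halfplane_at_infinityI:
  fixes f :: "complex \<Rightarrow> 'a::metric_space"
  assumes "\<And>x. (\<And>n. c \<le> Re (x n)) \<Longrightarrow> filterlim x at_infinity sequentially \<Longrightarrow>
    \<exists>r. strict_mono (r :: nat \<Rightarrow> nat) \<and> (\<lambda>n. f (x (r n))) \<longlonglongrightarrow> l"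
  shows "(f \<longlongrightarrow> l) (halfplane_at_infinity c)"
proof (rule tendstoI, rule ccontr)
  fix e :: real assume e: "e > 0" and "\<not> (\<forall>\<^sub>F w in halfplane_at_infinity c. dist (f w) l < e)"
  then have "\<forall>b. \<exists>w. c \<le> Re w \<and> b \<le> cmod w \<and> e \<le> dist (f w) l"
    unfolding eventually_halfplane_at_infinity by (auto simp: not_less)
  then have "\<forall>n. \<exists>w. c \<le> Re w \<and> real n \<le> cmod w \<and> e \<le> dist (f w) l" by blast
  from choice[OF this] obtain x where
    x: "\<And>n. c \<le> Re (x n)" "\<And>n. real n \<le> cmod (x n)" "\<And>n. e \<le> dist (f (x n)) l" by auto
  have "filterlim x at_infinity sequentially"
    unfolding filterlim_at_infinity_conv_norm_at_top
    by (rule filterlim_at_top_mono[OF filterlim_real_sequentially]) (use x(2) in simp)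
  then obtain r where "strict_mono (r :: nat \<Rightarrow> nat)" "(\<lambda>n. f (x (r n))) \<longlonglongrightarrow> l"
    using assms[of x, OF x(1)] by blast
  then have "\<forall>\<^sub>F n in sequentially. dist (f (x (r n))) l < e" using tendstoD e by blast
  then obtain n where "dist (f (x (r n))) l < e" using eventually_happens sequentially_bot by blast
  then show False using x(3)[of "r n"] by simp
qed

lemma has_H_limit_iff:
  assumes \<sigma>: "cmod \<sigma> = 1"
  shows "has_H_limit h \<sigma> \<longleftrightarrow> (\<exists>L. halfplane_limit (h \<circ> cayley \<sigma>) L)"
proof
  assume "has_H_limit h \<sigma>"
  then obtain L where L: "\<And>z. (\<And>n. z n \<in> ball 0 1) \<Longrightarrow> z \<longlonglongrightarrow> \<sigma> \<Longrightarrow>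
      \<exists>R>0. \<forall>\<^sub>F n in sequentially. z n \<in> disc_horosphere \<sigma> R \<Longrightarrow> (\<lambda>n. Pt (h (z n))) \<longlonglongrightarrow> L"
    unfolding has_H_limit_def by blast
  have "((\<lambda>w. Pt ((h \<circ> cayley \<sigma>) w)) \<longlongrightarrow> L) (halfplane_at_infinity c)" if c: "c > 0" for c
  proof (rule tendsto_halfplane_at_infinityI)
    fix x :: "nat \<Rightarrow> complex" assume x: "\<And>n. c \<le> Re (x n)" "filterlim x at_infinity sequentially"
    \<comment> \<open>The closed half plane \<open>c \<le> Re w\<close> lies in the open one
      \<open>c / 2 < Re w\<close>, which corresponds to the horosphere of radius
      \<open>2 / c\<close>.\<close>
    have "1 / (2 / c) < Re (x n)" for n using x(1)[of n] c by simp
    then have "cayley \<sigma> (x n) \<in> disc_horosphere \<sigma> (2 / c)" for n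
      using cayley_image_halfplane[OF \<sigma>, of "2 / c"] c by auto
    moreover from this have "cayley \<sigma> (x n) \<in> ball 0 1" for n by (simp add: disc_horosphere_def)
    moreover have "(\<lambda>n. cayley \<sigma> (x n)) \<longlonglongrightarrow> \<sigma>" by (rule tendsto_cayley[OF \<sigma> x(2)])
    ultimately have "(\<lambda>n. Pt (h (cayley \<sigma> (x n)))) \<longlonglongrightarrow> L"
      using c by (intro L exI[of _ "2 / c"]) auto
    then show "\<exists>r. strict_mono (r :: nat \<Rightarrow> nat) \<and> (\<lambda>n. Pt ((h \<circ> cayley \<sigma>) (x (r n)))) \<longlonglongrightarrow> L"
      by (intro exI[of _ id]) (simp add: strict_mono_id)
  qed
  then show "\<exists>L. halfplane_limit (h \<circ> cayley \<sigma>) L" unfolding halfplane_limit_def by blast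
next
  assume "\<exists>L. halfplane_limit (h \<circ> cayley \<sigma>) L"
  then obtain L where L: "halfplane_limit (h \<circ> cayley \<sigma>) L" by blast
  have "(\<lambda>n. Pt (h (z n))) \<longlonglongrightarrow> L"
    if z: "\<And>n. z n \<in> ball 0 1" "z \<longlonglongrightarrow> \<sigma>" and R: "R > 0" "\<forall>\<^sub>F n in sequentially. z n \<in> disc_horosphere \<sigma> R"
    for z R
  proof -
    have "filterlim (\<lambda>n. inv_cayley \<sigma> (z n)) at_infinity sequentially"
      by (rule filterlim_inv_cayley[OF \<sigma> z(2)]) (use z(1) in simp)
    moreover have "\<forall>\<^sub>F n in sequentially. 1 / R \<le> Re (inv_cayley \<sigma> (z n))"
      using R(2) by eventually_elim (use disc_horosphere_iff[OF \<sigma> R(1) z(1)] in \<open>simp add: less_imp_le\<close>)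
    ultimately have "filterlim (\<lambda>n. inv_cayley \<sigma> (z n)) (halfplane_at_infinity (1 / R)) sequentially"
      by (simp add: filterlim_halfplane_at_infinity)
    moreover have "((\<lambda>w. Pt ((h \<circ> cayley \<sigma>) w)) \<longlongrightarrow> L) (halfplane_at_infinity (1 / R))"
      using L R(1) by (simp add: halfplane_limit_def)
    ultimately have "(\<lambda>n. Pt ((h \<circ> cayley \<sigma>) (inv_cayley \<sigma> (z n)))) \<longlonglongrightarrow> L"
      using filterlim_compose by blast
    then show ?thesis by (simp add: cayley_inv_cayley[OF \<sigma> z(1)])
  qed
  then show "has_H_limit h \<sigma>" unfolding has_H_limit_def by blast
qed

lemma horosphere_image:
  assumes "cmod \<sigma> = 1" "R > 0"
  shows "h ` disc_horosphere \<sigma> R = (h \<circ> cayley \<sigma>) ` {w. 1 / R < Re w}"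
  unfolding cayley_image_halfplane[OF assms, symmetric] by (simp add: image_comp)

text \<open>Only sequences escaping to infinity can produce boundary values: a bounded one
  accumulates at some \<open>v\<close> with \<open>Re v \<ge> c > 0\<close>, where
  \<open>g v\<close> belongs to \<Omega>.\<close>

lemma halfplane_limit_closure_boundary:
  assumes g: "biholomorphism g rhp \<Omega>" and "open \<Omega>" and L: "halfplane_limit g L" and c: "c > 0"
  shows "sphere_closure (g ` {w. c < Re w}) \<inter> sphere_boundary \<Omega> = {L}"
proof -
  have g_rhp: "g w \<in> \<Omega>" if "w \<in> rhp" for w using g that by (auto simp: biholomorphism_def bij_betw_def)
  have Lc: "((\<lambda>w. Pt (g w)) \<longlongrightarrow> L) (halfplane_at_infinity c)" using L c by (simp add: halfplane_limit_def)
  have "p = L" if p: "p \<in> sphere_closure (g ` {w. c < Re w})" "p \<in> sphere_boundary \<Omega>" for p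
  proof -
    obtain y where y: "\<And>n. y n \<in> Pt ` g ` {w. c < Re w}" "y \<longlonglongrightarrow> p"
      using p(1) unfolding sphere_closure_def closure_sequential by blast
    have "\<forall>n. \<exists>w. c < Re w \<and> y n = Pt (g w)" using y(1) by blast
    from choice[OF this] obtain x where x: "\<And>n. c < Re (x n)" "\<And>n. y n = Pt (g (x n))" by auto
    have "filterlim x at_infinity sequentially"
    proof (rule ccontr)
      assume "\<not> ?thesis"
      then obtain B where "\<not> (\<forall>\<^sub>F n in sequentially. B \<le> cmod (x n))"
        unfolding filterlim_at_infinity_conv_norm_at_top filterlim_at_top by blast
      then obtain r where r: "strict_mono (r :: nat \<Rightarrow> nat)" "\<And>n. \<not> B \<le> cmod (x (r n))"
        using not_eventually_sequentiallyD by blast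
      have "x (r n) \<in> cball 0 B" for n using r(2)[of n] by simp
      then obtain v s where s: "strict_mono (s :: nat \<Rightarrow> nat)" and v: "(\<lambda>n. x (r (s n))) \<longlonglongrightarrow> v"
        by (rule compact_convergent_subsequence[OF compact_cball]) (rule that)
      have "c \<le> Re v"
        by (rule LIMSEQ_le_const[OF tendsto_Re[OF v]]) (use x(1) in \<open>auto intro: less_imp_le\<close>)
      then have "v \<in> rhp" using c by (simp add: rhp_def)
      have "isCont g v"
        using g \<open>v \<in> rhp\<close> open_rhp holomorphic_on_imp_continuous_on[of g rhp]
        by (simp add: biholomorphism_def continuous_on_eq_continuous_at)
      then have "(\<lambda>n. g (x (r (s n)))) \<longlonglongrightarrow> g v" using v by (rule isCont_tendsto_compose)
      then have "(\<lambda>n. y (r (s n))) \<longlonglongrightarrow> Pt (g v)" by (simp add: x(2) tendsto_Pt_iff)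
      moreover have "(\<lambda>n. y (r (s n))) \<longlonglongrightarrow> p"
        using filterlim_compose[OF y(2) filterlim_compose[OF filterlim_subseq[OF r(1)] filterlim_subseq[OF s]]] .
      ultimately have "p = Pt (g v)" using LIMSEQ_unique by blast
      then show False using p(2) sphere_boundary_eq[OF \<open>open \<Omega>\<close>] g_rhp[OF \<open>v \<in> rhp\<close>] by auto
    qed
    then have "filterlim x (halfplane_at_infinity c) sequentially"
      using x(1) by (simp add: filterlim_halfplane_at_infinity less_imp_le)
    from filterlim_compose[OF Lc this] have "y \<longlonglongrightarrow> L" by (simp flip: x(2))
    then show "p = L" using y(2) LIMSEQ_unique by blast
  qed
  moreover have "L \<in> sphere_boundary \<Omega>" by (rule halfplane_limit_in_boundary[OF g \<open>open \<Omega>\<close> L])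
  moreover have "L \<in> sphere_closure (g ` {w. c < Re w})"
  proof -
    define x where "x n = complex_of_real (c + 1 + real n)" for n
    have x: "c < Re (x n)" "real n \<le> cmod (x n)" for n
      using c by (auto simp: x_def simp del: of_real_add)
    have "filterlim x at_infinity sequentially"
      unfolding filterlim_at_infinity_conv_norm_at_top
      by (rule filterlim_at_top_mono[OF filterlim_real_sequentially]) (use x(2) in simp)
    then have "filterlim x (halfplane_at_infinity c) sequentially"
      using x(1) by (simp add: filterlim_halfplane_at_infinity less_imp_le)
    from filterlim_compose[OF Lc this] show ?thesis
      unfolding sphere_closure_def closure_sequential
      using x(1) by (intro exI[of _ "\<lambda>n. Pt (g (x n))"]) auto
  qed
  ultimately show ?thesis by blast
qed

text \<open>Horospheres at the same boundary point are nested, so their unique boundary points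
  coincide. The sphere being compact, this point is the only possible cluster value of
  \<open>g\<close> at infinity within a half plane.\<close>

lemma halfplane_limit_of_horospheres:
  assumes g: "biholomorphism g rhp \<Omega>" and "open \<Omega>"
    and uniq: "\<And>c. c > 0 \<Longrightarrow> \<exists>!p. p \<in> sphere_closure (g ` {w. c < Re w}) \<inter> sphere_boundary \<Omega>"
  shows "\<exists>L. halfplane_limit g L"
proof -
  let ?A = "\<lambda>c. sphere_closure (g ` {w. c < Re w}) \<inter> sphere_boundary \<Omega>"
  have mono: "?A c' \<subseteq> ?A c" if "c \<le> c'" for c c' :: real
  proof -
    have "Pt ` g ` {w. c' < Re w} \<subseteq> Pt ` g ` {w. c < Re w}" using that by (intro image_mono) auto
    then show ?thesis unfolding sphere_closure_def using closure_mono by blast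
  qed
  obtain L where L: "L \<in> ?A 1" using uniq[of 1] by auto
  have eq: "p = L" if "p \<in> ?A c" "c > 0" for p c
  proof -
    have "0 < max c 1" by (simp add: less_max_iff_disj)
    from ex1_implies_ex[OF uniq[OF this]] obtain p0 where p0: "p0 \<in> ?A (max c 1)" by (rule exE)
    have "p0 \<in> ?A c" "p0 \<in> ?A 1" using p0 mono[of c "max c 1"] mono[of 1 "max c 1"] by auto
    then have "p0 = p" "p0 = L" using uniq[OF \<open>c > 0\<close>] uniq[of 1] that(1) L by auto
    then show ?thesis by simp
  qed
  have "((\<lambda>w. Pt (g w)) \<longlongrightarrow> L) (halfplane_at_infinity c)" if c: "c > 0" for c
  proof (rule tendsto_halfplane_at_infinityI)
    fix x :: "nat \<Rightarrow> complex" assume x: "\<And>n. c \<le> Re (x n)" "filterlim x at_infinity sequentially"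
    obtain q r where r: "strict_mono (r :: nat \<Rightarrow> nat)" and q: "(\<lambda>n. Pt (g (x (r n)))) \<longlonglongrightarrow> q"
      by (rule compact_convergent_subsequence[OF compact_riemann_sphere, of "\<lambda>n. Pt (g (x n))"])
        (auto intro: that)
    have half: "c / 2 < Re (x n)" for n using x(1)[of n] c by simp
    have "x n \<in> rhp" for n using x(1)[of n] c by (simp add: rhp_def)
    then have "q \<in> sphere_boundary \<Omega>"
      by (rule escaping_limit_in_boundary[OF g \<open>open \<Omega>\<close> _ filterlim_compose[OF x(2) filterlim_subseq[OF r]] q])
    moreover have "q \<in> sphere_closure (g ` {w. c / 2 < Re w})"
      unfolding sphere_closure_def closure_sequential
      using q half by (intro exI[of _ "\<lambda>n. Pt (g (x (r n)))"]) auto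
    ultimately have "q = L" using eq[of q "c / 2"] c by simp
    then show "\<exists>r. strict_mono (r :: nat \<Rightarrow> nat) \<and> (\<lambda>n. Pt (g (x (r n)))) \<longlonglongrightarrow> L" using r q by blast
  qed
  then show ?thesis unfolding halfplane_limit_def by blast
qed

text \<open>The points \<open>w n\<close> of the half plane with \<open>g (w n)\<close> on
  \<open>C n\<close> escape to infinity, since bounded parts of \<open>Re w \<ge> 1\<close> have
  relatively compact images in \<Omega>, which late crosscuts avoid.\<close>

lemma null_chain_converges:
  assumes g: "biholomorphism g rhp \<Omega>" and "open \<Omega>" and L: "halfplane_limit g L"
    and C: "C \<in> null_chains \<Omega>"
    and meets: "\<forall>\<^sub>F n in sequentially. C n \<inter> g ` {w. 1 \<le> Re w} \<noteq> {}" and z: "\<And>n. z n \<in> C n"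
  shows "(\<lambda>n. Pt (z n)) \<longlonglongrightarrow> L"
proof -
  have g_rhp: "g w \<in> \<Omega>" if "w \<in> rhp" for w using g that by (auto simp: biholomorphism_def bij_betw_def)
  have g_cont: "continuous_on rhp g" using g by (simp add: biholomorphism_def holomorphic_on_imp_continuous_on)
  have "\<forall>n. \<exists>w. C n \<inter> g ` {w. 1 \<le> Re w} \<noteq> {} \<longrightarrow> 1 \<le> Re w \<and> g w \<in> C n" by blast
  from choice[OF this] obtain w where
    w: "\<And>n. C n \<inter> g ` {w. 1 \<le> Re w} \<noteq> {} \<Longrightarrow> 1 \<le> Re (w n) \<and> g (w n) \<in> C n" by auto
  have ev: "\<forall>\<^sub>F n in sequentially. 1 \<le> Re (w n) \<and> g (w n) \<in> C n"
    using meets by eventually_elim (rule w)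
  have "\<forall>\<^sub>F n in sequentially. B \<le> cmod (w n)" for B
  proof -
    let ?S = "cball 0 B \<inter> {w. 1 \<le> Re w}"
    have S: "?S \<subseteq> rhp" by (auto simp: rhp_def)
    have "compact (g ` ?S)"
      by (intro compact_continuous_image continuous_on_subset[OF g_cont S] compact_Int_closed
          compact_cball closed_halfspace_Re_ge)
    then have "\<forall>\<^sub>F n in sequentially. C n \<inter> g ` ?S = {}"
      by (rule null_chain_leaves_compact[OF C \<open>open \<Omega>\<close>]) (use S g_rhp in auto)
    with ev show ?thesis
    proof eventually_elim
      case (elim n)
      then have "w n \<notin> ?S" by blast
      then show ?case using elim(1) by simp
    qed
  qed
  then have "filterlim w at_infinity sequentially"
    unfolding filterlim_at_infinity_conv_norm_at_top filterlim_at_top by blast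
  then have "filterlim w (halfplane_at_infinity 1) sequentially"
    using ev by (auto simp: filterlim_halfplane_at_infinity elim: eventually_mono)
  moreover have "((\<lambda>w. Pt (g w)) \<longlongrightarrow> L) (halfplane_at_infinity 1)"
    using L by (simp add: halfplane_limit_def)
  ultimately have lim: "(\<lambda>n. Pt (g (w n))) \<longlonglongrightarrow> L" using filterlim_compose by blast
  have "(\<lambda>n. dist (Pt (z n)) L) \<longlonglongrightarrow> 0"
  proof (rule Lim_null_comparison)
    show "\<forall>\<^sub>F n in sequentially. norm (dist (Pt (z n)) L) \<le> diameter (Pt ` C n) + dist (Pt (g (w n))) L"
      using ev
    proof eventually_elim
      case (elim n)
      have "dist (Pt (z n)) (Pt (g (w n))) \<le> diameter (Pt ` C n)"
        using z[of n] elim by (intro dist_le_sphere_diameter) auto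
      then show ?case using dist_triangle[of "Pt (z n)" L "Pt (g (w n))"] by simp
    qed
    have "(\<lambda>n. diameter (Pt ` C n)) \<longlonglongrightarrow> 0" using C by (simp add: null_chains_def)
    from tendsto_add[OF this iffD1[OF tendsto_dist_iff lim]]
    show "(\<lambda>n. diameter (Pt ` C n) + dist (Pt (g (w n))) L) \<longlonglongrightarrow> 0" by simp
  qed
  then show ?thesis by (rule iffD2[OF tendsto_dist_iff])
qed

section \<open>Equivalent null-chains and the principal part\<close>

lemma separates_commute: "separates \<Omega> C A B \<longleftrightarrow> separates \<Omega> C B A"
  unfolding separates_def by blast

text \<open>This puts a chain into the class it generates, so that the principal part is not empty.
  For \<open>m \<ge> 1\<close> the witness is \<open>n = 0\<close> replaced by \<open>Suc m\<close>,
  the crosscut just behind \<open>C m\<close>.\<close>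

lemma null_chain_equiv_refl:
  assumes "C \<in> null_chains \<Omega>"
  shows "(C, C) \<in> null_chain_equiv \<Omega>"
proof -
  have "\<forall>\<^sub>F m in sequentially. \<exists>n. separates \<Omega> (C m) (C n) (C 0) \<and> separates \<Omega> (C m) (C n) (C 0)"
    using eventually_ge_at_top[of 1]
  proof eventually_elim
    case (elim m)
    then have "separates \<Omega> (C m) (C 0) (C (Suc m))" using assms by (simp add: null_chains_def)
    then show ?case using separates_commute by blast
  qed
  then show ?thesis using assms by (simp add: null_chain_equiv_def)
qed

text \<open>A late crosscut \<open>C' m\<close> separates \<open>C 0\<close> from some
  \<open>C n\<close> that meets \<open>E\<close>, while the fixed point \<open>b\<close> of
  \<open>E\<close> lies on the side of \<open>C 0\<close>. Being connected, \<open>E\<close> has to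
  meet \<open>C' m\<close>.\<close>

lemma equivalent_null_chain_meets:
  assumes h: "riemann_map \<Omega> h" and "open \<Omega>" and equiv: "(C, C') \<in> null_chain_equiv \<Omega>"
    and E: "connected E" "E \<subseteq> \<Omega>" and meets: "\<forall>\<^sub>F n in sequentially. C n \<inter> E \<noteq> {}"
  shows "\<forall>\<^sub>F m in sequentially. C' m \<inter> E \<noteq> {}"
proof -
  have C: "C \<in> null_chains \<Omega>" "C' \<in> null_chains \<Omega>"
    and sep: "\<forall>\<^sub>F m in sequentially. \<exists>n. separates \<Omega> (C' m) (C n) (C 0)"
    using equiv by (auto simp: null_chain_equiv_def elim: eventually_mono)
  have cc: "crosscut \<Omega> (C n)" for n using C(1) by (simp add: null_chains_def)
  note top = crosscut_topology[OF cc \<open>open \<Omega>\<close>]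
  obtain N where N: "\<And>n. n \<ge> N \<Longrightarrow> C n \<inter> E \<noteq> {}"
    using meets unfolding eventually_sequentially by blast
  then obtain b where b: "b \<in> E" by blast
  have "\<forall>n. \<exists>a. a \<in> C n" using top(1) by blast
  from choice[OF this] obtain a where a: "\<And>n. a n \<in> C n" by auto
  have a\<Omega>: "a n \<in> \<Omega>" for n using a top(4) by blast
  \<comment> \<open>Points of the crosscuts with index up to \<open>N\<close> are kept on the side
    of \<open>C 0\<close>, which forces the separated \<open>C n\<close> to have
    \<open>n > N\<close>, where it is known to meet \<open>E\<close>.\<close>
  let ?P = "insert b (a ` {..N})"
  have "compact ?P" by (intro finite_imp_compact) auto
  moreover have "?P \<subseteq> \<Omega>" using a\<Omega> b E(2) by auto
  ultimately obtain K where K: "connected K" "?P \<subseteq> K" "K \<subseteq> \<Omega>" "\<forall>\<^sub>F n in sequentially. C' n \<inter> K = {}"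
    by (rule null_chain_avoids_connected[OF h C(2) \<open>open \<Omega>\<close>]) (rule that)
  from K(4) sep show ?thesis
  proof eventually_elim
    case (elim m)
    then obtain n U V where UV: "U \<in> components (\<Omega> - C' m)" "V \<in> components (\<Omega> - C' m)" "U \<noteq> V"
      "C n \<subseteq> U" "C 0 \<subseteq> V" unfolding separates_def by blast
    have disj: "U \<inter> V = {}" using UV components_nonoverlap by blast
    have "a 0 \<in> V \<inter> K" using a[of 0] UV(5) K(2) by auto
    then have "K \<subseteq> V"
      by (intro components_maximal[OF UV(2) K(1)]) (use K(3) elim(1) in auto)
    have "n \<ge> N"
    proof (rule ccontr)
      assume "\<not> n \<ge> N"
      then have "a n \<in> a ` {..N}" by (intro imageI) simp
      then have "a n \<in> V" using K(2) \<open>K \<subseteq> V\<close> by blast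
      then show False using a[of n] UV(4) disj by blast
    qed
    then have "U \<inter> E \<noteq> {}" using N UV(4) by blast
    show ?case
    proof
      assume "C' m \<inter> E = {}"
      then have "E \<subseteq> U" by (intro components_maximal[OF UV(1) E(1) _ \<open>U \<inter> E \<noteq> {}\<close>]) (use E(2) in blast)
      then show False using b K(2) \<open>K \<subseteq> V\<close> disj by blast
    qed
  qed
qed

lemma principal_part_singleton:
  assumes h: "riemann_map \<Omega> h" and \<Omega>: "open \<Omega>" "connected \<Omega>" "\<Omega> \<noteq> UNIV"
    and lim: "\<And>\<sigma>. cmod \<sigma> = 1 \<Longrightarrow> \<exists>L. halfplane_limit (h \<circ> cayley \<sigma>) L"
    and \<xi>: "\<xi> \<in> prime_ends \<Omega>"
  shows "\<exists>p. principal_part \<xi> = {p}"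
proof -
  obtain C where C: "C \<in> null_chains \<Omega>" and \<xi>_eq: "\<xi> = null_chain_equiv \<Omega> `` {C}"
    using \<xi> unfolding prime_ends_def by (elim quotientE)
  obtain \<sigma> where \<sigma>: "cmod \<sigma> = 1"
    and meets: "\<forall>\<^sub>F n in sequentially. C n \<inter> (h \<circ> cayley \<sigma>) ` {w. 1 \<le> Re w} \<noteq> {}"
    by (rule null_chain_meets_halfplane[OF h C \<Omega> lim]) (assumption | rule that)+
  define g where "g = h \<circ> cayley \<sigma>"
  have g: "biholomorphism g rhp \<Omega>"
    unfolding g_def by (rule biholomorphism_compose[OF cayley_biholomorphism[OF \<sigma>] h])
  obtain L where L: "halfplane_limit g L" using lim[OF \<sigma>] by (auto simp: g_def)
  have E_sub: "{w. 1 \<le> Re w} \<subseteq> rhp" by (auto simp: rhp_def)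
  have g_cont: "continuous_on rhp g" using g by (simp add: biholomorphism_def holomorphic_on_imp_continuous_on)
  have E: "connected (g ` {w. 1 \<le> Re w})" "g ` {w. 1 \<le> Re w} \<subseteq> \<Omega>"
    by (intro connected_continuous_image continuous_on_subset[OF g_cont E_sub] convex_connected
        convex_halfspace_Re_ge) (use E_sub g in \<open>auto simp: biholomorphism_def bij_betw_def\<close>)
  have conv: "(\<lambda>n. Pt (z n)) \<longlonglongrightarrow> L" if C': "C' \<in> \<xi>" and z: "\<And>n. z n \<in> C' n" for C' z
  proof -
    have equiv: "(C, C') \<in> null_chain_equiv \<Omega>" using C' by (simp add: \<xi>_eq)
    then have "C' \<in> null_chains \<Omega>" by (simp add: null_chain_equiv_def)
    moreover have "\<forall>\<^sub>F m in sequentially. C' m \<inter> g ` {w. 1 \<le> Re w} \<noteq> {}"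
      by (rule equivalent_null_chain_meets[OF h \<Omega>(1) equiv E]) (use meets in \<open>simp add: g_def\<close>)
    ultimately show ?thesis by (rule null_chain_converges[OF g \<Omega>(1) L _ _ z])
  qed
  have "crosscut \<Omega> (C n)" for n using C by (simp add: null_chains_def)
  then have "\<forall>n. \<exists>z. z \<in> C n" using crosscut_topology(1)[OF _ \<Omega>(1)] by blast
  from choice[OF this] obtain z where z: "\<And>n. z n \<in> C n" by auto
  have "C \<in> \<xi>" using null_chain_equiv_refl[OF C] by (simp add: \<xi>_eq)
  then have "(\<lambda>n. Pt (z n)) \<longlonglongrightarrow> L" using z by (rule conv)
  then have "L \<in> principal_part \<xi>" using z \<open>C \<in> \<xi>\<close> unfolding principal_part_def by blast
  moreover have "p = L" if "p \<in> principal_part \<xi>" for p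
    using that conv LIMSEQ_unique unfolding principal_part_def by blast
  ultimately show ?thesis by blast
qed

lemma riemann_map_exists:
  assumes "open \<Omega>" "simply_connected \<Omega>" "\<Omega> \<noteq> {}" "\<Omega> \<noteq> UNIV"
  obtains h where "riemann_map \<Omega> h"
proof -
  obtain f h where "f holomorphic_on \<Omega>" "h holomorphic_on ball 0 1"
    "\<forall>z\<in>\<Omega>. f z \<in> ball 0 1 \<and> h (f z) = z" "\<forall>z\<in>ball 0 1. h z \<in> \<Omega> \<and> f (h z) = z"
    using iffD1[OF Riemann_mapping_theorem conjI[OF assms(1,2)]] assms(3,4) by blast
  then show ?thesis by (intro that[of h] biholomorphismI[where g = f]) auto
qed

theorem theorem1p4:
  fixes \<Omega> :: "complex set"
  assumes "open \<Omega>" and "connected \<Omega>" and "\<Omega> \<noteq> {}"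
    and "simply_connected \<Omega>" and "\<Omega> \<noteq> UNIV"
  shows "(Denjoy_Wolff_property \<Omega> \<longleftrightarrow> (\<forall>g \<in> Aut_d \<Omega>. has_Denjoy_Wolff_point \<Omega> g)) \<and>
    ((\<forall>g \<in> Aut_d \<Omega>. has_Denjoy_Wolff_point \<Omega> g) \<longleftrightarrow>
       (\<forall>H \<in> horospheres \<Omega>. \<exists>!p. p \<in> sphere_closure H \<inter> sphere_boundary \<Omega>)) \<and>
    ((\<forall>H \<in> horospheres \<Omega>. \<exists>!p. p \<in> sphere_closure H \<inter> sphere_boundary \<Omega>) \<longleftrightarrow>
       (\<forall>h. riemann_map \<Omega> h \<longrightarrow> (\<forall>\<sigma> \<in> sphere 0 1. has_H_limit h \<sigma>))) \<and>
    (Denjoy_Wolff_property \<Omega> \<longrightarrow> (\<forall>\<xi> \<in> prime_ends \<Omega>. \<exists>p. principal_part \<xi> = {p}))"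
    (is "(?dw \<longleftrightarrow> ?aut) \<and> (?aut \<longleftrightarrow> ?horo) \<and> (?horo \<longleftrightarrow> ?H) \<and> (?dw \<longrightarrow> ?pp)")
proof -
  obtain h0 where h0: "riemann_map \<Omega> h0"
    by (rule riemann_map_exists[OF assms(1,4,3,5)]) (rule that)
  have g: "biholomorphism (h \<circ> cayley \<sigma>) rhp \<Omega>" if "riemann_map \<Omega> h" "cmod \<sigma> = 1" for h \<sigma>
    by (rule biholomorphism_compose[OF cayley_biholomorphism[OF that(2)] that(1)])
  \<comment> \<open>The condition with which all the others are compared. It speaks of every Riemann
    map, as the conditions on horospheres and H-limits do; the return to the Denjoy-Wolff Property
    applies it to \<open>h0\<close>.\<close>
  let ?hp = "\<forall>h \<sigma>. riemann_map \<Omega> h \<longrightarrow> cmod \<sigma> = 1 \<longrightarrow> (\<exists>L. halfplane_limit (h \<circ> cayley \<sigma>) L)"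
  have dw_aut: ?aut if ?dw
    using that by (auto simp: Denjoy_Wolff_property_def Aut_d_def)
  have aut_hp: ?hp if ?aut
    using halfplane_limit_of_automorphisms[OF g assms(5) that] by metis
  have hp_dw: ?dw if ?hp
    by (rule Denjoy_Wolff_of_halfplane_limits[OF h0 assms(1)]) (use that h0 in blast)
  have hp_H: "?hp \<longleftrightarrow> ?H" using has_H_limit_iff by auto
  have hp_horo: ?horo if hp: ?hp
  proof
    fix S assume "S \<in> horospheres \<Omega>"
    then obtain h \<sigma> R where S: "S = h ` disc_horosphere \<sigma> R" and h: "riemann_map \<Omega> h"
      and \<sigma>: "cmod \<sigma> = 1" and R: "R > 0" by (auto simp: horospheres_def)
    obtain L where "halfplane_limit (h \<circ> cayley \<sigma>) L" using hp h \<sigma> by blast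
    then have "sphere_closure S \<inter> sphere_boundary \<Omega> = {L}"
      unfolding S horosphere_image[OF \<sigma> R]
      using R by (intro halfplane_limit_closure_boundary[OF g[OF h \<sigma>] assms(1)]) auto
    then show "\<exists>!p. p \<in> sphere_closure S \<inter> sphere_boundary \<Omega>" by auto
  qed
  have horo_hp: ?hp if ?horo
  proof (intro allI impI)
    fix h \<sigma> assume h: "riemann_map \<Omega> h" and \<sigma>: "cmod \<sigma> = 1"
    show "\<exists>L. halfplane_limit (h \<circ> cayley \<sigma>) L"
    proof (rule halfplane_limit_of_horospheres[OF g[OF h \<sigma>] assms(1)])
      fix c :: real assume c: "c > 0"
      have "h ` disc_horosphere \<sigma> (1 / c) \<in> horospheres \<Omega>"
        unfolding horospheres_def
        by (intro CollectI exI[of _ h] exI[of _ \<sigma>] exI[of _ "1 / c"]) (use h \<sigma> c in simp)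
      moreover have "h ` disc_horosphere \<sigma> (1 / c) = (h \<circ> cayley \<sigma>) ` {w. c < Re w}"
        using horosphere_image[OF \<sigma>, of "1 / c" h] c by simp
      ultimately show "\<exists>!p. p \<in> sphere_closure ((h \<circ> cayley \<sigma>) ` {w. c < Re w}) \<inter> sphere_boundary \<Omega>"
        using that by simp
    qed
  qed
  have hp_pp: ?pp if ?hp
    using principal_part_singleton[OF h0 assms(1,2,5)] that h0 by blast
  show ?thesis
    using dw_aut aut_hp hp_dw hp_H hp_horo horo_hp hp_pp by blast
qed

end
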